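(* Let $X$ be a path-connected and locally contractible space with a residually finite fundamental group, and let $p\colon E\to X$ be a (Hurewicz) fibration whose fibres are compact, metrizable and totally path-disconnected. Then $p$ is an inverse limit of finite regular coverings if, and only if, it is regular, $\pi_1$-profinite and has a dense leaf.
   Context: Definitions. A Hurewicz fibration with totally path-disconnected fibres has unique path lifting; such a map is called a lifting projection. For $\tilde x\in E$ and a path $\alpha\colon I\to X$ with $\alpha(0)=p(\tilde x)$, write $\tilde x\alpha\in p^{-1}(\alpha(1))$ for the endpoint of the unique lift of $\alpha$ to $E$ starting at $\tilde x$; it depends only on the homotopy class of $\alpha$ rel endpoints. Fix $x_0\in X$, let $F=p^{-1}(x_0)$ with the subspace topology from $E$, and fix a base point $\tilde x_0\in F$. - A deck transformation of $p$ is a homeomorphism $\varphi\colon E\to E$ with $p\circ\varphi=p$; $A(p)$ is the group of all deck transformations. The map $p$ is regular if $A(p)$ acts transitively on the fibres of $p$. - A leaf of $E$ is a path-component of $E$; $p$ has a dense leaf if some leaf is dense in $E$. - $p$ (with compact fibres) is $\pi_1$-profinite if the map $\theta\colon\pi_1(X,x_0)\to F$, $\alpha\mapsto\tilde x_0\alpha$, is continuous, where $\pi_1(X,x_0)$ carries the profinite topology (the group topology in which the normal subgroups of finite index form a neighbourhood base at the identity). - $p$ is an inverse limit of finite regular coverings if there is an inverse system (indexed by a directed set) of finite-sheeted regular covering projections $p_i\colon\widetilde X_i\to X$ with path-connected total spaces $\widetilde X_i$, with bonding maps over $X$, such that $E$ is homeomorphic over $X$ to $\varprojlim\widetilde X_i$.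 A covering is regular if its deck transformations act transitively on its fibres. *)

theory Defs
  imports "HOL-Analysis.Analysis" "HOL-Algebra.Coset"
begin

text \<open>
  All spaces are abstract topologies (\<^typ>\<open>'a topology\<close>), because the inverse systems below are
  families of spaces. The library's paths with concatenation, covering spaces and homotopy of
  paths are tied to the class of topological spaces, hence their counterparts here.
\<close>

abbreviation unit_interval :: "real topology"
  where "unit_interval \<equiv> top_of_set {0..1}"

abbreviation fibre_set :: "'e topology \<Rightarrow> ('e \<Rightarrow> 'x) \<Rightarrow> 'x \<Rightarrow> 'e set"
  where "fibre_set E p x \<equiv> {e \<in> topspace E. p e = x}"

abbreviation fibre :: "'e topology \<Rightarrow> ('e \<Rightarrow> 'x) \<Rightarrow> 'x \<Rightarrow> 'e topology"
  where "fibre E p x \<equiv> subtopology E (fibre_set E p x)"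


section \<open>The fundamental group\<close>

definition path_homotopic :: "'x topology \<Rightarrow> (real \<Rightarrow> 'x) \<Rightarrow> (real \<Rightarrow> 'x) \<Rightarrow> bool" where
  "path_homotopic X \<alpha> \<beta> \<longleftrightarrow>
     homotopic_with (\<lambda>\<gamma>. \<gamma> 0 = \<alpha> 0 \<and> \<gamma> 1 = \<alpha> 1) unit_interval X \<alpha> \<beta>"

definition path_concat :: "(real \<Rightarrow> 'x) \<Rightarrow> (real \<Rightarrow> 'x) \<Rightarrow> real \<Rightarrow> 'x" where
  "path_concat \<alpha> \<beta> = (\<lambda>t. if t \<le> 1/2 then \<alpha> (2 * t) else \<beta> (2 * t - 1))"

definition loops :: "'x topology \<Rightarrow> 'x \<Rightarrow> (real \<Rightarrow> 'x) set" where
  "loops X x0 = {\<alpha>. pathin X \<alpha> \<and> \<alpha> 0 = x0 \<and> \<alpha> 1 = x0}"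

definition loop_class :: "'x topology \<Rightarrow> (real \<Rightarrow> 'x) \<Rightarrow> (real \<Rightarrow> 'x) set" where
  "loop_class X \<alpha> = {\<beta>. path_homotopic X \<alpha> \<beta>}"

definition fundamental_group :: "'x topology \<Rightarrow> 'x \<Rightarrow> (real \<Rightarrow> 'x) set monoid" where
  "fundamental_group X x0 =
     \<lparr>carrier = loop_class X ` loops X x0,
      mult = (\<lambda>A B. \<Union>\<alpha>\<in>A. \<Union>\<beta>\<in>B. loop_class X (path_concat \<alpha> \<beta>)),
      one = loop_class X (\<lambda>_. x0)\<rparr>"

lemma path_homotopic_iff:
  "path_homotopic X \<alpha> \<beta> \<longleftrightarrow>
     (\<exists>h. continuous_map (prod_topology unit_interval unit_interval) X h \<and>
          (\<forall>t\<in>{0..1}. h (0, t) = \<alpha> t) \<and> (\<forall>t\<in>{0..1}. h (1, t) = \<beta> t) \<and>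
          (\<forall>s\<in>{0..1}. h (s, 0) = \<alpha> 0 \<and> h (s, 1) = \<alpha> 1))"
  unfolding path_homotopic_def by (subst homotopic_with) auto

lemma path_homotopic_imp:
  assumes "path_homotopic X \<alpha> \<beta>"
  shows "pathin X \<alpha>" "pathin X \<beta>" "\<beta> 0 = \<alpha> 0" "\<beta> 1 = \<alpha> 1"
  using assms homotopic_with_imp_continuous_maps homotopic_with_imp_property
  unfolding path_homotopic_def pathin_def by blast+

lemma path_homotopic_refl: "pathin X \<alpha> \<Longrightarrow> path_homotopic X \<alpha> \<alpha>"
  by (simp add: path_homotopic_def pathin_def)

lemma path_homotopic_sym:
  assumes "path_homotopic X \<alpha> \<beta>" shows "path_homotopic X \<beta> \<alpha>"
  using assms path_homotopic_imp(3,4)[OF assms] homotopic_with_symD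
  unfolding path_homotopic_def by fastforce

lemma path_homotopic_trans:
  assumes "path_homotopic X \<alpha> \<beta>" "path_homotopic X \<beta> \<gamma>" shows "path_homotopic X \<alpha> \<gamma>"
  using assms path_homotopic_imp(3,4)[OF assms(1)] homotopic_with_trans
  unfolding path_homotopic_def by fastforce

lemma path_homotopic_reparam:
  assumes \<alpha>: "pathin X \<alpha>"
    and r: "continuous_on {0..1} r" "r ` {0..1} \<subseteq> {0..1}"
    and r': "continuous_on {0..1} r'" "r' ` {0..1} \<subseteq> {0..1}"
    and ends: "r 0 = r' 0" "r 1 = r' 1"
    and \<beta>: "\<And>t. t \<in> {0..1} \<Longrightarrow> \<beta> t = \<alpha> (r t)"
    and \<gamma>: "\<And>t. t \<in> {0..1} \<Longrightarrow> \<gamma> t = \<alpha> (r' t)"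
  shows "path_homotopic X \<beta> \<gamma>"
  unfolding path_homotopic_iff
proof (intro exI conjI ballI)
  let ?k = "\<lambda>z::real \<times> real. (1 - fst z) * r (snd z) + fst z * r' (snd z)"
  have "continuous_on ({0..1} \<times> {0..1}) ?k"
    by (intro continuous_intros continuous_on_compose2[OF r(1)] continuous_on_compose2[OF r'(1)]) auto
  moreover have "?k ` ({0..1} \<times> {0..1}) \<subseteq> {0..1}"
  proof clarify
    fix s t :: real assume st: "s \<in> {0..1}" "t \<in> {0..1}"
    have "r t \<in> {0..1}" "r' t \<in> {0..1}" using st r(2) r'(2) by blast+
    then show "?k (s, t) \<in> {0..1}"
      using st convexD[of "{0..1::real}" "r t" "r' t" "1 - s" s] by simp
  qed
  moreover have "prod_topology unit_interval unit_interval = top_of_set ({0..1::real} \<times> {0..1::real})"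
    by (simp flip: prod_topology_subtopology_eu)
  ultimately have "continuous_map (prod_topology unit_interval unit_interval) unit_interval ?k"
    by (simp add: continuous_map_in_subtopology image_subset_iff_funcset)
  then show "continuous_map (prod_topology unit_interval unit_interval) X (\<alpha> \<circ> ?k)"
    using \<alpha> continuous_map_compose unfolding pathin_def by blast
next
  fix s :: real
  have *: "(1 - s) * r 0 + s * r' 0 = r 0" "(1 - s) * r 1 + s * r' 1 = r 1"
    using ends by (simp_all add: algebra_simps)
  show "(\<alpha> \<circ> (\<lambda>z. (1 - fst z) * r (snd z) + fst z * r' (snd z))) (s, 0) = \<beta> 0"
       "(\<alpha> \<circ> (\<lambda>z. (1 - fst z) * r (snd z) + fst z * r' (snd z))) (s, 1) = \<beta> 1"
    by (simp_all add: * \<beta>)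
qed (simp_all add: \<beta> \<gamma>)

lemma path_homotopic_concat:
  assumes "path_homotopic X \<alpha> \<alpha>'" "path_homotopic X \<beta> \<beta>'" and ab: "\<alpha> 1 = \<beta> 0"
  shows "path_homotopic X (path_concat \<alpha> \<beta>) (path_concat \<alpha>' \<beta>')"
proof -
  let ?II = "prod_topology unit_interval unit_interval"
  obtain h where h: "continuous_map ?II X h" "\<And>t. t\<in>{0..1} \<Longrightarrow> h (0, t) = \<alpha> t"
      "\<And>t. t\<in>{0..1} \<Longrightarrow> h (1, t) = \<alpha>' t" "\<And>s. s\<in>{0..1} \<Longrightarrow> h (s, 0) = \<alpha> 0 \<and> h (s, 1) = \<alpha> 1"
    using assms(1) unfolding path_homotopic_iff by metis
  obtain k where k: "continuous_map ?II X k" "\<And>t. t\<in>{0..1} \<Longrightarrow> k (0, t) = \<beta> t"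
      "\<And>t. t\<in>{0..1} \<Longrightarrow> k (1, t) = \<beta>' t" "\<And>s. s\<in>{0..1} \<Longrightarrow> k (s, 0) = \<beta> 0 \<and> k (s, 1) = \<beta> 1"
    using assms(2) unfolding path_homotopic_iff by metis
  let ?m = "\<lambda>z::real \<times> real. if snd z \<le> 1/2 then (h \<circ> (\<lambda>z. (fst z, 2 * snd z))) z
                              else (k \<circ> (\<lambda>z. (fst z, 2 * snd z - 1))) z"
  have II: "?II = top_of_set ({0..1} \<times> {0..1})"
    by (simp flip: prod_topology_subtopology_eu)
  have "continuous_map ?II X ?m"
  proof (rule continuous_map_cases_le)
    show "continuous_map ?II euclideanreal snd" "continuous_map ?II euclideanreal (\<lambda>z. 1/2)"
      unfolding II by (auto intro!: continuous_intros)
    show "continuous_map (subtopology ?II {z \<in> topspace ?II. snd z \<le> 1/2}) X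
            (h \<circ> (\<lambda>z. (fst z, 2 * snd z)))"
      by (rule continuous_map_compose[OF _ h(1)], unfold II)
         (auto simp: subtopology_subtopology continuous_map_in_subtopology intro!: continuous_intros)
    show "continuous_map (subtopology ?II {z \<in> topspace ?II. 1/2 \<le> snd z}) X
            (k \<circ> (\<lambda>z. (fst z, 2 * snd z - 1)))"
      by (rule continuous_map_compose[OF _ k(1)], unfold II)
         (auto simp: subtopology_subtopology continuous_map_in_subtopology intro!: continuous_intros)
    show "(h \<circ> (\<lambda>z. (fst z, 2 * snd z))) z = (k \<circ> (\<lambda>z. (fst z, 2 * snd z - 1))) z"
      if "z \<in> topspace ?II" "snd z = 1/2" for z
    proof -
      obtain s t where "z = (s, t)" by fastforce
      then have "z = (s, t)" "s \<in> {0..1}" "2 * t = 1" using that unfolding II by auto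
      then show ?thesis using h(4)[of s] k(4)[of s] ab by simp
    qed
  qed
  then show ?thesis
    unfolding path_homotopic_iff path_concat_def
    using h(2,3,4) k(2,3,4) by (intro exI[of _ ?m]) auto
qed

lemma path_concat_ends [simp]: "path_concat \<alpha> \<beta> 0 = \<alpha> 0" "path_concat \<alpha> \<beta> 1 = \<beta> 1"
  by (simp_all add: path_concat_def)

lemma pathin_concat:
  assumes "pathin X \<alpha>" "pathin X \<beta>" "\<alpha> 1 = \<beta> 0" shows "pathin X (path_concat \<alpha> \<beta>)"
  using path_homotopic_concat path_homotopic_refl path_homotopic_imp(1) assms by metis

lemma path_homotopic_concat_assoc:
  assumes "pathin X \<alpha>" "pathin X \<beta>" "pathin X \<gamma>" "\<alpha> 1 = \<beta> 0" "\<beta> 1 = \<gamma> 0"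
  shows "path_homotopic X (path_concat (path_concat \<alpha> \<beta>) \<gamma>) (path_concat \<alpha> (path_concat \<beta> \<gamma>))"
proof -
  have conc: "pathin X (path_concat \<alpha> (path_concat \<beta> \<gamma>))"
    using assms by (simp add: pathin_concat)
  let ?r = "\<lambda>t::real. if t \<le> 1/2 then (if t \<le> 1/4 then 2 * t else t + 1/4) else t / 2 + 1/2"
  show ?thesis
  proof (rule path_homotopic_reparam[OF conc])
    have "continuous_on {0..1} (\<lambda>t::real. if t \<le> 1/4 then 2 * t else t + 1/4)"
      by (rule continuous_on_cases_le) (auto intro!: continuous_intros)
    then show "continuous_on {0..1} ?r"
      by (intro continuous_on_cases_le)
         (auto intro!: continuous_intros elim: continuous_on_subset)
    show "?r ` {0..1} \<subseteq> {0..1}" by auto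
    show "continuous_on {0..1} (\<lambda>t::real. t)" by (rule continuous_on_id)
    show "path_concat (path_concat \<alpha> \<beta>) \<gamma> t = path_concat \<alpha> (path_concat \<beta> \<gamma>) (?r t)" for t
    proof -
      consider "t \<le> 1/4" | "1/4 < t" "t \<le> 1/2" | "1/2 < t" by linarith
      then show ?thesis
      proof cases
        case 3
        then have "2 * (t / 2 + 1/2) - 1 = t" by (simp add: field_simps)
        then show ?thesis using 3 by (simp add: path_concat_def)
      qed (simp_all add: path_concat_def)
    qed
  qed auto
qed

lemma loop_class_eq_iff:
  "pathin X \<alpha> \<Longrightarrow> pathin X \<beta> \<Longrightarrow> loop_class X \<alpha> = loop_class X \<beta> \<longleftrightarrow> path_homotopic X \<alpha> \<beta>"
  unfolding loop_class_def
  by (blast intro: path_homotopic_refl path_homotopic_sym path_homotopic_trans)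

lemma loop_concat: "\<alpha> \<in> loops X x \<Longrightarrow> \<beta> \<in> loops X x \<Longrightarrow> path_concat \<alpha> \<beta> \<in> loops X x"
  by (simp add: loops_def pathin_concat)

lemma fundamental_group_mult:
  assumes "\<alpha> \<in> loops X x" "\<beta> \<in> loops X x"
  shows "loop_class X \<alpha> \<otimes>\<^bsub>fundamental_group X x\<^esub> loop_class X \<beta> = loop_class X (path_concat \<alpha> \<beta>)"
proof -
  have *: "loop_class X (path_concat \<alpha>' \<beta>') = loop_class X (path_concat \<alpha> \<beta>)"
    if "\<alpha>' \<in> loop_class X \<alpha>" "\<beta>' \<in> loop_class X \<beta>" for \<alpha>' \<beta>'
  proof -
    have "path_homotopic X (path_concat \<alpha> \<beta>) (path_concat \<alpha>' \<beta>')"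
      using that assms by (intro path_homotopic_concat) (simp_all add: loop_class_def loops_def)
    then show ?thesis
      using loop_class_eq_iff path_homotopic_imp(1,2) by blast
  qed
  have "\<alpha> \<in> loop_class X \<alpha>" "\<beta> \<in> loop_class X \<beta>"
    using assms by (simp_all add: loop_class_def loops_def path_homotopic_refl)
  then have "(\<Union>\<alpha>'\<in>loop_class X \<alpha>. \<Union>\<beta>'\<in>loop_class X \<beta>. loop_class X (path_concat \<alpha>' \<beta>')) =
      loop_class X (path_concat \<alpha> \<beta>)"
    using * by blast
  then show ?thesis
    by (simp add: fundamental_group_def)
qed

lemma group_fundamental_group:
  assumes "x0 \<in> topspace X" shows "group (fundamental_group X x0)"
proof (rule groupI)
  let ?G = "fundamental_group X x0"
  have carrier: "carrier ?G = loop_class X ` loops X x0" and one: "\<one>\<^bsub>?G\<^esub> = loop_class X (\<lambda>_. x0)"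
    by (simp_all add: fundamental_group_def)
  have const: "(\<lambda>_. x0) \<in> loops X x0" using assms by (simp add: loops_def)
  show "\<one>\<^bsub>?G\<^esub> \<in> carrier ?G" using const by (simp add: carrier one)
  show "A \<otimes>\<^bsub>?G\<^esub> B \<in> carrier ?G" if "A \<in> carrier ?G" "B \<in> carrier ?G" for A B
    using that by (auto simp: carrier fundamental_group_mult intro!: loop_concat)
  show "A \<otimes>\<^bsub>?G\<^esub> B \<otimes>\<^bsub>?G\<^esub> C = A \<otimes>\<^bsub>?G\<^esub> (B \<otimes>\<^bsub>?G\<^esub> C)"
    if ABC: "A \<in> carrier ?G" "B \<in> carrier ?G" "C \<in> carrier ?G" for A B C
  proof -
    obtain \<alpha> \<beta> \<gamma> where *: "\<alpha> \<in> loops X x0" "\<beta> \<in> loops X x0" "\<gamma> \<in> loops X x0"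
        "A = loop_class X \<alpha>" "B = loop_class X \<beta>" "C = loop_class X \<gamma>"
      using ABC by (auto simp: carrier)
    have "path_homotopic X (path_concat (path_concat \<alpha> \<beta>) \<gamma>) (path_concat \<alpha> (path_concat \<beta> \<gamma>))"
      using * by (intro path_homotopic_concat_assoc) (auto simp: loops_def)
    then have "loop_class X (path_concat (path_concat \<alpha> \<beta>) \<gamma>) =
               loop_class X (path_concat \<alpha> (path_concat \<beta> \<gamma>))"
      using loop_class_eq_iff path_homotopic_imp(1,2) by blast
    then show ?thesis
      by (simp add: * fundamental_group_mult loop_concat)
  qed
  show "\<one>\<^bsub>?G\<^esub> \<otimes>\<^bsub>?G\<^esub> A = A" if A: "A \<in> carrier ?G" for A
  proof -
    obtain \<alpha> where \<alpha>: "\<alpha> \<in> loops X x0" "A = loop_class X \<alpha>" using A by (auto simp: carrier)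
    have "path_homotopic X (path_concat (\<lambda>_. x0) \<alpha>) \<alpha>"
    proof (rule path_homotopic_reparam[of X \<alpha> "\<lambda>t. max 0 (2 * t - 1)" "\<lambda>t. t"])
      show "path_concat (\<lambda>_. x0) \<alpha> t = \<alpha> (max 0 (2 * t - 1))" for t
      proof (cases "t \<le> 1/2")
        case True
        then have "max 0 (2 * t - 1) = 0" by simp
        then show ?thesis using True \<alpha> by (simp add: path_concat_def loops_def)
      qed (simp add: path_concat_def)
    qed (use \<alpha> in \<open>auto simp: loops_def intro!: continuous_intros\<close>)
    then have "loop_class X (path_concat (\<lambda>_. x0) \<alpha>) = loop_class X \<alpha>"
      using loop_class_eq_iff path_homotopic_imp(1,2) by blast
    then show ?thesis
      by (simp add: \<alpha> const fundamental_group_mult one)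
  qed
  show "\<exists>B\<in>carrier ?G. B \<otimes>\<^bsub>?G\<^esub> A = \<one>\<^bsub>?G\<^esub>" if A: "A \<in> carrier ?G" for A
  proof -
    obtain \<alpha> where \<alpha>: "\<alpha> \<in> loops X x0" "A = loop_class X \<alpha>" using A by (auto simp: carrier)
    let ?\<beta> = "\<alpha> \<circ> (\<lambda>t. 1 - t)"
    have "continuous_map unit_interval unit_interval (\<lambda>t. 1 - t)"
      by (auto simp: continuous_map_in_subtopology intro!: continuous_intros)
    then have \<beta>: "?\<beta> \<in> loops X x0"
      using \<alpha>(1) continuous_map_compose[of unit_interval unit_interval "\<lambda>t. 1 - t" X \<alpha>]
      by (simp add: loops_def pathin_def)
    have "path_homotopic X (path_concat ?\<beta> \<alpha>) (\<lambda>_. x0)"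
    proof (rule path_homotopic_reparam[of X \<alpha> "\<lambda>t. \<bar>1 - 2 * t\<bar>" "\<lambda>_. 1"])
      show "path_concat ?\<beta> \<alpha> t = \<alpha> \<bar>1 - 2 * t\<bar>" for t
        by (auto simp: path_concat_def abs_if)
    qed (use \<alpha> in \<open>auto simp: loops_def intro!: continuous_intros\<close>)
    then have "loop_class X (path_concat ?\<beta> \<alpha>) = loop_class X (\<lambda>_. x0)"
      using loop_class_eq_iff path_homotopic_imp(1,2) by blast
    then have "loop_class X ?\<beta> \<otimes>\<^bsub>?G\<^esub> A = \<one>\<^bsub>?G\<^esub>"
      using \<alpha>(1) \<beta> by (simp only: \<alpha>(2) fundamental_group_mult one)
    then show ?thesis using \<beta> by (auto simp: carrier)
  qed
qed


section \<open>Residual finiteness and the profinite topology\<close>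

definition normal_finite_index :: "'g set \<Rightarrow> ('g, 'b) monoid_scheme \<Rightarrow> bool" where
  "normal_finite_index N G \<longleftrightarrow> N \<lhd> G \<and> finite (rcosets\<^bsub>G\<^esub> N)"

definition residually_finite :: "('g, 'b) monoid_scheme \<Rightarrow> bool" where
  "residually_finite G \<longleftrightarrow>
     group G \<and> (\<forall>g\<in>carrier G. g \<noteq> \<one>\<^bsub>G\<^esub> \<longrightarrow> (\<exists>N. normal_finite_index N G \<and> g \<notin> N))"

definition profinite_topology :: "('g, 'b) monoid_scheme \<Rightarrow> 'g topology" where
  "profinite_topology G =
     topology (\<lambda>U. U \<subseteq> carrier G \<and>
                   (\<forall>g\<in>U. \<exists>N. normal_finite_index N G \<and> l_coset G g N \<subseteq> U))"

lemma normal_finite_index_Int: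
  assumes "normal_finite_index H G" "normal_finite_index K G"
  shows "normal_finite_index (H \<inter> K) G"
proof -
  have HK: "H \<lhd> G" "K \<lhd> G" "finite (rcosets\<^bsub>G\<^esub> H)" "finite (rcosets\<^bsub>G\<^esub> K)"
    using assms by (auto simp: normal_finite_index_def)
  interpret H: normal H G by fact
  interpret K: normal K G by fact
  have "(H \<inter> K) #>\<^bsub>G\<^esub> a = (H #>\<^bsub>G\<^esub> a) \<inter> (K #>\<^bsub>G\<^esub> a)" if "a \<in> carrier G" for a
  proof -
    have "h = k" if "h \<in> H" "k \<in> K" "h \<otimes>\<^bsub>G\<^esub> a = k \<otimes>\<^bsub>G\<^esub> a" for h k
      using that \<open>a \<in> carrier G\<close> H.mem_carrier[of h] K.mem_carrier[of k] by simp
    then show ?thesis unfolding r_coset_def by blast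
  qed
  then have "rcosets\<^bsub>G\<^esub> (H \<inter> K) =
      (\<lambda>a. (H #>\<^bsub>G\<^esub> a) \<inter> (K #>\<^bsub>G\<^esub> a)) ` carrier G"
    by (simp add: RCOSETS_def UNION_singleton_eq_range cong: image_cong_simp)
  also have "\<dots> \<subseteq> (\<lambda>(A, B). A \<inter> B) ` ((rcosets\<^bsub>G\<^esub> H) \<times> (rcosets\<^bsub>G\<^esub> K))"
    by (auto simp: RCOSETS_def)
  finally have "finite (rcosets\<^bsub>G\<^esub> (H \<inter> K))"
    using HK(3,4) by (rule finite_subset[OF _ finite_imageI[OF finite_cartesian_product]])
  then show ?thesis
    using H.normal_subgroup_intersect HK by (auto simp: normal_finite_index_def)
qed

lemma openin_profinite_topology:
  "openin (profinite_topology G) U \<longleftrightarrow>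
     U \<subseteq> carrier G \<and> (\<forall>g\<in>U. \<exists>N. normal_finite_index N G \<and> l_coset G g N \<subseteq> U)"
proof -
  let ?P = "\<lambda>U g. \<exists>N. normal_finite_index N G \<and> l_coset G g N \<subseteq> U"
  have Int: "?P (S \<inter> T) g" if "?P S g" "?P T g" for S T g
  proof -
    obtain M N where "normal_finite_index M G" "l_coset G g M \<subseteq> S"
      "normal_finite_index N G" "l_coset G g N \<subseteq> T" using \<open>?P S g\<close> \<open>?P T g\<close> by blast
    then show ?thesis
      by (intro exI[of _ "M \<inter> N"]) (auto simp: normal_finite_index_Int l_coset_def)
  qed
  have "istopology (\<lambda>U. U \<subseteq> carrier G \<and> (\<forall>g\<in>U. ?P U g))"
    unfolding istopology_def
  proof (intro conjI allI impI ballI)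
    fix S T g
    assume "S \<subseteq> carrier G \<and> (\<forall>g\<in>S. ?P S g)" "T \<subseteq> carrier G \<and> (\<forall>g\<in>T. ?P T g)" "g \<in> S \<inter> T"
    then show "?P (S \<inter> T) g" using Int by blast
  next
    fix \<K> g assume "\<forall>K\<in>\<K>. K \<subseteq> carrier G \<and> (\<forall>g\<in>K. ?P K g)" "g \<in> \<Union>\<K>"
    then show "?P (\<Union>\<K>) g" by (meson Union_upper UnionE subset_trans)
  qed blast+
  then show ?thesis
    unfolding profinite_topology_def by (simp add: topology_inverse')
qed


section \<open>Local contractibility and Hurewicz fibrations\<close>

text \<open>Every neighbourhood \<^term>\<open>U\<close> of a point contains a neighbourhood \<^term>\<open>V\<close> that is contractible
  in \<^term>\<open>U\<close>.\<close>

definition locally_contractible_space :: "'x topology \<Rightarrow> bool" where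
  "locally_contractible_space X \<longleftrightarrow>
     (\<forall>U x. openin X U \<and> x \<in> U \<longrightarrow>
        (\<exists>V c. openin X V \<and> x \<in> V \<and> V \<subseteq> U \<and>
             homotopic_with (\<lambda>_. True) (subtopology X V) (subtopology X U) (\<lambda>v. v) (\<lambda>_. c)))"

definition homotopy_lifting_property ::
  "'y topology \<Rightarrow> 'e topology \<Rightarrow> 'x topology \<Rightarrow> ('e \<Rightarrow> 'x) \<Rightarrow> bool" where
  "homotopy_lifting_property Y E X p \<longleftrightarrow>
     (\<forall>f H. continuous_map Y E f \<and> continuous_map (prod_topology Y unit_interval) X H \<and>
            (\<forall>y\<in>topspace Y. H (y, 0) = p (f y)) \<longrightarrow>
        (\<exists>K. continuous_map (prod_topology Y unit_interval) E K \<and>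
             (\<forall>y\<in>topspace Y. K (y, 0) = f y) \<and>
             (\<forall>y\<in>topspace Y. \<forall>t\<in>{0..1}. p (K (y, t)) = H (y, t))))"

text \<open>The homotopy lifting property is required for all test spaces on one type. This type is large
  enough for the property to hold for test spaces on every type
  (\<open>hurewicz_fibration_lifting\<close> below).\<close>

definition hurewicz_fibration :: "'e topology \<Rightarrow> 'x topology \<Rightarrow> ('e \<Rightarrow> 'x) \<Rightarrow> bool" where
  "hurewicz_fibration E X p \<longleftrightarrow>
     continuous_map E X p \<and>
     (\<forall>Y :: ('e \<times> (real \<Rightarrow> 'x)) topology. homotopy_lifting_property Y E X p)"

lemma hurewicz_fibration_lifting:
  fixes Y :: "'y topology" and E :: "'e topology" and X :: "'x topology"
  assumes p: "hurewicz_fibration E X p"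
  shows "homotopy_lifting_property Y E X p"
  unfolding homotopy_lifting_property_def
proof (intro allI impI, elim conjE)
  fix f H
  assume f: "continuous_map Y E f" and H: "continuous_map (prod_topology Y unit_interval) X H"
    and fH: "\<forall>y\<in>topspace Y. H (y, 0) = p (f y)"
  define j where "j = (\<lambda>y. (f y, \<lambda>t. H (y, t)))"
  define Q where "Q = topology (\<lambda>U. U \<subseteq> j ` topspace Y \<and> openin Y {y \<in> topspace Y. j y \<in> U})"
  have "istopology (\<lambda>U. U \<subseteq> j ` topspace Y \<and> openin Y {y \<in> topspace Y. j y \<in> U})"
    unfolding istopology_def
  proof (intro conjI allI impI)
    fix S T
    assume "S \<subseteq> j ` topspace Y \<and> openin Y {y \<in> topspace Y. j y \<in> S}"
      "T \<subseteq> j ` topspace Y \<and> openin Y {y \<in> topspace Y. j y \<in> T}"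
    moreover have "{y \<in> topspace Y. j y \<in> S \<inter> T} =
        {y \<in> topspace Y. j y \<in> S} \<inter> {y \<in> topspace Y. j y \<in> T}" by blast
    ultimately show "openin Y {y \<in> topspace Y. j y \<in> S \<inter> T}" by auto
  next
    fix \<K> assume "\<forall>K\<in>\<K>. K \<subseteq> j ` topspace Y \<and> openin Y {y \<in> topspace Y. j y \<in> K}"
    moreover have "{y \<in> topspace Y. j y \<in> \<Union>\<K>} = (\<Union>K\<in>\<K>. {y \<in> topspace Y. j y \<in> K})" by blast
    ultimately show "openin Y {y \<in> topspace Y. j y \<in> \<Union>\<K>}" by auto
  qed blast+
  then have openQ: "openin Q U \<longleftrightarrow> U \<subseteq> j ` topspace Y \<and> openin Y {y \<in> topspace Y. j y \<in> U}" for U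
    unfolding Q_def by (simp add: topology_inverse')
  have "openin Q (j ` topspace Y)"
  proof -
    have "{y \<in> topspace Y. j y \<in> j ` topspace Y} = topspace Y" by blast
    then show ?thesis by (simp add: openQ)
  qed
  then have topQ: "topspace Q = j ` topspace Y"
    using openQ[of "topspace Q"] by (auto dest: openin_subset)
  have j: "quotient_map Y Q j"
    unfolding quotient_map_def topQ openQ by auto
  have jI: "quotient_map (prod_topology Y unit_interval) (prod_topology Q unit_interval)
              (\<lambda>(y, t). (j y, t))"
  proof (rule quotient_map_prod_left[OF _ _ j])
    show "locally_compact_space unit_interval"
      by (simp add: compact_imp_locally_compact_space compact_space_subtopology)
    show "Hausdorff_space unit_interval \<or> regular_space unit_interval"
      by (simp add: Hausdorff_space_subtopology)
  qed
  have fQ: "continuous_map Q E fst"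
  proof (rule continuous_compose_quotient_map[OF j])
    show "continuous_map Y E (fst \<circ> j)" using f by (simp add: j_def o_def)
  qed
  have "continuous_map (prod_topology Q unit_interval) X (\<lambda>(q, t). snd q t)"
  proof (rule continuous_compose_quotient_map[OF jI])
    have "(\<lambda>(q, t). snd q t) \<circ> (\<lambda>(y, t). (j y, t)) = H" by (auto simp: j_def)
    then show "continuous_map (prod_topology Y unit_interval) X
                 ((\<lambda>(q, t). snd q t) \<circ> (\<lambda>(y, t). (j y, t)))" using H by simp
  qed
  moreover have "\<forall>q\<in>topspace Q. (\<lambda>(q, t). snd q t) (q, 0) = p (fst q)"
    using fH by (auto simp: topQ j_def)
  moreover have "homotopy_lifting_property Q E X p"
    using p by (simp add: hurewicz_fibration_def)
  ultimately have "\<exists>K. continuous_map (prod_topology Q unit_interval) E K \<and>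
      (\<forall>q\<in>topspace Q. K (q, 0) = fst q) \<and>
      (\<forall>q\<in>topspace Q. \<forall>t\<in>{0..1}. p (K (q, t)) = (\<lambda>(q, t). snd q t) (q, t))"
    using fQ unfolding homotopy_lifting_property_def by blast
  then obtain K where K: "continuous_map (prod_topology Q unit_interval) E K"
      "\<forall>q\<in>topspace Q. K (q, 0) = fst q" "\<forall>q\<in>topspace Q. \<forall>t\<in>{0..1}. p (K (q, t)) = snd q t"
    by auto
  show "\<exists>K. continuous_map (prod_topology Y unit_interval) E K \<and>
             (\<forall>y\<in>topspace Y. K (y, 0) = f y) \<and>
             (\<forall>y\<in>topspace Y. \<forall>t\<in>{0..1}. p (K (y, t)) = H (y, t))"
  proof (intro exI conjI ballI)
    show "continuous_map (prod_topology Y unit_interval) E (K \<circ> (\<lambda>(y, t). (j y, t)))"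
      using continuous_map_compose K(1) jI quotient_imp_continuous_map by blast
  qed (use K topQ in \<open>auto simp: j_def\<close>)
qed

definition totally_path_disconnected_space :: "'a topology \<Rightarrow> bool" where
  "totally_path_disconnected_space X \<longleftrightarrow> (\<forall>x y. path_component_of X x y \<longrightarrow> x = y)"


section \<open>Regularity, dense leaves and profinite continuity\<close>

definition deck_transformations :: "'e topology \<Rightarrow> ('e \<Rightarrow> 'x) \<Rightarrow> ('e \<Rightarrow> 'e) set" where
  "deck_transformations E p =
     {\<phi>. homeomorphic_map E E \<phi> \<and> (\<forall>e\<in>topspace E. p (\<phi> e) = p e)}"

definition regular_projection :: "'e topology \<Rightarrow> ('e \<Rightarrow> 'x) \<Rightarrow> bool" where
  "regular_projection E p \<longleftrightarrow>
     (\<forall>e\<in>topspace E. \<forall>e'\<in>topspace E. p e = p e' \<longrightarrow> (\<exists>\<phi>\<in>deck_transformations E p. \<phi> e = e'))"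

definition has_dense_leaf :: "'e topology \<Rightarrow> bool" where
  "has_dense_leaf E \<longleftrightarrow> (\<exists>L\<in>path_components_of E. E closure_of L = topspace E)"

definition lift_endpoint :: "'e topology \<Rightarrow> ('e \<Rightarrow> 'x) \<Rightarrow> 'e \<Rightarrow> (real \<Rightarrow> 'x) \<Rightarrow> 'e" where
  "lift_endpoint E p e \<alpha> =
     (THE y. \<exists>\<gamma>. pathin E \<gamma> \<and> \<gamma> 0 = e \<and> (\<forall>t\<in>{0..1}. p (\<gamma> t) = \<alpha> t) \<and> \<gamma> 1 = y)"

text \<open>The endpoint depends only on the homotopy class, so the image of a class is a singleton.\<close>

definition class_endpoint :: "'e topology \<Rightarrow> ('e \<Rightarrow> 'x) \<Rightarrow> 'e \<Rightarrow> (real \<Rightarrow> 'x) set \<Rightarrow> 'e" where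
  "class_endpoint E p e A = the_elem (lift_endpoint E p e ` A)"

definition pi1_profinite :: "'e topology \<Rightarrow> 'x topology \<Rightarrow> ('e \<Rightarrow> 'x) \<Rightarrow> 'x \<Rightarrow> 'e \<Rightarrow> bool" where
  "pi1_profinite E X p x0 e0 \<longleftrightarrow>
     continuous_map (profinite_topology (fundamental_group X x0)) (fibre E p x0)
       (class_endpoint E p e0)"


section \<open>Inverse limits of finite regular coverings\<close>

definition covering_projection :: "'t topology \<Rightarrow> 'x topology \<Rightarrow> ('t \<Rightarrow> 'x) \<Rightarrow> bool" where
  "covering_projection T X q \<longleftrightarrow>
     continuous_map T X q \<and> q ` topspace T = topspace X \<and>
     (\<forall>x\<in>topspace X. \<exists>U. openin X U \<and> x \<in> U \<and>
        (\<exists>\<V>. \<Union>\<V> = {e \<in> topspace T. q e \<in> U} \<and> pairwise disjnt \<V> \<and>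
             (\<forall>V\<in>\<V>. openin T V \<and> homeomorphic_map (subtopology T V) (subtopology X U) q)))"

definition finite_regular_covering :: "'t topology \<Rightarrow> 'x topology \<Rightarrow> ('t \<Rightarrow> 'x) \<Rightarrow> bool" where
  "finite_regular_covering T X q \<longleftrightarrow>
     covering_projection T X q \<and> (\<forall>x\<in>topspace X. finite (fibre_set T q x)) \<and>
     regular_projection T q"

definition directed_set :: "'i set \<Rightarrow> ('i \<Rightarrow> 'i \<Rightarrow> bool) \<Rightarrow> bool" where
  "directed_set J leq \<longleftrightarrow>
     J \<noteq> {} \<and> (\<forall>i\<in>J. leq i i) \<and>
     (\<forall>i\<in>J. \<forall>j\<in>J. \<forall>k\<in>J. leq i j \<and> leq j k \<longrightarrow> leq i k) \<and>
     (\<forall>i\<in>J. \<forall>j\<in>J. \<exists>k\<in>J. leq i k \<and> leq j k)"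

text \<open>For \<^term>\<open>leq i j\<close> the bonding map \<^term>\<open>b i j\<close> goes from \<^term>\<open>T j\<close> to \<^term>\<open>T i\<close>.\<close>

definition inverse_system ::
  "'i set \<Rightarrow> ('i \<Rightarrow> 'i \<Rightarrow> bool) \<Rightarrow> ('i \<Rightarrow> 't topology) \<Rightarrow> ('i \<Rightarrow> 'i \<Rightarrow> 't \<Rightarrow> 't) \<Rightarrow> bool" where
  "inverse_system J leq T b \<longleftrightarrow>
     directed_set J leq \<and>
     (\<forall>i\<in>J. \<forall>j\<in>J. leq i j \<longrightarrow> continuous_map (T j) (T i) (b i j)) \<and>
     (\<forall>i\<in>J. \<forall>t\<in>topspace (T i). b i i t = t) \<and>
     (\<forall>i\<in>J. \<forall>j\<in>J. \<forall>k\<in>J. leq i j \<and> leq j k \<longrightarrow>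
        (\<forall>t\<in>topspace (T k). b i j (b j k t) = b i k t))"

definition inverse_limit ::
  "'i set \<Rightarrow> ('i \<Rightarrow> 'i \<Rightarrow> bool) \<Rightarrow> ('i \<Rightarrow> 't topology) \<Rightarrow> ('i \<Rightarrow> 'i \<Rightarrow> 't \<Rightarrow> 't) \<Rightarrow> ('i \<Rightarrow> 't) topology" where
  "inverse_limit J leq T b =
     subtopology (product_topology T J) {z. \<forall>i\<in>J. \<forall>j\<in>J. leq i j \<longrightarrow> b i j (z j) = z i}"

text \<open>The type arguments give the types that carry the index set and the total spaces. The
  structure map of the limit to \<^term>\<open>X\<close> is \<open>q i \<circ> (projection to T i)\<close>, for any \<^term>\<open>i\<close>.\<close>

definition inverse_limit_of_finite_regular_coverings ::
  "'i itself \<Rightarrow> 't itself \<Rightarrow> 'e topology \<Rightarrow> 'x topology \<Rightarrow> ('e \<Rightarrow> 'x) \<Rightarrow> bool" where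
  "inverse_limit_of_finite_regular_coverings index_type total_type E X p \<longleftrightarrow>
     (\<exists>(J :: 'i set) leq (T :: 'i \<Rightarrow> 't topology) q b.
        inverse_system J leq T b \<and>
        (\<forall>i\<in>J. path_connected_space (T i) \<and> finite_regular_covering (T i) X (q i)) \<and>
        (\<forall>i\<in>J. \<forall>j\<in>J. leq i j \<longrightarrow> (\<forall>t\<in>topspace (T j). q i (b i j t) = q j t)) \<and>
        (\<exists>h. homeomorphic_map E (inverse_limit J leq T b) h \<and>
             (\<forall>e\<in>topspace E. \<forall>i\<in>J. q i (h e i) = p e)))"

text \<open>No type carries all index sets or all total spaces. In an inverse limit as above, however,
  the projection of the limit \<^term>\<open>E\<close> to each total space is surjective, so the total spaces can be
  taken to be sets of equivalence classes in \<^term>\<open>E\<close>, indexed by the corresponding equivalence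
  relations. The following types are therefore large enough.\<close>

abbreviation is_inverse_limit_of_finite_regular_coverings ::
  "'e topology \<Rightarrow> 'x topology \<Rightarrow> ('e \<Rightarrow> 'x) \<Rightarrow> bool" where
  "is_inverse_limit_of_finite_regular_coverings E X p \<equiv>
     inverse_limit_of_finite_regular_coverings TYPE(('e \<times> 'e) set) TYPE('e set) E X p"

end

theory Submission
  imports Defs
begin

text \<open>
  A fibration with totally path-disconnected fibres has unique path lifting, so \<open>\<pi>\<^sub>1(X, x\<^sub>0)\<close> acts on
  the fibre \<open>F\<close> over \<open>x\<^sub>0\<close> from the right and this action commutes with deck transformations.

  In an inverse limit of finite regular coverings, deck transformations are assembled from those of
  the coverings, where they are determined by one value; the map \<open>\<theta>\<close> is continuous because its
  components are constant on cosets of the stabilizers, which are normal of finite index; and a leaf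
  is dense because it surjects onto each covering space.

  Conversely, local contractibility makes \<open>p\<close> locally trivial, so a dense leaf meets \<open>F\<close> in a dense
  set, and by regularity all orbits of \<open>\<pi>\<^sub>1\<close> in \<open>F\<close> are dense. For a normal subgroup \<open>N\<close> of finite
  index in a group acting with dense orbits, the closures of the \<open>N\<close>-orbits form a finite partition
  into open and closed sets. Spread over \<open>E\<close> by path lifting, this partition is an equivalence
  relation whose quotient is a finite regular covering. Profinite continuity of \<open>\<theta>\<close> makes the blocks
  arbitrarily small, so \<open>E\<close> is the limit of these quotients.
\<close>

section \<open>Paths\<close>

text \<open>The coverings are built inside \<open>E\<close>, as quotients by equivalence relations
  that transport along paths and deck transformations preserve. Bonding maps are then inclusions of
  relations, and directedness only asks that intersections be admissible again. Continuity of
  \<theta> speaks about the one point \<open>e0\<close>; deck transformations commute with path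
  lifting, so regularity carries it to every point of the fibre. Blocks are closures of orbits, so
  smallness of an orbit has to survive closure: here the compact Hausdorff fibre acts as a regular
  space. Compactness enters twice more, to bound the number of classes and to find a point with
  prescribed classes. It holds only along fibres, so the bijection from \<open>E\<close> to the
  limit is shown to be open by means of local trivializations.\<close>

lemma pathin_reverse:
  assumes "pathin X \<alpha>" shows "pathin X (\<lambda>t. \<alpha> (1 - t))"
proof -
  have "continuous_map unit_interval unit_interval (\<lambda>t. 1 - t)"
    by (auto simp: continuous_map_in_subtopology intro!: continuous_intros)
  from continuous_map_compose[OF this, of X \<alpha>] assms show ?thesis
    by (simp add: pathin_def o_def)
qed

lemma pathin_slices:
  assumes "continuous_map (prod_topology unit_interval unit_interval) X K" "s \<in> {0..1}"
  shows "pathin X (\<lambda>t. K (s, t))" "pathin X (\<lambda>t. K (t, s))"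
proof -
  have "continuous_map unit_interval (prod_topology unit_interval unit_interval) (\<lambda>t. (s, t))"
    "continuous_map unit_interval (prod_topology unit_interval unit_interval) (\<lambda>t. (t, s))"
    using assms(2) by (intro continuous_map_pairedI; simp)+
  from this[THEN continuous_map_compose, OF assms(1)]
  show "pathin X (\<lambda>t. K (s, t))" "pathin X (\<lambda>t. K (t, s))"
    by (simp_all add: pathin_def o_def)
qed

lemma path_homotopic_concat_reverse:
  assumes "pathin X \<alpha>"
  shows "path_homotopic X (path_concat \<alpha> (\<lambda>t. \<alpha> (1 - t))) (\<lambda>_. \<alpha> 0)"
\<comment> \<open>Out and back along \<open>\<alpha>\<close> is \<open>\<alpha>\<close> after the
  tent function; this function and the constant 0 agree at both ends, so a straight-line homotopy
  joins them.\<close>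
proof (rule path_homotopic_reparam[of X \<alpha> "\<lambda>t. 1 - \<bar>1 - 2 * t\<bar>" "\<lambda>_. 0"])
  show "path_concat \<alpha> (\<lambda>t. \<alpha> (1 - t)) t = \<alpha> (1 - \<bar>1 - 2 * t\<bar>)" for t
    by (auto simp: path_concat_def abs_if)
qed (use assms in \<open>auto intro!: continuous_intros\<close>)

lemma const_loop: "x \<in> topspace X \<Longrightarrow> (\<lambda>_. x) \<in> loops X x"
  by (simp add: loops_def)

lemma carrier_fundamental_group: "carrier (fundamental_group X x) = loop_class X ` loops X x"
  by (simp add: fundamental_group_def)

lemma one_fundamental_group: "\<one>\<^bsub>fundamental_group X x\<^esub> = loop_class X (\<lambda>_. x)"
  by (simp add: fundamental_group_def)


section \<open>Lifting projections\<close>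

locale lifting_projection =
  fixes E :: "'e topology" and X :: "'x topology" and p :: "'e \<Rightarrow> 'x"
  assumes fibration: "hurewicz_fibration E X p"
    and fibres: "\<And>x. x \<in> topspace X \<Longrightarrow> totally_path_disconnected_space (fibre E p x)"
begin

lemma continuous_p: "continuous_map E X p"
  using fibration by (simp add: hurewicz_fibration_def)

lemma p_in: "e \<in> topspace E \<Longrightarrow> p e \<in> topspace X"
  using continuous_p by (simp add: continuous_map_def Pi_iff)

lemma homotopy_lift:
  fixes Y :: "'y topology"
  assumes "continuous_map Y E f" "continuous_map (prod_topology Y unit_interval) X H"
    and "\<And>y. y \<in> topspace Y \<Longrightarrow> H (y, 0) = p (f y)"
  obtains K where "continuous_map (prod_topology Y unit_interval) E K"
    "\<And>y. y \<in> topspace Y \<Longrightarrow> K (y, 0) = f y"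
    "\<And>y t. y \<in> topspace Y \<Longrightarrow> t \<in> {0..1} \<Longrightarrow> p (K (y, t)) = H (y, t)"
  using hurewicz_fibration_lifting[OF fibration, of Y] assms
  unfolding homotopy_lifting_property_def by blast

text \<open>The one place where total path-disconnectedness acts: a path over a constant runs inside
  a fibre. Uniqueness of lifts and homotopy invariance both end with edges of a lifted square
  collapsing in this way.\<close>

lemma path_in_fibre_const:
  assumes \<gamma>: "pathin E \<gamma>" and x: "\<And>t. t \<in> {0..1} \<Longrightarrow> p (\<gamma> t) = x"
  shows "\<gamma> 0 = \<gamma> 1"
proof -
  have "\<gamma> t \<in> topspace E" if "t \<in> {0..1}" for t
    using \<gamma> that by (auto simp: pathin_def continuous_map_def)
  then have "pathin (fibre E p x) \<gamma>" "x \<in> topspace X"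
    using \<gamma> x p_in[of "\<gamma> 0"] x[of 0] by (auto simp: pathin_subtopology)
  then show ?thesis
    using fibres[of x] unfolding totally_path_disconnected_space_def path_component_of_def by blast
qed

definition is_lift :: "'e \<Rightarrow> (real \<Rightarrow> 'x) \<Rightarrow> (real \<Rightarrow> 'e) \<Rightarrow> bool" where
  "is_lift e \<alpha> \<gamma> \<longleftrightarrow> pathin E \<gamma> \<and> \<gamma> 0 = e \<and> (\<forall>t\<in>{0..1}. p (\<gamma> t) = \<alpha> t)"

text \<open>Going back along one lift and out along the other is a path over a null-homotopic loop;
  lifting the null-homotopy joins the endpoints of the two lifts by a path in a fibre.\<close>

lemma is_lift_unique:
  assumes "is_lift e \<alpha> \<gamma>" "is_lift e \<alpha> \<gamma>'" and \<tau>: "\<tau> \<in> {0..1}"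
  shows "\<gamma> \<tau> = \<gamma>' \<tau>"
proof -
  have \<gamma>: "pathin E \<gamma>" "pathin E \<gamma>'" "\<gamma> 0 = \<gamma>' 0"
    and p\<gamma>: "\<And>t. t \<in> {0..1} \<Longrightarrow> p (\<gamma> t) = \<alpha> t" "\<And>t. t \<in> {0..1} \<Longrightarrow> p (\<gamma>' t) = \<alpha> t"
    using assms(1,2) by (auto simp: is_lift_def)
  \<comment> \<open>\<open>?a\<close> is the parameter of \<alpha> below \<open>w\<close>: it falls
    from \<tau> to 0 on the way back along \<gamma>, then rises to \<tau> again along
    \<gamma>'.\<close>
  let ?a = "\<lambda>s. \<tau> * \<bar>1 - 2 * s\<bar>"
  have a: "?a s \<in> {0..1}" if "s \<in> {0..1}" for s
    using \<tau> that by (auto intro!: mult_le_one)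
  have sc: "continuous_map unit_interval unit_interval (\<lambda>t. \<tau> * t)"
    using \<tau> by (auto simp: continuous_map_in_subtopology mult_le_one intro!: continuous_intros)
  define w where "w = path_concat (\<lambda>s. \<gamma> (\<tau> * (1 - s))) (\<lambda>s. \<gamma>' (\<tau> * s))"
  have "pathin E (\<lambda>s. \<gamma> (\<tau> * s))" "pathin E (\<lambda>s. \<gamma>' (\<tau> * s))"
    using \<gamma> continuous_map_compose[OF sc] by (auto simp: pathin_def o_def)
  then have w: "pathin E w"
    unfolding w_def using \<gamma>(3) pathin_reverse[of E "\<lambda>s. \<gamma> (\<tau> * s)"] by (intro pathin_concat) auto
  have pw: "p (w s) = \<alpha> (?a s)" if "s \<in> {0..1}" for s
  proof (cases "s \<le> 1/2")
    case True
    then have "\<tau> * (1 - 2 * s) = ?a s" by (simp add: abs_if)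
    then show ?thesis using True a[OF that] p\<gamma>(1)[of "?a s"] by (simp add: w_def path_concat_def)
  next
    case False
    then have "\<tau> * (2 * s - 1) = ?a s" by (simp add: abs_if)
    then show ?thesis using False a[OF that] p\<gamma>(2)[of "?a s"] by (simp add: w_def path_concat_def)
  qed
  \<comment> \<open>Straight-line contraction of \<open>?a\<close> to the constant \<tau>: the edge
    \<open>snd z = 0\<close> is \<open>?a\<close>, the other three edges are constantly \<tau>. It
    is sent to \<open>X\<close> through \<open>p \<circ> \<gamma>\<close>, which is continuous and
    agrees with \<alpha> on the unit interval.\<close>
  let ?b = "\<lambda>z::real \<times> real. \<tau> * (snd z + (1 - snd z) * \<bar>1 - 2 * fst z\<bar>)"
  have b: "?b z \<in> {0..1}" if "z \<in> {0..1} \<times> {0..1}" for z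
  proof -
    have "snd z * 1 + (1 - snd z) * \<bar>1 - 2 * fst z\<bar> \<in> {0..1}"
      using that convexD[of "{0..1::real}" 1 "\<bar>1 - 2 * fst z\<bar>" "snd z" "1 - snd z"] by force
    then show ?thesis using \<tau> by (auto intro!: mult_le_one)
  qed
  have II: "prod_topology unit_interval unit_interval = top_of_set ({0..1::real} \<times> {0..1::real})"
    by (simp flip: prod_topology_subtopology_eu)
  have "continuous_map (prod_topology unit_interval unit_interval) unit_interval ?b"
    unfolding II continuous_map_in_subtopology
    using b by (auto intro!: continuous_intros)
  then have "continuous_map (prod_topology unit_interval unit_interval) E (\<gamma> \<circ> ?b)"
    using \<gamma>(1) continuous_map_compose unfolding pathin_def by blast
  from continuous_map_compose[OF this continuous_p]
  have H: "continuous_map (prod_topology unit_interval unit_interval) X (p \<circ> (\<gamma> \<circ> ?b))" .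
  have Hb: "(p \<circ> (\<gamma> \<circ> ?b)) z = \<alpha> (?b z)" if "z \<in> {0..1} \<times> {0..1}" for z
    using b[OF that] p\<gamma>(1) by simp
  have H0: "(p \<circ> (\<gamma> \<circ> ?b)) (s, 0) = p (w s)" if "s \<in> topspace unit_interval" for s
    using that Hb[of "(s, 0)"] pw[of s] by simp
  have w': "continuous_map unit_interval E w" using w by (simp add: pathin_def)
  obtain K where K: "continuous_map (prod_topology unit_interval unit_interval) E K"
    and K0: "\<And>s. s \<in> topspace unit_interval \<Longrightarrow> K (s, 0) = w s"
    and pK: "\<And>s t. s \<in> topspace unit_interval \<Longrightarrow> t \<in> {0..1} \<Longrightarrow> p (K (s, t)) = (p \<circ> (\<gamma> \<circ> ?b)) (s, t)"
    using homotopy_lift[OF w' H H0] by blast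
  have pK': "p (K (s, t)) = \<alpha> (?b (s, t))" if "s \<in> {0..1}" "t \<in> {0..1}" for s t
    using that pK[of s t] Hb[of "(s, t)"] by simp
  \<comment> \<open>Three edges of the lifted square lie over the single point
    \<open>\<alpha> \<tau>\<close>; walking along them leads from one end of \<open>w\<close> to the
    other.\<close>
  have "K (0, 0) = K (0, 1)"
    by (rule path_in_fibre_const[of "\<lambda>t. K (0, t)" "\<alpha> \<tau>"])
       (use pathin_slices[OF K, of 0] pK' in auto)
  also have "\<dots> = K (1, 1)"
    by (rule path_in_fibre_const[of "\<lambda>t. K (t, 1)" "\<alpha> \<tau>"])
       (use pathin_slices[OF K, of 1] pK' in auto)
  also have "\<dots> = K (1, 0)"
    by (rule path_in_fibre_const[of "\<lambda>t. K (1, t)" "\<alpha> \<tau>", symmetric])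
       (use pathin_slices[OF K, of 1] pK' in auto)
  finally have "w 0 = w 1" using K0 by simp
  then show ?thesis by (simp add: w_def)
qed

abbreviation lift_end (infixl "\<cdot>" 70) where "e \<cdot> \<alpha> \<equiv> lift_endpoint E p e \<alpha>"

lemma lift_end_eq:
  assumes "is_lift e \<alpha> \<gamma>" shows "e \<cdot> \<alpha> = \<gamma> 1"
  unfolding lift_endpoint_def
proof (rule the_equality)
  show "\<exists>\<gamma>'. pathin E \<gamma>' \<and> \<gamma>' 0 = e \<and> (\<forall>t\<in>{0..1}. p (\<gamma>' t) = \<alpha> t) \<and> \<gamma>' 1 = \<gamma> 1"
    using assms by (auto simp: is_lift_def)
  show "y = \<gamma> 1"
    if "\<exists>\<gamma>. pathin E \<gamma> \<and> \<gamma> 0 = e \<and> (\<forall>t\<in>{0..1}. p (\<gamma> t) = \<alpha> t) \<and> \<gamma> 1 = y" for y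
    using that is_lift_unique[OF _ assms, of _ 1] by (auto simp: is_lift_def)
qed

text \<open>Each path of a homotopy lift is the lift of its own image, so uniqueness identifies the
  endpoint with the time-one value of the homotopy lift. Dependence on starting point and path
  jointly is what the local trivializations use.\<close>

lemma continuous_lift_end:
  fixes Y :: "'y topology"
  assumes f: "continuous_map Y E f" and H: "continuous_map (prod_topology Y unit_interval) X H"
    and fH: "\<And>y. y \<in> topspace Y \<Longrightarrow> H (y, 0) = p (f y)"
  shows "continuous_map Y E (\<lambda>y. f y \<cdot> (\<lambda>t. H (y, t)))"
proof -
  obtain K where K: "continuous_map (prod_topology Y unit_interval) E K"
    "\<And>y. y \<in> topspace Y \<Longrightarrow> K (y, 0) = f y"
    "\<And>y t. y \<in> topspace Y \<Longrightarrow> t \<in> {0..1} \<Longrightarrow> p (K (y, t)) = H (y, t)"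
    using homotopy_lift[OF assms] by blast
  have "is_lift (f y) (\<lambda>t. H (y, t)) (\<lambda>t. K (y, t))" if y: "y \<in> topspace Y" for y
  proof -
    have "continuous_map unit_interval (prod_topology Y unit_interval) (\<lambda>t. (y, t))"
      using y by (simp add: continuous_map_pairwise o_def)
    from continuous_map_compose[OF this K(1)] show ?thesis
      using K(2,3) y by (simp add: is_lift_def pathin_def o_def)
  qed
  then have "f y \<cdot> (\<lambda>t. H (y, t)) = K (y, 1)" if "y \<in> topspace Y" for y
    using that lift_end_eq by blast
  moreover have "continuous_map Y (prod_topology Y unit_interval) (\<lambda>y. (y, 1))"
    by (simp add: continuous_map_pairwise o_def)
  from continuous_map_compose[OF this K(1)] have "continuous_map Y E (\<lambda>y. K (y, 1))"
    by (simp add: o_def)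
  ultimately show ?thesis using continuous_map_eq[of Y E "\<lambda>y. K (y, 1)"] by simp
qed

lemma lift_exists:
  assumes e: "e \<in> topspace E" and \<alpha>: "pathin X \<alpha>" "\<alpha> 0 = p e"
  obtains \<gamma> where "is_lift e \<alpha> \<gamma>"
proof -
  \<comment> \<open>Path lifting is homotopy lifting with a one-point test space.\<close>
  let ?Y = "discrete_topology {()}"
  have "continuous_map (prod_topology ?Y unit_interval) X (\<alpha> \<circ> snd)"
    using \<alpha>(1) unfolding pathin_def by (rule continuous_map_compose[OF continuous_map_snd])
  then obtain K where K: "continuous_map (prod_topology ?Y unit_interval) E K"
    "K ((), 0) = e" "\<And>t. t \<in> {0..1} \<Longrightarrow> p (K ((), t)) = \<alpha> t"
    using homotopy_lift[of ?Y "\<lambda>_. e" "\<alpha> \<circ> snd"] e \<alpha>(2) by auto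
  have "continuous_map unit_interval (prod_topology ?Y unit_interval) (\<lambda>t. ((), t))"
    by (simp add: continuous_map_pairwise o_def)
  from continuous_map_compose[OF this K(1)] have "is_lift e \<alpha> (\<lambda>t. K ((), t))"
    using K(2,3) by (simp add: is_lift_def pathin_def o_def)
  then show ?thesis using that by blast
qed

lemma is_lift_end:
  assumes "is_lift e \<alpha> \<gamma>"
  shows "\<gamma> 1 \<in> topspace E" "p (\<gamma> 1) = \<alpha> 1" "path_component_of E e (\<gamma> 1)"
  using assms by (auto simp: is_lift_def pathin_def continuous_map_def path_component_of_def)

lemma lift_end:
  assumes "e \<in> topspace E" "pathin X \<alpha>" "\<alpha> 0 = p e"
  shows "e \<cdot> \<alpha> \<in> topspace E" "p (e \<cdot> \<alpha>) = \<alpha> 1" "path_component_of E e (e \<cdot> \<alpha>)"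
proof -
  obtain \<gamma> where \<gamma>: "is_lift e \<alpha> \<gamma>" using lift_exists assms by blast
  then show "e \<cdot> \<alpha> \<in> topspace E" "p (e \<cdot> \<alpha>) = \<alpha> 1" "path_component_of E e (e \<cdot> \<alpha>)"
    using is_lift_end[OF \<gamma>] lift_end_eq[OF \<gamma>] by auto
qed

lemma lift_end_of_path:
  assumes "pathin E \<gamma>"
  shows "\<gamma> 0 \<cdot> (p \<circ> \<gamma>) = \<gamma> 1"
  by (rule lift_end_eq) (use assms in \<open>simp add: is_lift_def\<close>)

lemma lift_end_const [simp]:
  assumes "e \<in> topspace E" shows "e \<cdot> (\<lambda>_. p e) = e"
  using assms lift_end_eq[of e "\<lambda>_. p e" "\<lambda>_. e"] by (simp add: is_lift_def)

section \<open>Lifting and concatenation, homotopy, maps over \<open>X\<close>\<close>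

lemma lift_end_concat:
  assumes e: "e \<in> topspace E" and \<alpha>: "pathin X \<alpha>" "\<alpha> 0 = p e" and \<beta>: "pathin X \<beta>" "\<beta> 0 = \<alpha> 1"
  shows "e \<cdot> path_concat \<alpha> \<beta> = (e \<cdot> \<alpha>) \<cdot> \<beta>"
proof -
  obtain \<gamma> where \<gamma>: "is_lift e \<alpha> \<gamma>" using lift_exists e \<alpha> by blast
  obtain \<delta> where \<delta>: "is_lift (\<gamma> 1) \<beta> \<delta>"
    using lift_exists[of "\<gamma> 1" \<beta>] is_lift_end[OF \<gamma>] \<beta> by metis
  have "is_lift e (path_concat \<alpha> \<beta>) (path_concat \<gamma> \<delta>)"
    unfolding is_lift_def
  proof (intro conjI ballI)
    show "pathin E (path_concat \<gamma> \<delta>)"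
      using \<gamma> \<delta> by (intro pathin_concat) (auto simp: is_lift_def)
    show "path_concat \<gamma> \<delta> 0 = e" using \<gamma> by (simp add: is_lift_def)
    show "p (path_concat \<gamma> \<delta> t) = path_concat \<alpha> \<beta> t" if "t \<in> {0..1}" for t
      using that \<gamma> \<delta> by (simp add: is_lift_def path_concat_def)
  qed
  from lift_end_eq[OF this] show ?thesis
    using lift_end_eq[OF \<gamma>] lift_end_eq[OF \<delta>] by simp
qed

text \<open>The lifted homotopy starts on the constant \<open>e\<close>, so its first and last rows
  are lifts of \<alpha> and \<beta> from \<open>e\<close>; its edge of endpoints lies in the fibre
  over \<open>\<alpha> 1\<close>, hence has equal ends.\<close>

lemma lift_end_homotopic:
  assumes e: "e \<in> topspace E" and \<alpha>: "\<alpha> 0 = p e" and h: "path_homotopic X \<alpha> \<beta>"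
  shows "e \<cdot> \<alpha> = e \<cdot> \<beta>"
proof -
  obtain H where H: "continuous_map (prod_topology unit_interval unit_interval) X H"
    and H01: "\<And>t. t \<in> {0..1} \<Longrightarrow> H (0, t) = \<alpha> t" "\<And>t. t \<in> {0..1} \<Longrightarrow> H (1, t) = \<beta> t"
    and ends: "\<And>s. s \<in> {0..1} \<Longrightarrow> H (s, 0) = \<alpha> 0 \<and> H (s, 1) = \<alpha> 1"
    using h unfolding path_homotopic_iff by metis
  have st: "H (s, 0) = p e" if "s \<in> topspace unit_interval" for s
    using ends that \<alpha> by simp
  have "continuous_map unit_interval E (\<lambda>s. e)" using e by simp
  then obtain K where K: "continuous_map (prod_topology unit_interval unit_interval) E K"
    and K0: "\<And>s. s \<in> topspace unit_interval \<Longrightarrow> K (s, 0) = e"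
    and pK: "\<And>s t. s \<in> topspace unit_interval \<Longrightarrow> t \<in> {0..1} \<Longrightarrow> p (K (s, t)) = H (s, t)"
    using homotopy_lift[OF _ H st] by blast
  have "is_lift e \<alpha> (\<lambda>t. K (0, t))" "is_lift e \<beta> (\<lambda>t. K (1, t))"
    using pathin_slices[OF K] K0 pK H01 by (auto simp: is_lift_def)
  moreover have "K (0, 1) = K (1, 1)"
    by (rule path_in_fibre_const[of "\<lambda>s. K (s, 1)" "\<alpha> 1"])
       (use pathin_slices[OF K, of 1] pK ends in auto)
  ultimately show ?thesis using lift_end_eq by metis
qed

lemma lift_end_reverse:
  assumes e: "e \<in> topspace E" and \<alpha>: "pathin X \<alpha>" "\<alpha> 0 = p e"
  shows "(e \<cdot> \<alpha>) \<cdot> (\<lambda>t. \<alpha> (1 - t)) = e"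
proof -
  have "(e \<cdot> \<alpha>) \<cdot> (\<lambda>t. \<alpha> (1 - t)) = e \<cdot> path_concat \<alpha> (\<lambda>t. \<alpha> (1 - t))"
    using e \<alpha> by (subst lift_end_concat) (auto intro: pathin_reverse)
  also have "\<dots> = e \<cdot> (\<lambda>_. p e)"
    using path_homotopic_concat_reverse[OF \<alpha>(1)] e \<alpha> by (intro lift_end_homotopic) auto
  finally show ?thesis using e by simp
qed

lemma lift_end_reverse':
  assumes e: "e \<in> topspace E" and \<alpha>: "pathin X \<alpha>" "\<alpha> 1 = p e"
  shows "(e \<cdot> (\<lambda>t. \<alpha> (1 - t))) \<cdot> \<alpha> = e"
  using lift_end_reverse[OF e pathin_reverse[OF \<alpha>(1)]] \<alpha>(2) by simp

text \<open>A map over \<open>X\<close> sends lifts to lifts. For deck transformations this is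
  commutation with transport, hence with monodromy.\<close>

lemma lift_end_map:
  assumes e: "e \<in> topspace E" and \<alpha>: "pathin X \<alpha>" "\<alpha> 0 = p e"
    and \<phi>: "continuous_map E E \<phi>" "\<And>e. e \<in> topspace E \<Longrightarrow> p (\<phi> e) = p e"
  shows "\<phi> e \<cdot> \<alpha> = \<phi> (e \<cdot> \<alpha>)"
proof -
  obtain \<gamma> where \<gamma>: "is_lift e \<alpha> \<gamma>" using lift_exists e \<alpha> by blast
  then have "is_lift (\<phi> e) \<alpha> (\<phi> \<circ> \<gamma>)"
    unfolding is_lift_def using \<phi> pathin_compose[of E \<gamma> E \<phi>]
    by (auto simp: pathin_def continuous_map_def Pi_iff)
  then show ?thesis using lift_end_eq[OF \<gamma>] lift_end_eq by fastforce
qed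

lemma continuous_transport:
  assumes \<alpha>: "pathin X \<alpha>" "\<alpha> 0 = x" "\<alpha> 1 = y"
  shows "continuous_map (fibre E p x) (fibre E p y) (\<lambda>e. e \<cdot> \<alpha>)"
proof -
  have f: "continuous_map (fibre E p x) E (\<lambda>e. e)"
    by (intro continuous_map_from_subtopology continuous_map_id[unfolded id_def])
  have H: "continuous_map (prod_topology (fibre E p x) unit_interval) X (\<lambda>z. \<alpha> (snd z))"
    using continuous_map_compose[OF continuous_map_snd, of unit_interval X \<alpha>] \<alpha>(1)
    by (simp add: pathin_def o_def)
  have "continuous_map (fibre E p x) E (\<lambda>e. e \<cdot> (\<lambda>t. (\<lambda>z. \<alpha> (snd z)) (e, t)))"
    by (rule continuous_lift_end[OF f H]) (use \<alpha> in simp)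
  then show ?thesis
    using lift_end[OF _ \<alpha>(1)] \<alpha>(2,3) by (auto simp: continuous_map_in_subtopology)
qed

subsection \<open>The monodromy action\<close>

lemma class_endpoint_eq:
  assumes "e \<in> topspace E" "\<alpha> \<in> loops X (p e)"
  shows "class_endpoint E p e (loop_class X \<alpha>) = e \<cdot> \<alpha>"
proof -
  have "\<alpha> \<in> loop_class X \<alpha>" using assms by (simp add: loop_class_def loops_def path_homotopic_refl)
  moreover have "e \<cdot> \<beta> = e \<cdot> \<alpha>" if "\<beta> \<in> loop_class X \<alpha>" for \<beta>
    using that assms lift_end_homotopic[of e \<alpha> \<beta>] by (simp add: loop_class_def loops_def)
  ultimately have "lift_endpoint E p e ` loop_class X \<alpha> = {e \<cdot> \<alpha>}" by blast
  then show ?thesis by (simp add: class_endpoint_def)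
qed

abbreviation monodromy (infixl "\<star>" 70) where "e \<star> A \<equiv> class_endpoint E p e A"

lemma monodromy_in:
  assumes "e \<in> fibre_set E p x" "A \<in> carrier (fundamental_group X x)"
  shows "e \<star> A \<in> fibre_set E p x"
  using assms lift_end[of e] by (auto simp: carrier_fundamental_group class_endpoint_eq loops_def)

lemma monodromy_one:
  assumes "e \<in> fibre_set E p x"
  shows "e \<star> \<one>\<^bsub>fundamental_group X x\<^esub> = e"
  using assms class_endpoint_eq[of e "\<lambda>_. x"] p_in[of e]
  by (auto simp: one_fundamental_group const_loop)

lemma monodromy_mult:
  assumes "e \<in> fibre_set E p x" "A \<in> carrier (fundamental_group X x)" "B \<in> carrier (fundamental_group X x)"
  shows "e \<star> (A \<otimes>\<^bsub>fundamental_group X x\<^esub> B) = e \<star> A \<star> B"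
proof -
  obtain \<alpha> \<beta> where *: "\<alpha> \<in> loops X x" "\<beta> \<in> loops X x" "A = loop_class X \<alpha>" "B = loop_class X \<beta>"
    using assms by (auto simp: carrier_fundamental_group)
  have "e \<star> (A \<otimes>\<^bsub>fundamental_group X x\<^esub> B) = e \<cdot> path_concat \<alpha> \<beta>"
    using assms(1) * loop_concat[of \<alpha> X x \<beta>] by (simp add: fundamental_group_mult class_endpoint_eq)
  also have "\<dots> = e \<cdot> \<alpha> \<cdot> \<beta>"
    using assms(1) * by (intro lift_end_concat) (auto simp: loops_def)
  also have "\<dots> = e \<star> A \<star> B"
    using assms(1) * lift_end[of e \<alpha>] by (auto simp: class_endpoint_eq loops_def)
  finally show ?thesis .
qed

lemma continuous_monodromy:
  assumes "A \<in> carrier (fundamental_group X x)"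
  shows "continuous_map (fibre E p x) (fibre E p x) (\<lambda>e. e \<star> A)"
proof -
  obtain \<alpha> where \<alpha>: "\<alpha> \<in> loops X x" "A = loop_class X \<alpha>"
    using assms by (auto simp: carrier_fundamental_group)
  then have "continuous_map (fibre E p x) (fibre E p x) (\<lambda>e. e \<cdot> \<alpha>)"
    by (intro continuous_transport) (auto simp: loops_def)
  then show ?thesis
    by (rule continuous_map_eq) (use \<alpha> in \<open>auto simp: class_endpoint_eq\<close>)
qed

end

section \<open>Minimal actions\<close>

text \<open>Serves whenever one count bounds another: cosets bound orbit closures, points in the
  fibre of a covering bound cosets, classes over \<open>x0\<close> bound classes over another
  point.\<close>

lemma finite_image_factor:
  assumes "finite (f ` A)" "\<And>a b. a \<in> A \<Longrightarrow> b \<in> A \<Longrightarrow> f a = f b \<Longrightarrow> g a = g b"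
  shows "finite (g ` A)"
proof -
  have "g a = g (inv_into A f (f a))" if "a \<in> A" for a
    using that by (intro assms(2)) (auto simp: f_inv_into_f inv_into_into)
  then have "g ` A = (\<lambda>t. g (inv_into A f t)) ` f ` A"
    unfolding image_image by (rule image_cong[OF refl])
  then show ?thesis using assms(1) by simp
qed

text \<open>Minimal as in topological dynamics: all orbits are dense. The action is from the right
  because the first path of a concatenation is lifted first. The intended instance is monodromy on
  the fibre over \<open>x0\<close>.\<close>

locale minimal_right_action = group G for G (structure) +
  fixes F :: "'f topology" and act :: "'f \<Rightarrow> 'a \<Rightarrow> 'f" (infixl "\<star>" 70)
  assumes continuous_act: "A \<in> carrier G \<Longrightarrow> continuous_map F F (\<lambda>x. x \<star> A)"
    and act_one: "x \<in> topspace F \<Longrightarrow> x \<star> \<one> = x"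
    and act_mult: "x \<in> topspace F \<Longrightarrow> A \<in> carrier G \<Longrightarrow> B \<in> carrier G \<Longrightarrow> x \<star> (A \<otimes> B) = x \<star> A \<star> B"
    and dense_orbits: "x \<in> topspace F \<Longrightarrow> F closure_of (act x ` carrier G) = topspace F"
begin

lemma act_in: "x \<in> topspace F \<Longrightarrow> A \<in> carrier G \<Longrightarrow> x \<star> A \<in> topspace F"
  using continuous_act by (auto simp: continuous_map_def)

lemma act_inv:
  assumes "x \<in> topspace F" "A \<in> carrier G"
  shows "x \<star> A \<star> inv A = x" "x \<star> inv A \<star> A = x"
  using assms act_one by (simp_all flip: act_mult)

lemma homeomorphic_act:
  assumes "A \<in> carrier G" shows "homeomorphic_map F F (\<lambda>x. x \<star> A)"
  unfolding homeomorphic_map_maps homeomorphic_maps_def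
  using assms by (intro exI[of _ "\<lambda>x. x \<star> inv A"]) (simp add: continuous_act act_inv)

definition orbit_closure :: "'a set \<Rightarrow> 'f \<Rightarrow> 'f set" where
  "orbit_closure N x = F closure_of (act x ` N)"

lemma closed_orbit_closure: "closedin F (orbit_closure N x)"
  by (simp add: orbit_closure_def)

lemma orbit_closure_equivariant:
  assumes "continuous_map F F \<phi>" "N \<subseteq> carrier G" "x \<in> topspace F" "y \<in> orbit_closure N x"
    and \<phi>: "\<And>x A. x \<in> topspace F \<Longrightarrow> A \<in> carrier G \<Longrightarrow> \<phi> (x \<star> A) = \<phi> x \<star> A"
  shows "\<phi> y \<in> orbit_closure N (\<phi> x)"
proof -
  have "\<phi> ` act x ` N = act (\<phi> x) ` N"
    using assms(2,3) \<phi> by (force simp: image_image intro!: image_cong)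
  then show ?thesis
    using continuous_map_image_closure_subset[OF assms(1), of "act x ` N"] assms(4)
    by (auto simp: orbit_closure_def)
qed

context
  fixes N
  assumes N: "normal_finite_index N G"
begin

lemma N_normal: "N \<lhd> G" and N_sub: "N \<subseteq> carrier G" and N_one: "\<one> \<in> N"
proof -
  show "N \<lhd> G" using N by (simp add: normal_finite_index_def)
  then have "subgroup N G" by (simp add: normal_imp_subgroup)
  then show "N \<subseteq> carrier G" "\<one> \<in> N" by (auto simp: subgroup.subset subgroup.one_closed)
qed

lemma orbit_closure_refl: "x \<in> topspace F \<Longrightarrow> x \<in> orbit_closure N x"
  unfolding orbit_closure_def
  using closure_of_subset[of "act x ` N" F] N_sub imageI[OF N_one, of "act x"] act_in[of x] act_one[of x]
  by (auto simp: subset_iff)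

text \<open>By normality the cosets \<open>A N\<close> and \<open>N A\<close> coincide, so
  translation by \<open>A\<close> carries the \<open>N\<close>-orbit of \<open>x\<close> onto that
  of \<open>x \<star> A\<close>; being a homeomorphism, it also carries the closures.\<close>

lemma orbit_closure_act:
  assumes x: "x \<in> topspace F" and A: "A \<in> carrier G"
  shows "orbit_closure N (x \<star> A) = (\<lambda>y. y \<star> A) ` orbit_closure N x"
proof -
  have "x \<star> A \<star> n \<in> (\<lambda>y. y \<star> A) ` act x ` N" if "n \<in> N" for n
  proof -
    have n: "n \<in> carrier G" "A \<otimes> n \<otimes> inv A \<in> N"
      using that N_sub A normal.inv_op_closed2[OF N_normal] by auto
    have "x \<star> A \<star> n = x \<star> (A \<otimes> n \<otimes> inv A \<otimes> A)"
      using x A n(1) by (simp add: m_assoc act_mult)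
    also have "\<dots> = x \<star> (A \<otimes> n \<otimes> inv A) \<star> A"
      using x A n(1) act_mult by simp
    finally show ?thesis using n(2) by blast
  qed
  moreover have "x \<star> n \<star> A \<in> act (x \<star> A) ` N" if "n \<in> N" for n
  proof -
    have n: "n \<in> carrier G" "inv A \<otimes> n \<otimes> A \<in> N"
      using that N_sub A normal.inv_op_closed1[OF N_normal] by auto
    have "x \<star> n \<star> A = x \<star> (A \<otimes> (inv A \<otimes> n \<otimes> A))"
      using x A n(1) by (simp add: act_mult m_assoc[symmetric] r_inv)
    also have "\<dots> = x \<star> A \<star> (inv A \<otimes> n \<otimes> A)"
      using x A n(1) act_mult by simp
    finally show ?thesis using n(2) by blast
  qed
  ultimately have "act (x \<star> A) ` N = (\<lambda>y. y \<star> A) ` act x ` N" by blast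
  moreover have "act x ` N \<subseteq> topspace F" using x N_sub act_in by blast
  ultimately show ?thesis
    unfolding orbit_closure_def
    using homeomorphic_map_closure_of[OF homeomorphic_act[OF A]] by metis
qed

lemma orbit_closure_N:
  assumes x: "x \<in> topspace F" and n: "n \<in> N"
  shows "orbit_closure N (x \<star> n) = orbit_closure N x"
proof -
  have S: "subgroup N G" by (simp add: N_normal normal_imp_subgroup)
  have "x \<star> n \<star> m \<in> act x ` N" if "m \<in> N" for m
    using n x N_sub imageI[OF subgroup.m_closed[OF S n that], of "act x"] act_mult[of x n m] that
    by (simp add: subset_iff)
  moreover have "x \<star> m \<in> act (x \<star> n) ` N" if "m \<in> N" for m
  proof -
    have "inv n \<otimes> m \<in> N" using that n S by (simp add: subgroup.m_closed subgroup.m_inv_closed)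
    moreover have "n \<in> carrier G" "m \<in> carrier G" using n that N_sub by auto
    then have "x \<star> m = x \<star> n \<star> (inv n \<otimes> m)"
      using x by (simp add: m_assoc[symmetric] flip: act_mult)
    ultimately show ?thesis by blast
  qed
  ultimately show ?thesis
    unfolding orbit_closure_def by (metis (no_types, lifting) image_subsetI subset_antisym)
qed

text \<open>The closed set \<open>orbit_closure N x\<close> is invariant under \<open>N\<close>,
  since translation by \<open>n\<close> turns it into the orbit closure of
  \<open>x \<star> n\<close>, which is the same set. With \<open>y\<close> it contains the orbit of
  \<open>y\<close> and its closure.\<close>

lemma orbit_closure_mono:
  assumes x: "x \<in> topspace F" and y: "y \<in> orbit_closure N x"
  shows "orbit_closure N y \<subseteq> orbit_closure N x"
proof -
  have "y \<star> n \<in> orbit_closure N x" if "n \<in> N" for n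
    using orbit_closure_act[OF x, of n] orbit_closure_N[OF x that] that N_sub y by blast
  then show ?thesis
    using closed_orbit_closure[of N x] closure_of_minimal[of "act y ` N" "orbit_closure N x" F]
    unfolding orbit_closure_def[of N y] by blast
qed

text \<open>The orbit closure of \<open>x \<star> A\<close> depends only on the coset
  \<open>N #> A\<close>: for \<open>A = n \<otimes> B\<close>, the factor \<open>n\<close> is
  absorbed into the orbit of \<open>x\<close>.\<close>

lemma finite_orbit_closures:
  assumes x: "x \<in> topspace F"
  shows "finite ((\<lambda>A. orbit_closure N (x \<star> A)) ` carrier G)"
proof -
  have eq: "orbit_closure N (x \<star> A) = orbit_closure N (x \<star> B)"
    if AB: "A \<in> carrier G" "B \<in> carrier G" and "N #> A = N #> B" for A B
  proof -
    have "A \<in> N #> B" using that rcos_self N_normal normal_imp_subgroup by metis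
    then obtain n where n: "n \<in> N" "A = n \<otimes> B" by (auto simp: r_coset_def)
    have nG: "n \<in> carrier G" using n N_sub by blast
    have "orbit_closure N (x \<star> A) = (\<lambda>y. y \<star> B) ` orbit_closure N (x \<star> n)"
      using n(2) nG x AB act_mult act_in orbit_closure_act by simp
    also have "\<dots> = orbit_closure N (x \<star> B)"
      using orbit_closure_N[OF x n(1)] orbit_closure_act[OF x AB(2)] by simp
    finally show ?thesis .
  qed
  have "finite ((\<lambda>A. N #> A) ` carrier G)"
    using N by (simp add: normal_finite_index_def RCOSETS_def UNION_singleton_eq_range)
  then show ?thesis by (rule finite_image_factor) (rule eq)
qed

text \<open>Finite index makes the union of the translates closed, and it contains a dense
  orbit.\<close>

lemma orbit_closures_cover:
  assumes x: "x \<in> topspace F" and y: "y \<in> topspace F"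
  obtains A where "A \<in> carrier G" "y \<in> orbit_closure N (x \<star> A)"
proof -
  let ?U = "\<Union>A\<in>carrier G. orbit_closure N (x \<star> A)"
  have "closedin F ?U"
    using finite_orbit_closures[OF x] closed_orbit_closure by (intro closedin_Union) auto
  moreover have "act x ` carrier G \<subseteq> ?U"
    using orbit_closure_refl act_in x by blast
  ultimately have "F closure_of (act x ` carrier G) \<subseteq> ?U"
    by (rule closure_of_minimal[rotated])
  then show ?thesis using that dense_orbits[OF x] y by blast
qed

text \<open>Finitely many translates of \<open>orbit_closure N x\<close> cover the space. An inclusion-minimal one
  contains no smaller orbit closure, and hence, by translation, none does.\<close>

lemma orbit_closure_eq:
  assumes x: "x \<in> topspace F" and y: "y \<in> orbit_closure N x"
  shows "orbit_closure N y = orbit_closure N x"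
proof -
  let ?\<D> = "(\<lambda>A. orbit_closure N (x \<star> A)) ` carrier G"
  obtain D where D: "D \<in> ?\<D>" and min: "\<And>D'. D' \<in> ?\<D> \<Longrightarrow> D' \<subseteq> D \<Longrightarrow> D' = D"
    using finite_has_minimal[OF finite_orbit_closures[OF x]] one_closed by blast
  then obtain A where A: "A \<in> carrier G" "D = orbit_closure N (x \<star> A)" by blast
  have xA: "x \<star> A \<in> topspace F" using x A act_in by simp
  have D_eq: "orbit_closure N z = D" if z: "z \<in> D" for z
  proof -
    have zF: "z \<in> topspace F" using z A closedin_subset[OF closed_orbit_closure] by blast
    have zD: "orbit_closure N z \<subseteq> D" using orbit_closure_mono[OF xA] z A by blast
    \<comment> \<open>Some translate of \<open>z\<close> has the base point of \<open>D\<close> in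
      its orbit closure. Translating back by \<open>inv B\<close> yields a member of the finite
      family inside \<open>orbit_closure N z\<close>, which lies in \<open>D\<close>; minimality
      forces equality.\<close>
    obtain B where B: "B \<in> carrier G" "x \<star> A \<in> orbit_closure N (z \<star> B)"
      using orbit_closures_cover[OF zF xA] .
    have zB: "z \<star> B \<in> topspace F" using zF B act_in by simp
    have "D \<subseteq> orbit_closure N (z \<star> B)"
      using orbit_closure_mono[OF zB B(2)] A by simp
    then have "(\<lambda>y. y \<star> inv B) ` D \<subseteq> orbit_closure N (z \<star> B \<star> inv B)"
      using orbit_closure_act[OF zB, of "inv B"] B by auto
    then have "orbit_closure N (x \<star> (A \<otimes> inv B)) \<subseteq> orbit_closure N z"
      using orbit_closure_act[OF xA, of "inv B"] A B x act_inv(1)[OF zF B(1)] by (simp add: act_mult)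
    moreover have "orbit_closure N (x \<star> (A \<otimes> inv B)) \<in> ?\<D>" using A B by blast
    ultimately show ?thesis using zD min by blast
  qed
  have yF: "y \<in> topspace F" using y closedin_subset[OF closed_orbit_closure] by blast
  have "y \<star> A \<in> D" using orbit_closure_act[OF x A(1)] A y by blast
  then have "orbit_closure N (y \<star> A) = orbit_closure N (x \<star> A)" using D_eq A by simp
  then have "orbit_closure N (y \<star> A \<star> inv A) = orbit_closure N (x \<star> A \<star> inv A)"
    using orbit_closure_act[OF xA, of "inv A"] orbit_closure_act[of "y \<star> A" "inv A"] A yF act_in by simp
  then show ?thesis using act_inv(1) A x yF by simp
qed

text \<open>The translates are finitely many closed sets that cover the space and are equal or
  disjoint; so each is the complement of a finite union of closed sets.\<close>

lemma open_orbit_closure: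
  assumes x: "x \<in> topspace F" shows "openin F (orbit_closure N x)"
proof -
  let ?\<D> = "(\<lambda>A. orbit_closure N (x \<star> A)) ` carrier G"
  have sub: "orbit_closure N y \<subseteq> topspace F" for y
    using closedin_subset[OF closed_orbit_closure] .
  have "z \<in> topspace F - \<Union>(?\<D> - {orbit_closure N x}) \<longleftrightarrow> z \<in> orbit_closure N x" for z
  proof
    assume z: "z \<in> topspace F - \<Union>(?\<D> - {orbit_closure N x})"
    obtain A where "A \<in> carrier G" "z \<in> orbit_closure N (x \<star> A)"
      using orbit_closures_cover[OF x] z by blast
    then show "z \<in> orbit_closure N x" using z by blast
  next
    assume z: "z \<in> orbit_closure N x"
    have "orbit_closure N (x \<star> A) = orbit_closure N x" if "A \<in> carrier G" "z \<in> orbit_closure N (x \<star> A)" for A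
      using orbit_closure_eq[OF x z] orbit_closure_eq[OF act_in[OF x that(1)] that(2)] by simp
    then show "z \<in> topspace F - \<Union>(?\<D> - {orbit_closure N x})" using z sub by blast
  qed
  then have "orbit_closure N x = topspace F - \<Union>(?\<D> - {orbit_closure N x})" by blast
  moreover have "closedin F (\<Union>(?\<D> - {orbit_closure N x}))"
    using finite_orbit_closures[OF x] closed_orbit_closure by (intro closedin_Union) auto
  ultimately show ?thesis by (metis closedin_def)
qed

end

end


section \<open>Coverings\<close>

lemma topspace_profinite_topology:
  assumes "group G" shows "topspace (profinite_topology G) = carrier G"
proof -
  interpret group G by fact
  have "carrier G \<lhd> G" using normal_inv_iff subgroup_self by auto
  moreover have "rcosets\<^bsub>G\<^esub> (carrier G) \<subseteq> {carrier G}"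
    by (auto simp: RCOSETS_def coset_join2 subgroup_self)
  ultimately have "normal_finite_index (carrier G) G"
    by (simp add: normal_finite_index_def finite_subset)
  then have "openin (profinite_topology G) (carrier G)"
    unfolding openin_profinite_topology using l_coset_subset_G by blast
  moreover have "topspace (profinite_topology G) \<subseteq> carrier G"
    using openin_topspace[of "profinite_topology G"] unfolding openin_profinite_topology by blast
  ultimately show ?thesis using openin_subset by blast
qed

lemma covering_projectionE:
  assumes "covering_projection T X q" "x \<in> topspace X"
  obtains U \<V> where "openin X U" "x \<in> U" "\<Union>\<V> = {e \<in> topspace T. q e \<in> U}" "pairwise disjnt \<V>"
    "\<And>V. V \<in> \<V> \<Longrightarrow> openin T V" "\<And>V. V \<in> \<V> \<Longrightarrow> inj_on q V"
proof -
  have "\<exists>U. openin X U \<and> x \<in> U \<and> (\<exists>\<V>. \<Union>\<V> = {e \<in> topspace T. q e \<in> U} \<and> pairwise disjnt \<V> \<and>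
      (\<forall>V\<in>\<V>. openin T V \<and> homeomorphic_map (subtopology T V) (subtopology X U) q))"
    using assms by (simp add: covering_projection_def)
  then obtain U \<V> where U: "openin X U" "x \<in> U"
      and \<V>: "\<Union>\<V> = {e \<in> topspace T. q e \<in> U}" "pairwise disjnt \<V>"
      and *: "\<forall>V\<in>\<V>. openin T V \<and> homeomorphic_map (subtopology T V) (subtopology X U) q"
    by (elim exE conjE) (rule that)
  have "openin T V" "inj_on q V" if "V \<in> \<V>" for V
  proof -
    have V: "openin T V" "homeomorphic_map (subtopology T V) (subtopology X U) q" using * that by auto
    have "topspace T \<inter> V = V" using openin_subset[OF V(1)] by blast
    then show "openin T V" "inj_on q V" using V homeomorphic_imp_injective_map[OF V(2)] by auto
  qed
  then show ?thesis using that[OF U \<V>] by simp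
qed

text \<open>The truth value of \<open>f w = g w\<close> is locally constant: near \<open>z\<close>
  each map stays in one sheet, and the two sheets are either the same, where \<open>q\<close> is
  injective, or disjoint. Applied to paths and, with a whole covering space as \<open>Y\<close>, to
  bonding maps.\<close>

lemma covering_unique_lift:
  assumes cov: "covering_projection T X q" and Y: "connected_space Y"
    and f: "continuous_map Y T f" and g: "continuous_map Y T g"
    and fg: "\<And>y. y \<in> topspace Y \<Longrightarrow> q (f y) = q (g y)"
    and a: "a \<in> topspace Y" "f a = g a" and y: "y \<in> topspace Y"
  shows "f y = g y"
proof -
  let ?S = "{y \<in> topspace Y. f y = g y}"
  have q: "continuous_map T X q" using cov by (simp add: covering_projection_def)
  have fT: "f z \<in> topspace T" "g z \<in> topspace T" "q (f z) \<in> topspace X" if "z \<in> topspace Y" for z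
    using that f g q by (auto simp: continuous_map_def Pi_iff)
  have nbhd: "\<exists>W. openin Y W \<and> z \<in> W \<and> (\<forall>w\<in>W. (f w = g w) = (f z = g z))"
    if z: "z \<in> topspace Y" for z
  proof -
    obtain U \<V> where U: "openin X U" "q (f z) \<in> U" and \<V>: "\<Union>\<V> = {e \<in> topspace T. q e \<in> U}" "pairwise disjnt \<V>"
        "\<And>V. V \<in> \<V> \<Longrightarrow> openin T V" "\<And>V. V \<in> \<V> \<Longrightarrow> inj_on q V"
      by (rule covering_projectionE[OF cov fT(3)[OF z]]) (rule that)
    obtain V V' where V: "V \<in> \<V>" "f z \<in> V" and V': "V' \<in> \<V>" "g z \<in> V'"
    proof -
      have "f z \<in> \<Union>\<V>" "g z \<in> \<Union>\<V>" unfolding \<V>(1) using U fT[OF z] fg[OF z] by auto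
      then obtain V V' where "V \<in> \<V>" "f z \<in> V" "V' \<in> \<V>" "g z \<in> V'" by (elim UnionE)
      then show ?thesis by (rule that)
    qed
    let ?W = "{w \<in> topspace Y. f w \<in> V} \<inter> {w \<in> topspace Y. g w \<in> V'}"
    have "openin Y ?W"
      using \<V>(3) V V' f g openin_continuous_map_preimage by blast
    moreover have "(f w = g w) = (f z = g z)" if w: "w \<in> ?W" for w
    proof (cases "V = V'")
      case True
      have "inj_on q V" using \<V>(4) V by blast
      moreover have "q (f w) = q (g w)" "q (f z) = q (g z)" using fg w z by auto
      ultimately have "f w = g w" "f z = g z"
        using w True V(2) V'(2) by (simp_all add: inj_on_eq_iff)
      then show ?thesis by simp
    next
      case False
      then have "disjnt V V'" using \<V>(2) V V' by (meson pairwiseD)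
      then show ?thesis using w V(2) V'(2) by (auto simp: disjnt_iff)
    qed
    ultimately show ?thesis using z V V' by (intro exI[of _ ?W]) blast
  qed
  have "openin Y ?S"
  proof (subst openin_subopen, rule ballI)
    fix z assume z: "z \<in> ?S"
    then obtain W where W: "openin Y W" "z \<in> W" "\<And>w. w \<in> W \<Longrightarrow> (f w = g w) = (f z = g z)"
      using nbhd[of z] by auto
    have "f w = g w" if "w \<in> W" for w using W(3)[OF that] z by simp
    then have "W \<subseteq> ?S" using openin_subset[OF W(1)] by auto
    then show "\<exists>W. openin Y W \<and> z \<in> W \<and> W \<subseteq> ?S" using W(1,2) by blast
  qed
  moreover have "openin Y (topspace Y - ?S)"
  proof (subst openin_subopen, rule ballI)
    fix z assume z: "z \<in> topspace Y - ?S"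
    then obtain W where W: "openin Y W" "z \<in> W" "\<And>w. w \<in> W \<Longrightarrow> (f w = g w) = (f z = g z)"
      using nbhd[of z] by auto
    have "f w \<noteq> g w" if "w \<in> W" for w using W(3)[OF that] z by simp
    then have "W \<subseteq> topspace Y - ?S" using openin_subset[OF W(1)] by auto
    then show "\<exists>W. openin Y W \<and> z \<in> W \<and> W \<subseteq> topspace Y - ?S" using W(1,2) by blast
  qed
  then have "closedin Y ?S" by (auto simp: closedin_def)
  ultimately have "?S = {} \<or> ?S = topspace Y"
    using Y unfolding connected_space_clopen_in by blast
  then show ?thesis using a y by blast
qed

section \<open>Inverse limits as subspaces of products\<close>

lemma topspace_inverse_limit:
  "topspace (inverse_limit J leq T b) =
     {z \<in> (\<Pi>\<^sub>E i\<in>J. topspace (T i)). \<forall>i\<in>J. \<forall>j\<in>J. leq i j \<longrightarrow> b i j (z j) = z i}"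
  by (auto simp: inverse_limit_def)

lemma continuous_map_into_inverse_limit_iff:
  "continuous_map Z (inverse_limit J leq T b) f \<longleftrightarrow>
     f ` topspace Z \<subseteq> topspace (inverse_limit J leq T b) \<and> (\<forall>i\<in>J. continuous_map Z (T i) (\<lambda>z. f z i))"
proof -
  have "f z i \<in> topspace (T i)" if "continuous_map Z (T i) (\<lambda>z. f z i)" "z \<in> topspace Z" for z i
    using that by (auto simp: continuous_map_def)
  then show ?thesis
    unfolding inverse_limit_def
    by (auto simp: continuous_map_in_subtopology continuous_map_componentwise Pi_iff PiE_iff image_subset_iff)
qed

section \<open>Limits of finite regular coverings\<close>

locale covering_limit = lifting_projection E X p
  for E :: "'e topology" and X :: "'x topology" and p :: "'e \<Rightarrow> 'x" +
  fixes J :: "'i set" and leq :: "'i \<Rightarrow> 'i \<Rightarrow> bool" and T :: "'i \<Rightarrow> 't topology"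
    and q :: "'i \<Rightarrow> 't \<Rightarrow> 'x" and b :: "'i \<Rightarrow> 'i \<Rightarrow> 't \<Rightarrow> 't" and h :: "'e \<Rightarrow> 'i \<Rightarrow> 't"
  assumes sys: "inverse_system J leq T b"
    and pconn: "i \<in> J \<Longrightarrow> path_connected_space (T i)"
    and frc: "i \<in> J \<Longrightarrow> finite_regular_covering (T i) X (q i)"
    and qb: "i \<in> J \<Longrightarrow> j \<in> J \<Longrightarrow> leq i j \<Longrightarrow> t \<in> topspace (T j) \<Longrightarrow> q i (b i j t) = q j t"
    and homeo: "homeomorphic_map E (inverse_limit J leq T b) h"
    and qh: "e \<in> topspace E \<Longrightarrow> i \<in> J \<Longrightarrow> q i (h e i) = p e"
begin

lemma J_directed_set: "directed_set J leq"
  and continuous_bonding: "i \<in> J \<Longrightarrow> j \<in> J \<Longrightarrow> leq i j \<Longrightarrow> continuous_map (T j) (T i) (b i j)"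
  using sys unfolding inverse_system_def by blast+

lemma J_nonempty: "J \<noteq> {}"
  and J_directed: "i \<in> J \<Longrightarrow> j \<in> J \<Longrightarrow> \<exists>k\<in>J. leq i k \<and> leq j k"
  and J_trans: "i \<in> J \<Longrightarrow> j \<in> J \<Longrightarrow> k \<in> J \<Longrightarrow> leq i j \<Longrightarrow> leq j k \<Longrightarrow> leq i k"
  using J_directed_set unfolding directed_set_def by blast+

lemma covering: "i \<in> J \<Longrightarrow> covering_projection (T i) X (q i)"
  and regular: "i \<in> J \<Longrightarrow> regular_projection (T i) (q i)"
  and finite_fibres: "i \<in> J \<Longrightarrow> x \<in> topspace X \<Longrightarrow> finite (fibre_set (T i) (q i) x)"
  using frc by (auto simp: finite_regular_covering_def)

lemma h_limit: "e \<in> topspace E \<Longrightarrow> h e \<in> topspace (inverse_limit J leq T b)"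
  using homeomorphic_imp_surjective_map[OF homeo] by blast

lemma h_in: "e \<in> topspace E \<Longrightarrow> i \<in> J \<Longrightarrow> h e i \<in> topspace (T i)"
  and b_h: "e \<in> topspace E \<Longrightarrow> i \<in> J \<Longrightarrow> j \<in> J \<Longrightarrow> leq i j \<Longrightarrow> b i j (h e j) = h e i"
  using h_limit unfolding topspace_inverse_limit by auto

lemma continuous_h: "i \<in> J \<Longrightarrow> continuous_map E (T i) (\<lambda>e. h e i)"
  using homeomorphic_imp_continuous_map[OF homeo] unfolding continuous_map_into_inverse_limit_iff by blast

text \<open>The coordinate of a lift in \<open>E\<close> is a lift in \<open>T i\<close>, hence
  equal to \<gamma>. Paths in a single covering space thereby control endpoints in
  \<open>E\<close>.\<close>

lemma comp_lift_end:
  assumes i: "i \<in> J" and e: "e \<in> topspace E" and \<alpha>: "pathin X \<alpha>" "\<alpha> 0 = p e"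
    and \<gamma>: "pathin (T i) \<gamma>" "\<gamma> 0 = h e i" "\<And>t. t \<in> {0..1} \<Longrightarrow> q i (\<gamma> t) = \<alpha> t"
  shows "h (e \<cdot> \<alpha>) i = \<gamma> 1"
proof -
  obtain \<delta> where \<delta>: "is_lift e \<alpha> \<delta>" using lift_exists e \<alpha> by blast
  then have \<delta>': "pathin E \<delta>" "\<delta> 0 = e" "\<And>t. t \<in> {0..1} \<Longrightarrow> p (\<delta> t) = \<alpha> t"
    by (auto simp: is_lift_def)
  have \<delta>E: "\<delta> t \<in> topspace E" if "t \<in> {0..1}" for t
    using \<delta>'(1) that by (auto simp: pathin_def continuous_map_def)
  have h\<delta>: "continuous_map unit_interval (T i) (\<lambda>t. h (\<delta> t) i)"
    using continuous_map_compose[OF _ continuous_h[OF i]] \<delta>'(1) by (force simp: pathin_def o_def)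
  have "(\<lambda>t. h (\<delta> t) i) 1 = \<gamma> 1"
  proof (rule covering_unique_lift[OF covering[OF i] _ h\<delta>, where a = 0])
    show "connected_space unit_interval" by (simp add: is_interval_cc)
    show "continuous_map unit_interval (T i) \<gamma>" using \<gamma>(1) by (simp add: pathin_def)
  qed (use \<gamma> \<delta>' \<delta>E qh i in auto)
  then show ?thesis using lift_end_eq[OF \<delta>] by simp
qed

text \<open>Only the \<open>i\<close>-th coordinates of \<open>e\<close> and \<open>e'\<close> are
  related by \<phi>. With the identity, the coordinate of \<open>e \<cdot> \<alpha>\<close> depends
  on that of \<open>e\<close> alone; with a deck transformation of \<open>T i\<close>, monodromy in
  \<open>T i\<close> commutes with it.\<close>

lemma comp_lift_end_map:
  assumes i: "i \<in> J" and e: "e \<in> topspace E" "e' \<in> topspace E" and \<alpha>: "pathin X \<alpha>" "\<alpha> 0 = p e"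
    and \<phi>: "continuous_map (T i) (T i) \<phi>" "\<And>t. t \<in> topspace (T i) \<Longrightarrow> q i (\<phi> t) = q i t"
    and e': "h e' i = \<phi> (h e i)"
  shows "h (e' \<cdot> \<alpha>) i = \<phi> (h (e \<cdot> \<alpha>) i)"
proof -
  obtain \<delta> where \<delta>: "is_lift e \<alpha> \<delta>" using lift_exists e \<alpha> by blast
  then have \<delta>': "pathin E \<delta>" "\<delta> 0 = e" "\<And>t. t \<in> {0..1} \<Longrightarrow> p (\<delta> t) = \<alpha> t"
    by (auto simp: is_lift_def)
  have \<delta>E: "\<delta> t \<in> topspace E" if "t \<in> {0..1}" for t
    using \<delta>'(1) that by (auto simp: pathin_def continuous_map_def)
  have "pathin (T i) (\<lambda>t. \<phi> (h (\<delta> t) i))"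
    using pathin_compose[OF \<delta>'(1) continuous_map_compose[OF continuous_h[OF i] \<phi>(1)]]
    by (simp add: o_def)
  moreover have "p e' = p e" using qh[OF _ i] e e' \<phi>(2) h_in i by metis
  ultimately have "h (e' \<cdot> \<alpha>) i = \<phi> (h (\<delta> 1) i)"
    using comp_lift_end[OF i e(2) \<alpha>(1), of "\<lambda>t. \<phi> (h (\<delta> t) i)"] \<alpha> \<delta>' \<delta>E e' \<phi>(2) h_in i qh by simp
  then show ?thesis using lift_end_eq[OF \<delta>] by simp
qed

text \<open>The deck transformations of the \<open>T i\<close> are chosen independently, subject
  only to \<open>\<phi> i (h e i) = h e' i\<close>. Any such choice is compatible with the bonding
  maps: the two composites from the connected \<open>T j\<close> to \<open>T i\<close> are maps over
  \<open>X\<close> that agree at \<open>h e j\<close>.\<close>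

lemma regular_limit: "regular_projection E p"
  unfolding regular_projection_def
proof (intro ballI impI)
  fix e e' assume e: "e \<in> topspace E" and e': "e' \<in> topspace E" and pe: "p e = p e'"
  let ?L = "inverse_limit J leq T b"
  have "\<forall>i. \<exists>\<phi>. i \<in> J \<longrightarrow> \<phi> \<in> deck_transformations (T i) (q i) \<and> \<phi> (h e i) = h e' i"
    using regular h_in[OF e] h_in[OF e'] qh[OF e] qh[OF e'] pe
    unfolding regular_projection_def by metis
  from choice[OF this] obtain \<phi> where
    "\<And>i. i \<in> J \<Longrightarrow> \<phi> i \<in> deck_transformations (T i) (q i) \<and> \<phi> i (h e i) = h e' i"
    by blast
  then have \<phi>: "\<And>i. i \<in> J \<Longrightarrow> homeomorphic_map (T i) (T i) (\<phi> i)"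
      "\<And>i t. i \<in> J \<Longrightarrow> t \<in> topspace (T i) \<Longrightarrow> q i (\<phi> i t) = q i t"
      "\<And>i. i \<in> J \<Longrightarrow> \<phi> i (h e i) = h e' i"
    by (simp_all add: deck_transformations_def)
  have "\<forall>i. \<exists>\<psi>. i \<in> J \<longrightarrow> homeomorphic_maps (T i) (T i) (\<phi> i) \<psi>"
    using \<phi>(1) by (meson homeomorphic_map_maps)
  then obtain \<psi> where \<psi>: "\<And>i. i \<in> J \<Longrightarrow> homeomorphic_maps (T i) (T i) (\<phi> i) (\<psi> i)"
    by metis
  have \<phi>c: "continuous_map (T i) (T i) (\<phi> i)" and \<psi>c: "continuous_map (T i) (T i) (\<psi> i)"
    and \<psi>\<phi>: "\<And>t. t \<in> topspace (T i) \<Longrightarrow> \<psi> i (\<phi> i t) = t"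
    and \<phi>\<psi>: "\<And>t. t \<in> topspace (T i) \<Longrightarrow> \<phi> i (\<psi> i t) = t" if "i \<in> J" for i
    using \<psi>[OF that] by (auto simp: homeomorphic_maps_def)
  have in_T: "\<phi> i t \<in> topspace (T i)" "\<psi> i t \<in> topspace (T i)" if "i \<in> J" "t \<in> topspace (T i)" for i t
    using \<phi>c[OF that(1)] \<psi>c[OF that(1)] that(2) by (auto simp: continuous_map_def)
  have b_in: "b i j t \<in> topspace (T i)" if "i \<in> J" "j \<in> J" "leq i j" "t \<in> topspace (T j)" for i j t
    using continuous_bonding that by (auto simp: continuous_map_def)
  have \<phi>b: "b i j (\<phi> j t) = \<phi> i (b i j t)"
    if ij: "i \<in> J" "j \<in> J" "leq i j" and t: "t \<in> topspace (T j)" for i j t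
  proof (rule covering_unique_lift[OF covering[OF ij(1)], where a = "h e j" and y = t])
    show "connected_space (T j)" using pconn ij path_connected_imp_connected_space by blast
    show "continuous_map (T j) (T i) (\<lambda>t. b i j (\<phi> j t))" "continuous_map (T j) (T i) (\<lambda>t. \<phi> i (b i j t))"
      using continuous_map_compose[OF \<phi>c continuous_bonding] continuous_map_compose[OF continuous_bonding \<phi>c] ij
      by (simp_all add: o_def)
  qed (use ij t e e' h_in b_h qb \<phi>(2,3) in_T b_in in simp_all)
  have \<psi>b: "b i j (\<psi> j t) = \<psi> i (b i j t)"
    if ij: "i \<in> J" "j \<in> J" "leq i j" and t: "t \<in> topspace (T j)" for i j t
    using \<phi>b[OF ij, of "\<psi> j t"] \<phi>\<psi> \<psi>\<phi> in_T b_in ij t by metis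
  \<comment> \<open>The family is a parameter, so that one continuity proof serves the maps and
    their inverses; restriction to \<open>J\<close> keeps the values extensional, as points of the
    product must be.\<close>
  define \<Phi> where "\<Phi> = (\<lambda>(\<phi> :: 'i \<Rightarrow> 't \<Rightarrow> 't) z. \<lambda>i\<in>J. \<phi> i (z i))"
  have \<Phi>: "continuous_map ?L ?L (\<Phi> f)"
    if fc: "\<And>i. i \<in> J \<Longrightarrow> continuous_map (T i) (T i) (f i)"
      and fb: "\<And>i j t. i \<in> J \<Longrightarrow> j \<in> J \<Longrightarrow> leq i j \<Longrightarrow> t \<in> topspace (T j) \<Longrightarrow> b i j (f j t) = f i (b i j t)"
    for f
    unfolding continuous_map_into_inverse_limit_iff
  proof (intro conjI ballI)
    show "\<Phi> f ` topspace ?L \<subseteq> topspace ?L"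
      unfolding topspace_inverse_limit
    proof clarify
      fix z assume z: "z \<in> (\<Pi>\<^sub>E i\<in>J. topspace (T i))" "\<forall>i\<in>J. \<forall>j\<in>J. leq i j \<longrightarrow> b i j (z j) = z i"
      then show "\<Phi> f z \<in> (\<Pi>\<^sub>E i\<in>J. topspace (T i)) \<and>
          (\<forall>i\<in>J. \<forall>j\<in>J. leq i j \<longrightarrow> b i j (\<Phi> f z j) = \<Phi> f z i)"
        using fc fb by (auto simp: \<Phi>_def continuous_map_def PiE_iff Pi_iff)
    qed
    show "continuous_map ?L (T i) (\<lambda>z. \<Phi> f z i)" if i: "i \<in> J" for i
    proof -
      have "continuous_map ?L (T i) (\<lambda>z. z i)"
        unfolding inverse_limit_def
        by (intro continuous_map_from_subtopology continuous_map_product_projection i)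
      from continuous_map_compose[OF this fc[OF i]] show ?thesis
        using i by (simp add: \<Phi>_def o_def)
    qed
  qed
  have "homeomorphic_maps ?L ?L (\<Phi> \<phi>) (\<Phi> \<psi>)"
    unfolding homeomorphic_maps_def
  proof (intro conjI ballI)
    show "continuous_map ?L ?L (\<Phi> \<phi>)" "continuous_map ?L ?L (\<Phi> \<psi>)"
      using \<Phi> \<phi>c \<phi>b \<psi>c \<psi>b by blast+
    show "\<Phi> \<psi> (\<Phi> \<phi> z) = z" "\<Phi> \<phi> (\<Phi> \<psi> z) = z" if "z \<in> topspace ?L" for z
      using that \<psi>\<phi> \<phi>\<psi> unfolding topspace_inverse_limit
      by (auto simp: \<Phi>_def PiE_iff extensional_def fun_eq_iff)
  qed
  moreover obtain g where g: "homeomorphic_maps E ?L h g"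
    using homeo homeomorphic_map_maps by blast
  ultimately have "homeomorphic_map E E (g \<circ> \<Phi> \<phi> \<circ> h)"
    using homeomorphic_map_compose homeomorphic_maps_map homeomorphic_maps_sym homeomorphic_map_maps
    by (metis (no_types, lifting))
  moreover have \<Phi>h: "\<Phi> \<phi> (h a) \<in> topspace ?L" if "a \<in> topspace E" for a
    using \<Phi>[of \<phi>] \<phi>c \<phi>b h_limit[OF that] by (auto simp: continuous_map_def)
  then have hg: "h (g (\<Phi> \<phi> (h a))) = \<Phi> \<phi> (h a)" "g (\<Phi> \<phi> (h a)) \<in> topspace E" if "a \<in> topspace E" for a
    using g that by (auto simp: homeomorphic_maps_def continuous_map_def)
  have "p ((g \<circ> \<Phi> \<phi> \<circ> h) a) = p a" if a: "a \<in> topspace E" for a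
  proof -
    obtain i where i: "i \<in> J" using J_nonempty by blast
    have "p (g (\<Phi> \<phi> (h a))) = q i (h (g (\<Phi> \<phi> (h a))) i)"
      by (rule qh[OF hg(2)[OF a] i, symmetric])
    also have "\<dots> = q i (\<phi> i (h a i))" using hg a i by (simp add: \<Phi>_def)
    also have "\<dots> = p a" using \<phi>(2) h_in a i qh by simp
    finally show ?thesis by simp
  qed
  ultimately have "g \<circ> \<Phi> \<phi> \<circ> h \<in> deck_transformations E p"
    by (simp add: deck_transformations_def)
  moreover have "\<Phi> \<phi> (h e) = h e'"
    using \<phi>(3) h_limit[OF e'] unfolding topspace_inverse_limit by (auto simp: \<Phi>_def PiE_iff extensional_def fun_eq_iff)
  then have "(g \<circ> \<Phi> \<phi> \<circ> h) e = e'" using g e' by (simp add: homeomorphic_maps_def)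
  ultimately show "\<exists>\<phi>\<in>deck_transformations E p. \<phi> e = e'" by blast
qed

text \<open>A basic open set of the product constrains finitely many coordinates. An index above all
  of them sees each constraint through a bonding map, so one coordinate suffices.\<close>

lemma openin_limit_basis:
  assumes Q: "openin E Q" "e \<in> Q"
  obtains i U where "i \<in> J" "openin (T i) U" "h e i \<in> U"
    "\<And>e'. e' \<in> topspace E \<Longrightarrow> h e' i \<in> U \<Longrightarrow> e' \<in> Q"
proof -
  let ?L = "inverse_limit J leq T b"
  have e: "e \<in> topspace E" using Q openin_subset by blast
  have "openin ?L (h ` Q)"
    using homeomorphic_imp_open_map[OF homeo] Q by (simp add: open_map_def)
  then obtain W where W: "openin (product_topology T J) W" "h ` Q = W \<inter> {z. \<forall>i\<in>J. \<forall>j\<in>J. leq i j \<longrightarrow> b i j (z j) = z i}"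
    unfolding inverse_limit_def openin_subtopology by blast
  have "h e \<in> W" using Q(2) W(2) by blast
  then obtain V where V: "finite {i \<in> J. V i \<noteq> topspace (T i)}" "\<And>i. i \<in> J \<Longrightarrow> openin (T i) (V i)"
      "h e \<in> Pi\<^sub>E J V" "Pi\<^sub>E J V \<subseteq> W"
    using W(1) unfolding openin_product_topology_alt by metis
  have bound: "\<exists>k\<in>J. \<forall>i\<in>K. leq i k" if "finite K" "K \<subseteq> J" for K
    using that
  proof (induction K rule: finite_induct)
    case empty then show ?case using J_nonempty by blast
  next
    case (insert i K)
    then obtain k where k: "k \<in> J" "\<forall>i\<in>K. leq i k" by auto
    then obtain l where "l \<in> J" "leq k l" "leq i l" using J_directed insert.prems by blast
    then have "\<forall>j\<in>insert i K. leq j l"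
      using k insert.prems J_trans[of _ k l] by auto
    then show ?case using \<open>l \<in> J\<close> by blast
  qed
  let ?K = "{i \<in> J. V i \<noteq> topspace (T i)}"
  obtain k where k: "k \<in> J" "\<And>i. i \<in> ?K \<Longrightarrow> leq i k" using bound[OF V(1)] by blast
  \<comment> \<open>The factor \<open>topspace (T k)\<close> covers the case of no constrained
    coordinate, where the intersection is the universal set.\<close>
  let ?U = "topspace (T k) \<inter> (\<Inter>i\<in>?K. {t \<in> topspace (T k). b i k t \<in> V i})"
  have "openin (T k) ?U"
  proof (rule openin_Int_Inter)
    show "finite ((\<lambda>i. {t \<in> topspace (T k). b i k t \<in> V i}) ` ?K)" using V(1) by blast
    show "openin (T k) S" if S: "S \<in> (\<lambda>i. {t \<in> topspace (T k). b i k t \<in> V i}) ` ?K" for S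
    proof -
      obtain i where i: "i \<in> ?K" "S = {t \<in> topspace (T k). b i k t \<in> V i}" using S by blast
      then show ?thesis
        using openin_continuous_map_preimage[OF continuous_bonding V(2)] k by simp
    qed
  qed simp
  moreover have "h e k \<in> ?U"
    using h_in[OF e k(1)] b_h[OF e] k V(3) by (auto simp: PiE_iff)
  moreover have "e' \<in> Q" if e': "e' \<in> topspace E" "h e' k \<in> ?U" for e'
  proof -
    have "h e' i \<in> V i" if i: "i \<in> J" for i
    proof (cases "i \<in> ?K")
      case True then show ?thesis using e'(2) b_h[OF e'(1) i k(1)] k(2) by auto
    next
      case False then show ?thesis using h_in[OF e'(1) i] i by auto
    qed
    then have "h e' \<in> Pi\<^sub>E J V"
      using h_limit[OF e'(1)] by (simp add: topspace_inverse_limit PiE_iff)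
    then have "h e' \<in> W" using V(4) by blast
    then have "h e' \<in> h ` Q"
      using W(2) h_limit[OF e'(1)] unfolding topspace_inverse_limit by blast
    then show ?thesis
      using homeomorphic_imp_injective_map[OF homeo] e'(1) Q(1) openin_subset by (meson inj_on_image_mem_iff)
  qed
  ultimately show ?thesis using that k(1) by blast
qed

text \<open>To reach a neighbourhood given by \<open>U\<close> in \<open>T i\<close>, take a path in
  \<open>T i\<close> from the coordinate of \<open>e0\<close> to that of \<open>e\<close>, push it
  down to \<open>X\<close> and lift it to \<open>E\<close> from \<open>e0\<close>: the endpoint has
  the same coordinate as \<open>e\<close>.\<close>

lemma dense_leaf_limit:
  assumes "e0 \<in> topspace E" shows "has_dense_leaf E"
  unfolding has_dense_leaf_def
proof (intro bexI)
  let ?L = "Collect (path_component_of E e0)"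
  show "?L \<in> path_components_of E" using assms by (simp add: path_components_of_def)
  show "E closure_of ?L = topspace E"
  proof (intro subset_antisym closure_of_subset_topspace subsetI)
    fix e assume e: "e \<in> topspace E"
    show "e \<in> E closure_of ?L"
      unfolding in_closure_of
    proof (intro conjI e allI impI, elim conjE)
      fix Q assume "e \<in> Q" "openin E Q"
      then obtain i U where i: "i \<in> J" "h e i \<in> U"
        "\<And>e'. e' \<in> topspace E \<Longrightarrow> h e' i \<in> U \<Longrightarrow> e' \<in> Q"
        using openin_limit_basis by metis
      obtain \<gamma> where \<gamma>: "pathin (T i) \<gamma>" "\<gamma> 0 = h e0 i" "\<gamma> 1 = h e i"
        using pconn[OF i(1)] h_in[OF _ i(1)] e assms unfolding path_connected_space_def by blast
      have "continuous_map (T i) X (q i)" using covering[OF i(1)] by (simp add: covering_projection_def)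
      then have q\<gamma>: "pathin X (\<lambda>t. q i (\<gamma> t))" "q i (\<gamma> 0) = p e0"
        using \<gamma> qh[OF assms i(1)] pathin_compose[of "T i" \<gamma> X "q i"] by (auto simp: o_def)
      then have "h (e0 \<cdot> (\<lambda>t. q i (\<gamma> t))) i = h e i"
        using comp_lift_end[OF i(1) assms q\<gamma> \<gamma>(1,2)] \<gamma>(3) by simp
      then show "\<exists>y. y \<in> ?L \<and> y \<in> Q"
        using lift_end[OF assms q\<gamma>] i by auto
    qed
  qed
qed

lemma comp_monodromy_map:
  assumes i: "i \<in> J" and e: "e \<in> fibre_set E p x" "e' \<in> fibre_set E p x" and A: "A \<in> carrier (fundamental_group X x)"
    and \<phi>: "continuous_map (T i) (T i) \<phi>" "\<And>t. t \<in> topspace (T i) \<Longrightarrow> q i (\<phi> t) = q i t"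
    and e': "h e' i = \<phi> (h e i)"
  shows "h (e' \<star> A) i = \<phi> (h (e \<star> A) i)"
proof -
  obtain \<alpha> where \<alpha>: "\<alpha> \<in> loops X x" "A = loop_class X \<alpha>" using A by (auto simp: carrier_fundamental_group)
  then show ?thesis
    using comp_lift_end_map[OF i _ _ _ _ \<phi> e', of \<alpha>] e by (auto simp: class_endpoint_eq loops_def)
qed

text \<open>\<open>N\<close> is the stabilizer of \<open>h e0 i\<close> under the monodromy of
  \<open>T i\<close>. Regularity makes it normal: a deck transformation takes \<open>h e0 i\<close>
  to a given translate and commutes with monodromy, so what fixes the one point fixes the other. A
  point of the finite fibre of \<open>T i\<close> determines the coset, which bounds the
  index.\<close>

lemma comp_stabilizer:
  assumes i: "i \<in> J" and e0: "e0 \<in> fibre_set E p x"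
  defines "N \<equiv> {A \<in> carrier (fundamental_group X x). h (e0 \<star> A) i = h e0 i}"
  shows "normal_finite_index N (fundamental_group X x)"
proof -
  let ?G = "fundamental_group X x"
  have x: "x \<in> topspace X" using e0 p_in by blast
  interpret group ?G using x by (rule group_fundamental_group)
  note in_F = monodromy_in
  have cong: "h (e' \<star> A) i = h (e \<star> A) i"
    if "e \<in> fibre_set E p x" "e' \<in> fibre_set E p x" "A \<in> carrier ?G" "h e' i = h e i" for e e' A
    using comp_monodromy_map[OF i that(1,2,3), of "\<lambda>t. t"] that(4) by simp
  have cancel: "e \<star> A \<star> inv\<^bsub>?G\<^esub> A = e" if "e \<in> fibre_set E p x" "A \<in> carrier ?G" for e A
    using monodromy_mult[OF that inv_closed[OF that(2)]] that monodromy_one[OF that(1)] by simp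
  have subgroup: "subgroup N ?G"
  proof (rule subgroupI)
    show "N \<subseteq> carrier ?G" by (auto simp: N_def)
    show "N \<noteq> {}" using monodromy_one[OF e0] by (auto simp: N_def)
    show "inv\<^bsub>?G\<^esub> A \<in> N" if A: "A \<in> N" for A
      using cong[OF e0 in_F[OF e0], of A "inv\<^bsub>?G\<^esub> A"] cancel[OF e0, of A] A by (simp add: N_def)
    show "A \<otimes>\<^bsub>?G\<^esub> B \<in> N" if "A \<in> N" "B \<in> N" for A B
      using cong[OF e0 in_F[OF e0], of A B] that by (simp add: N_def monodromy_mult[OF e0])
  qed
  have "N \<lhd> ?G"
    unfolding normal_inv_iff
  proof (intro conjI subgroup ballI)
    fix B A assume B: "B \<in> carrier ?G" and A: "A \<in> N"
    have AG: "A \<in> carrier ?G" and Ae: "h (e0 \<star> A) i = h e0 i" using A by (auto simp: N_def)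
    have eB: "e0 \<star> B \<in> fibre_set E p x" using in_F[OF e0 B] .
    have "q i (h e0 i) = q i (h (e0 \<star> B) i)" using qh[OF _ i] e0 eB by simp
    then obtain \<phi> where \<phi>: "\<phi> \<in> deck_transformations (T i) (q i)" "\<phi> (h e0 i) = h (e0 \<star> B) i"
      using regular[OF i] h_in[OF _ i] e0 eB unfolding regular_projection_def by blast
    then have "h (e0 \<star> B \<star> A) i = \<phi> (h (e0 \<star> A) i)"
      by (intro comp_monodromy_map[OF i e0 eB AG])
         (auto simp: deck_transformations_def homeomorphic_imp_continuous_map)
    then have "h (e0 \<star> B \<star> A \<star> inv\<^bsub>?G\<^esub> B) i = h (e0 \<star> B \<star> inv\<^bsub>?G\<^esub> B) i"
      using \<phi>(2) Ae cong[OF eB in_F[OF eB AG] inv_closed[OF B]] by simp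
    then show "B \<otimes>\<^bsub>?G\<^esub> A \<otimes>\<^bsub>?G\<^esub> inv\<^bsub>?G\<^esub> B \<in> N"
      using cancel[OF e0 B] AG B by (simp add: N_def monodromy_mult[OF e0])
  qed
  moreover have "finite (rcosets\<^bsub>?G\<^esub> N)"
  proof -
    let ?f = "\<lambda>A. h (e0 \<star> A) i"
    have *: "N #>\<^bsub>?G\<^esub> A = N #>\<^bsub>?G\<^esub> B" if A: "A \<in> carrier ?G" and B: "B \<in> carrier ?G" and AB: "?f A = ?f B" for A B
    proof -
      have "h (e0 \<star> A \<star> inv\<^bsub>?G\<^esub> B) i = h e0 i"
        using cong[OF in_F[OF e0 B] in_F[OF e0 A] inv_closed[OF B] AB] cancel[OF e0 B] by simp
      then have "A \<otimes>\<^bsub>?G\<^esub> inv\<^bsub>?G\<^esub> B \<in> N" using A B by (simp add: N_def monodromy_mult[OF e0])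
      then have "A \<in> N #>\<^bsub>?G\<^esub> B" using A B by (auto simp: r_coset_def m_assoc intro!: bexI[of _ "A \<otimes>\<^bsub>?G\<^esub> inv\<^bsub>?G\<^esub> B"])
      then show ?thesis using repr_independence[OF _ B subgroup] by simp
    qed
    have "?f ` carrier ?G \<subseteq> fibre_set (T i) (q i) x"
      using in_F[OF e0] h_in[OF _ i] qh[OF _ i] by auto
    then have "finite (?f ` carrier ?G)" using finite_fibres[OF i x] finite_subset by blast
    then have "finite ((\<lambda>A. N #>\<^bsub>?G\<^esub> A) ` carrier ?G)" by (rule finite_image_factor) (rule *)
    then show ?thesis by (simp add: RCOSETS_def UNION_singleton_eq_range)
  qed
  ultimately show ?thesis by (simp add: normal_finite_index_def)
qed

lemma profinite_limit:
  assumes e0: "e0 \<in> fibre_set E p x" shows "pi1_profinite E X p x e0"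
proof -
  let ?G = "fundamental_group X x" and ?L = "inverse_limit J leq T b"
  let ?\<theta> = "class_endpoint E p e0"
  have x: "x \<in> topspace X" using e0 p_in by blast
  interpret group ?G using x by (rule group_fundamental_group)
  have top: "topspace (profinite_topology ?G) = carrier ?G" by (simp add: topspace_profinite_topology is_group)
  have "continuous_map (profinite_topology ?G) (T i) (\<lambda>A. h (?\<theta> A) i)" if i: "i \<in> J" for i
    unfolding continuous_map_def
  proof (intro conjI allI impI)
    show "(\<lambda>A. h (?\<theta> A) i) \<in> topspace (profinite_topology ?G) \<rightarrow> topspace (T i)"
      using monodromy_in[OF e0] h_in i by (auto simp: top)
    fix U assume U: "openin (T i) U"
    let ?N = "{A \<in> carrier ?G. h (e0 \<star> A) i = h e0 i}"
    show "openin (profinite_topology ?G) {A \<in> topspace (profinite_topology ?G). h (?\<theta> A) i \<in> U}"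
      unfolding openin_profinite_topology top
    proof (intro conjI ballI exI)
      fix A assume A: "A \<in> {A \<in> carrier ?G. h (?\<theta> A) i \<in> U}"
      then have AG: "A \<in> carrier ?G" and eA: "e0 \<star> A \<in> fibre_set E p x" using monodromy_in[OF e0] by auto
      have "q i (h e0 i) = q i (h (e0 \<star> A) i)" using qh[OF _ i] e0 eA by simp
      then obtain \<phi> where \<phi>: "\<phi> \<in> deck_transformations (T i) (q i)" "\<phi> (h e0 i) = h (e0 \<star> A) i"
        using regular[OF i] h_in[OF _ i] e0 eA unfolding regular_projection_def by blast
      \<comment> \<open>Elements of the stabilizer fix \<open>h e0 i\<close>; by the deck
        transformation \<phi> they also fix its translate by \<open>A\<close>, so the coordinate is
        constant on the left coset of \<open>A\<close>.\<close>
      have "h (e0 \<star> A \<star> B) i = \<phi> (h (e0 \<star> B) i)" if "B \<in> carrier ?G" for B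
        using \<phi> by (intro comp_monodromy_map[OF i e0 eA that])
          (auto simp: deck_transformations_def homeomorphic_imp_continuous_map)
      then show "l_coset ?G A ?N \<subseteq> {A \<in> carrier ?G. h (?\<theta> A) i \<in> U}"
        using A AG \<phi>(2) by (auto simp: l_coset_def monodromy_mult[OF e0])
      show "normal_finite_index ?N ?G" by (rule comp_stabilizer[OF i e0])
    qed blast
  qed
  then have "continuous_map (profinite_topology ?G) ?L (\<lambda>A. h (?\<theta> A))"
    unfolding continuous_map_into_inverse_limit_iff using h_limit monodromy_in[OF e0] by (auto simp: top)
  moreover obtain g where g: "homeomorphic_maps E ?L h g"
    using homeo homeomorphic_map_maps by blast
  ultimately have "continuous_map (profinite_topology ?G) E (g \<circ> (\<lambda>A. h (?\<theta> A)))"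
    unfolding homeomorphic_maps_def by (blast intro: continuous_map_compose)
  then have "continuous_map (profinite_topology ?G) E ?\<theta>"
    by (rule continuous_map_eq) (use g monodromy_in[OF e0] in \<open>auto simp: top homeomorphic_maps_def\<close>)
  then show ?thesis
    unfolding pi1_profinite_def using monodromy_in[OF e0] by (auto simp: continuous_map_in_subtopology top)
qed

end

text \<open>Stated for arbitrary index and total types, because the theorem applies it to the
  canonical types and to all others.\<close>

lemma (in lifting_projection) limit_of_coverings_imp:
  assumes limit: "inverse_limit_of_finite_regular_coverings TYPE('i) TYPE('t) E X p"
    and e0: "e0 \<in> fibre_set E p x0"
  shows "regular_projection E p \<and> pi1_profinite E X p x0 e0 \<and> has_dense_leaf E"
proof -
  obtain J :: "'i set" and leq and T :: "'i \<Rightarrow> 't topology" and q b h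
    where *: "inverse_system J leq T b"
      "\<forall>i\<in>J. path_connected_space (T i) \<and> finite_regular_covering (T i) X (q i)"
      "\<forall>i\<in>J. \<forall>j\<in>J. leq i j \<longrightarrow> (\<forall>t\<in>topspace (T j). q i (b i j t) = q j t)"
      "homeomorphic_map E (inverse_limit J leq T b) h"
      "\<forall>e\<in>topspace E. \<forall>i\<in>J. q i (h e i) = p e"
    using limit unfolding inverse_limit_of_finite_regular_coverings_def by (elim exE conjE) (rule that)
  interpret covering_limit E X p J leq T q b h
    by unfold_locales (use * in simp_all)
  show ?thesis using regular_limit profinite_limit[OF e0] dense_leaf_limit[of e0] e0 by simp
qed

context lifting_projection
begin

section \<open>Local triviality\<close>

text \<open>Contract \<open>V\<close> in \<open>X\<close> to a point and move this point to
  \<open>x0\<close>: the tracks are paths \<open>\<alpha> v\<close> from \<open>v\<close> to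
  \<open>x0\<close> that vary continuously with \<open>v\<close>. Lifting along them and along their
  reverses gives continuous maps inverse to each other.\<close>

lemma local_trivialization:
  assumes X: "path_connected_space X" "locally_contractible_space X" and x0: "x0 \<in> topspace X"
    and x: "x \<in> topspace X"
  obtains V \<alpha> where "openin X V" "x \<in> V"
    "\<And>v. v \<in> V \<Longrightarrow> pathin X (\<alpha> v) \<and> \<alpha> v 0 = v \<and> \<alpha> v 1 = x0"
    "homeomorphic_maps (subtopology E {e \<in> topspace E. p e \<in> V})
       (prod_topology (subtopology X V) (fibre E p x0))
       (\<lambda>e. (p e, e \<cdot> \<alpha> (p e))) (\<lambda>(v, f). f \<cdot> (\<lambda>t. \<alpha> v (1 - t)))"
proof -
  \<comment> \<open>The ambient neighbourhood is taken to be the whole space: the tracks may leave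
    \<open>V\<close>.\<close>
  obtain V c where V: "openin X V" "x \<in> V"
    and c: "homotopic_with (\<lambda>_. True) (subtopology X V) X (\<lambda>v. v) (\<lambda>_. c)"
    using X(2) x openin_topspace unfolding locally_contractible_space_def
    by (metis subtopology_topspace)
  have VX: "V \<subseteq> topspace X" using openin_subset V by blast
  have "(\<lambda>_. c) ` topspace (subtopology X V) \<subseteq> topspace X"
    using homotopic_with_imp_continuous_maps[OF c] continuous_map_image_subset_topspace by blast
  then have "c \<in> topspace X" using V VX by auto
  then have "homotopic_with (\<lambda>_. True) (subtopology X V) X (\<lambda>_. c) (\<lambda>_. x0)"
    using X(1) x0 by (simp add: homotopic_constant_maps path_connected_space_iff_path_component)
  from homotopic_with_trans[OF c this] obtain H
    where H: "continuous_map (prod_topology unit_interval (subtopology X V)) X H"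
      and H01: "\<And>v. H (0, v) = v" "\<And>v. H (1, v) = x0"
    unfolding homotopic_with_def by auto
  define \<alpha> where "\<alpha> = (\<lambda>v t. H (t, v))"
  have \<alpha>: "pathin X (\<alpha> v) \<and> \<alpha> v 0 = v \<and> \<alpha> v 1 = x0" if v: "v \<in> V" for v
  proof -
    have "continuous_map unit_interval (prod_topology unit_interval (subtopology X V)) (\<lambda>t. (t, v))"
      using v VX by (intro continuous_map_pairedI) auto
    from continuous_map_compose[OF this H] show ?thesis
      using H01 by (simp add: pathin_def \<alpha>_def o_def)
  qed
  let ?P = "{e \<in> topspace E. p e \<in> V}"
  let ?EV = "subtopology E ?P" and ?XV = "subtopology X V" and ?F = "fibre E p x0"
  let ?\<chi> = "\<lambda>e. e \<cdot> \<alpha> (p e)" and ?\<psi> = "\<lambda>z. snd z \<cdot> (\<lambda>t. \<alpha> (fst z) (1 - t))"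
  have p: "continuous_map ?EV ?XV p"
    using continuous_map_from_subtopology[OF continuous_p] by (auto simp: continuous_map_in_subtopology)
  have "continuous_map (prod_topology ?EV unit_interval) (prod_topology unit_interval ?XV)
      (\<lambda>z. (snd z, p (fst z)))"
    using continuous_map_compose[OF continuous_map_fst p]
    by (intro continuous_map_pairedI continuous_map_snd) (simp_all add: o_def)
  from continuous_map_compose[OF this H]
  have H1: "continuous_map (prod_topology ?EV unit_interval) X (\<lambda>z. \<alpha> (p (fst z)) (snd z))"
    by (simp add: \<alpha>_def o_def)
  have id: "continuous_map ?EV E (\<lambda>e. e)"
    by (intro continuous_map_from_subtopology continuous_map_id[unfolded id_def])
  have "continuous_map ?EV E (\<lambda>e. e \<cdot> (\<lambda>t. (\<lambda>z. \<alpha> (p (fst z)) (snd z)) (e, t)))"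
    by (rule continuous_lift_end[OF id H1]) (use \<alpha> in auto)
  then have "continuous_map ?EV E ?\<chi>" by simp
  then have \<chi>: "continuous_map ?EV ?F ?\<chi>"
    using lift_end(1,2) \<alpha> by (auto simp: continuous_map_in_subtopology)
  have rev: "continuous_map unit_interval unit_interval (\<lambda>t. 1 - t)"
    by (auto simp: continuous_map_in_subtopology intro!: continuous_intros)
  have fst': "continuous_map (prod_topology (prod_topology ?XV ?F) unit_interval) ?XV (\<lambda>z. fst (fst z))"
    using continuous_map_compose[OF continuous_map_fst continuous_map_fst] by (simp add: o_def)
  have "continuous_map (prod_topology (prod_topology ?XV ?F) unit_interval) unit_interval (\<lambda>z. 1 - snd z)"
    using continuous_map_compose[OF continuous_map_snd rev] by (simp add: o_def)
  then have "continuous_map (prod_topology (prod_topology ?XV ?F) unit_interval) (prod_topology unit_interval ?XV)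
      (\<lambda>z. (1 - snd z, fst (fst z)))"
    using fst' by (intro continuous_map_pairedI)
  from continuous_map_compose[OF this H]
  have H2: "continuous_map (prod_topology (prod_topology ?XV ?F) unit_interval) X
      (\<lambda>z. \<alpha> (fst (fst z)) (1 - snd z))"
    by (simp add: \<alpha>_def o_def)
  have snd: "continuous_map (prod_topology ?XV ?F) E snd"
    using continuous_map_snd[of ?XV ?F] by (simp add: continuous_map_in_subtopology)
  have "continuous_map (prod_topology ?XV ?F) E
      (\<lambda>z. snd z \<cdot> (\<lambda>t. (\<lambda>z. \<alpha> (fst (fst z)) (1 - snd z)) (z, t)))"
    by (rule continuous_lift_end[OF snd H2]) (use \<alpha> in auto)
  then have "continuous_map (prod_topology ?XV ?F) E ?\<psi>" by simp
  moreover have \<psi>_in: "?\<psi> z \<in> topspace E" "p (?\<psi> z) = fst z" if "z \<in> topspace (prod_topology ?XV ?F)" for z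
    using that lift_end[of "snd z" "\<lambda>t. \<alpha> (fst z) (1 - t)"] \<alpha>[of "fst z"]
      pathin_reverse[of X "\<alpha> (fst z)"] by auto
  ultimately have \<psi>: "continuous_map (prod_topology ?XV ?F) ?EV ?\<psi>"
    by (auto simp: continuous_map_in_subtopology)
  have "homeomorphic_maps ?EV (prod_topology ?XV ?F) (\<lambda>e. (p e, ?\<chi> e)) ?\<psi>"
    unfolding homeomorphic_maps_def
  proof (intro conjI ballI)
    show "continuous_map ?EV (prod_topology ?XV ?F) (\<lambda>e. (p e, ?\<chi> e))"
      using p \<chi> by (intro continuous_map_pairedI)
    show "continuous_map (prod_topology ?XV ?F) ?EV ?\<psi>" by (rule \<psi>)
    show "?\<psi> (p e, ?\<chi> e) = e" if "e \<in> topspace ?EV" for e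
      using that lift_end_reverse[of e "\<alpha> (p e)"] \<alpha>[of "p e"] by simp
    show "(p (?\<psi> z), ?\<chi> (?\<psi> z)) = z" if z: "z \<in> topspace (prod_topology ?XV ?F)" for z
      using z \<psi>_in[OF z] lift_end_reverse'[of "snd z" "\<alpha> (fst z)"] \<alpha>[of "fst z"] by auto
  qed
  then show ?thesis using that[OF V \<alpha>] by (simp add: case_prod_unfold)
qed

section \<open>Deck transformations, transport and monodromy\<close>

lemma deck_transformationD:
  assumes "\<phi> \<in> deck_transformations E p"
  shows "continuous_map E E \<phi>" "e \<in> topspace E \<Longrightarrow> \<phi> e \<in> topspace E" "e \<in> topspace E \<Longrightarrow> p (\<phi> e) = p e"
  using assms homeomorphic_imp_continuous_map[of E E \<phi>]
  by (auto simp: deck_transformations_def continuous_map_def)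

lemma deck_transformation_inverse:
  assumes "\<phi> \<in> deck_transformations E p"
  obtains \<psi> where "\<psi> \<in> deck_transformations E p"
    "\<And>e. e \<in> topspace E \<Longrightarrow> \<psi> (\<phi> e) = e" "\<And>e. e \<in> topspace E \<Longrightarrow> \<phi> (\<psi> e) = e"
proof -
  obtain \<psi> where \<psi>: "homeomorphic_maps E E \<phi> \<psi>"
    using assms unfolding deck_transformations_def homeomorphic_map_maps by blast
  then have "homeomorphic_map E E \<psi>" using homeomorphic_maps_map by blast
  moreover have *: "\<psi> (\<phi> e) = e" "\<phi> (\<psi> e) = e" "\<psi> e \<in> topspace E" if "e \<in> topspace E" for e
    using \<psi> that by (auto simp: homeomorphic_maps_def continuous_map_def)
  moreover have "p (\<psi> e) = p e" if "e \<in> topspace E" for e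
    using deck_transformationD(3)[OF assms *(3)[OF that]] *(2)[OF that] by simp
  ultimately show ?thesis using that[of \<psi>] by (simp add: deck_transformations_def)
qed

lemma deck_lift_end:
  assumes "\<phi> \<in> deck_transformations E p" "e \<in> topspace E" "pathin X \<alpha>" "\<alpha> 0 = p e"
  shows "\<phi> e \<cdot> \<alpha> = \<phi> (e \<cdot> \<alpha>)"
  using assms deck_transformationD by (intro lift_end_map) auto

lemma deck_monodromy:
  assumes "\<phi> \<in> deck_transformations E p" "e \<in> fibre_set E p x" "A \<in> carrier (fundamental_group X x)"
  shows "\<phi> e \<star> A = \<phi> (e \<star> A)"
proof -
  obtain \<alpha> where \<alpha>: "\<alpha> \<in> loops X x" "A = loop_class X \<alpha>" using assms by (auto simp: carrier_fundamental_group)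
  then show ?thesis
    using assms(1,2) deck_lift_end[of \<phi> e \<alpha>] deck_transformationD[OF assms(1)]
    by (auto simp: class_endpoint_eq loops_def)
qed

lemma deck_fibre:
  assumes "\<phi> \<in> deck_transformations E p"
  shows "continuous_map (fibre E p x) (fibre E p x) \<phi>"
  using deck_transformationD[OF assms] continuous_map_from_subtopology
  by (auto simp: continuous_map_in_subtopology)

end


section \<open>The covering relations of a regular profinite projection\<close>

lemma regular_space_shrink:
  assumes F: "regular_space F" and W: "openin F W" "x \<in> W"
  obtains V where "openin F V" "x \<in> V" "F closure_of V \<subseteq> W"
proof -
  have "closedin F (topspace F - W)" "x \<in> topspace F - (topspace F - W)"
    using W openin_subset[OF W(1)] by auto
  then obtain V where V: "openin F V" "x \<in> V" "disjnt (topspace F - W) (F closure_of V)"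
    using F unfolding regular_space by metis
  then have "F closure_of V \<subseteq> W"
    using closure_of_subset_topspace[of F V] by (auto simp: disjnt_iff)
  then show ?thesis using that V by blast
qed

locale profinite_projection = lifting_projection E X p
  for E :: "'e topology" and X :: "'x topology" and p :: "'e \<Rightarrow> 'x" +
  fixes x0 :: 'x and e0 :: 'e
  assumes path_connected: "path_connected_space X"
    and locally_contractible: "locally_contractible_space X"
    and compact_fibre: "compact_space (fibre E p x0)"
    and Hausdorff_fibre: "Hausdorff_space (fibre E p x0)"
    and e0: "e0 \<in> fibre_set E p x0"
    and regular: "regular_projection E p"
    and profinite: "pi1_profinite E X p x0 e0"
    and dense_leaf: "has_dense_leaf E"
begin

abbreviation F where "F \<equiv> fibre E p x0"
abbreviation G where "G \<equiv> fundamental_group X x0"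

lemma x0: "x0 \<in> topspace X"
  using e0 p_in by auto

lemma topspace_F [simp]: "topspace F = fibre_set E p x0" by auto

lemma transitive:
  assumes "e \<in> topspace E" "e' \<in> topspace E" "p e = p e'"
  obtains \<phi> where "\<phi> \<in> deck_transformations E p" "\<phi> e = e'"
  using regular assms unfolding regular_projection_def by blast

lemma path_to:
  assumes "x \<in> topspace X" obtains \<alpha> where "pathin X \<alpha>" "\<alpha> 0 = x" "\<alpha> 1 = x0"
  using path_connected assms x0 unfolding path_connected_space_def by blast

text \<open>The local trivialization over a neighbourhood of \<open>x0\<close> moves points of a dense leaf into the
  fibre along the leaf.\<close>

lemma leaf_meets_fibre:
  assumes L: "L \<in> path_components_of E" "E closure_of L = topspace E"
    and W: "openin F W" "W \<noteq> {}"
  obtains l where "l \<in> L" "l \<in> W"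
proof -
  obtain V \<alpha> where V: "openin X V" "x0 \<in> V"
    and \<alpha>: "\<And>v. v \<in> V \<Longrightarrow> pathin X (\<alpha> v) \<and> \<alpha> v 0 = v \<and> \<alpha> v 1 = x0"
    and triv: "homeomorphic_maps (subtopology E {e \<in> topspace E. p e \<in> V})
       (prod_topology (subtopology X V) F) (\<lambda>e. (p e, e \<cdot> \<alpha> (p e))) (\<lambda>(v, f). f \<cdot> (\<lambda>t. \<alpha> v (1 - t)))"
    by (rule local_trivialization[OF path_connected locally_contractible x0 x0]) (rule that)
  let ?P = "{e \<in> topspace E. p e \<in> V}"
  have P: "openin E ?P" using openin_continuous_map_preimage[OF continuous_p V(1)] .
  obtain w where w: "w \<in> W" using W(2) by blast
  then have wF: "w \<in> fibre_set E p x0" using openin_subset[OF W(1)] by auto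
  have "continuous_map (subtopology E ?P) F (\<lambda>e. e \<cdot> \<alpha> (p e))"
    using triv unfolding homeomorphic_maps_def continuous_map_pairwise by (simp add: o_def)
  note pre = openin_continuous_map_preimage[OF this W(1)]
  define S where "S = {e \<in> ?P. e \<cdot> \<alpha> (p e) \<in> W}"
  have "openin E S"
    unfolding S_def using P pre by (simp add: openin_open_subtopology Collect_conj_eq conj_ac)
  \<comment> \<open>\<open>\<alpha> x0\<close> is a loop that may be nonconstant, so the witness is
    not \<open>w\<close> itself but the point that transport along \<open>\<alpha> x0\<close>
    carries to \<open>w\<close>.\<close>
  moreover have "w \<cdot> (\<lambda>t. \<alpha> x0 (1 - t)) \<in> S"
    using w wF \<alpha>[OF V(2)] V(2) lift_end[of w "\<lambda>t. \<alpha> x0 (1 - t)"] pathin_reverse[of X "\<alpha> x0"]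
      lift_end_reverse'[of w "\<alpha> x0"] by (simp add: S_def)
  moreover from this have "w \<cdot> (\<lambda>t. \<alpha> x0 (1 - t)) \<in> E closure_of L" unfolding L(2) by (simp add: S_def)
  ultimately obtain e where "e \<in> L" "e \<in> S" unfolding in_closure_of by blast
  then have e: "e \<in> L" "e \<in> ?P" "e \<cdot> \<alpha> (p e) \<in> W" by (auto simp: S_def)
  have "path_component_of E e (e \<cdot> \<alpha> (p e))" using e \<alpha>[of "p e"] lift_end(3)[of e "\<alpha> (p e)"] by simp
  then have "e \<cdot> \<alpha> (p e) \<in> L"
    using L(1) e(1) unfolding path_components_of_def
    by (auto intro: path_component_of_trans)
  then show ?thesis using that e(3) by blast
qed

text \<open>Two points of the dense leaf over \<open>x0\<close> differ by the monodromy of a loop,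
  the image of a path joining them in the leaf. So the orbit of such a point is dense, and a deck
  transformation carrying this point to \<open>y\<close> transfers density to the orbit of
  \<open>y\<close>.\<close>

lemma dense_monodromy_orbit:
  assumes y: "y \<in> fibre_set E p x0"
  shows "F closure_of (class_endpoint E p y ` carrier G) = topspace F"
proof (intro subset_antisym closure_of_subset_topspace subsetI)
  fix w assume wF: "w \<in> topspace F"
  obtain L where L: "L \<in> path_components_of E" "E closure_of L = topspace E"
    using dense_leaf unfolding has_dense_leaf_def by blast
  show "w \<in> F closure_of (class_endpoint E p y ` carrier G)"
    unfolding in_closure_of
  proof (intro conjI wF allI impI, elim conjE)
    fix W assume W: "w \<in> W" "openin F W"
    obtain l where l: "l \<in> L" "l \<in> topspace F"
      using leaf_meets_fibre[OF L openin_topspace] wF by blast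
    then have lF: "l \<in> fibre_set E p x0" by simp
    obtain \<psi> where \<psi>: "\<psi> \<in> deck_transformations E p" "\<psi> l = y"
      using transitive[of l y] lF y by auto
    obtain \<phi> where \<phi>: "\<phi> \<in> deck_transformations E p" "\<And>e. e \<in> topspace E \<Longrightarrow> \<psi> (\<phi> e) = e"
      using deck_transformation_inverse[OF \<psi>(1)] by metis
    \<comment> \<open>\<open>W\<close> is pulled back along \<psi>, which maps \<open>l\<close> to
      \<open>y\<close>; the pullback is nonempty because it contains
      \<open>\<phi> w\<close>.\<close>
    let ?W = "{f \<in> topspace F. \<psi> f \<in> W}"
    have "openin F ?W" by (rule openin_continuous_map_preimage[OF deck_fibre[OF \<psi>(1)] W(2)])
    moreover have "\<phi> w \<in> ?W" using wF W(1) \<phi>(2) deck_transformationD(2,3)[OF \<phi>(1), of w] by simp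
    ultimately obtain l' where l': "l' \<in> L" "l' \<in> ?W" using leaf_meets_fibre[OF L] by blast
    have "path_component_of E l l'"
      using L(1) l(1) l'(1) unfolding path_components_of_def
      by (auto intro: path_component_of_trans path_component_of_sym)
    then obtain \<gamma> where \<gamma>: "pathin E \<gamma>" "\<gamma> 0 = l" "\<gamma> 1 = l'" unfolding path_component_of_def by blast
    have loop: "p \<circ> \<gamma> \<in> loops X x0"
      using pathin_compose[OF \<gamma>(1) continuous_p] \<gamma> lF l'(2) by (simp add: loops_def)
    let ?A = "loop_class X (p \<circ> \<gamma>)"
    have A: "?A \<in> carrier G" using loop by (simp add: carrier_fundamental_group)
    have "y \<star> ?A = \<psi> (l \<star> ?A)" using deck_monodromy[OF \<psi>(1) lF A] \<psi>(2) by simp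
    also have "l \<star> ?A = l'" using class_endpoint_eq[of l "p \<circ> \<gamma>"] lF loop lift_end_of_path[OF \<gamma>(1)] \<gamma> by simp
    finally have "y \<star> ?A \<in> W" using l'(2) by (simp only: mem_Collect_eq)
    then show "\<exists>y'. y' \<in> class_endpoint E p y ` carrier G \<and> y' \<in> W" using A by blast
  qed
qed

sublocale minimal_right_action G F "class_endpoint E p"
proof (intro minimal_right_action.intro minimal_right_action_axioms.intro)
  show "group G" using x0 by (rule group_fundamental_group)
qed (simp_all add: continuous_monodromy monodromy_one monodromy_mult dense_monodromy_orbit)

text \<open>Each clause serves a feature of the quotient: equality of \<open>p\<close> the map to
  \<open>X\<close>, invariance under transport the sheets, invariance under deck transformations
  regularity, and open classes in the compact fibre finiteness. All clauses survive intersection, so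
  these relations form a directed system.\<close>

definition covering_relation :: "('e \<times> 'e) set \<Rightarrow> bool" where
  "covering_relation R \<longleftrightarrow>
     equiv (topspace E) R \<and> (\<forall>(e, e')\<in>R. p e = p e') \<and>
     (\<forall>(e, e')\<in>R. \<forall>\<alpha>. pathin X \<alpha> \<and> \<alpha> 0 = p e \<longrightarrow> (e \<cdot> \<alpha>, e' \<cdot> \<alpha>) \<in> R) \<and>
     (\<forall>\<phi>\<in>deck_transformations E p. \<forall>(e, e')\<in>R. (\<phi> e, \<phi> e') \<in> R) \<and>
     (\<forall>f\<in>fibre_set E p x0. openin F (R `` {f}))"

lemma covering_relationD:
  assumes "covering_relation R"
  shows "equiv (topspace E) R" "(e, e') \<in> R \<Longrightarrow> p e = p e'"
    "(e, e') \<in> R \<Longrightarrow> pathin X \<alpha> \<Longrightarrow> \<alpha> 0 = p e \<Longrightarrow> (e \<cdot> \<alpha>, e' \<cdot> \<alpha>) \<in> R"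
    "\<phi> \<in> deck_transformations E p \<Longrightarrow> (e, e') \<in> R \<Longrightarrow> (\<phi> e, \<phi> e') \<in> R"
    "f \<in> fibre_set E p x0 \<Longrightarrow> openin F (R `` {f})"
    "(e, e') \<in> R \<Longrightarrow> e \<in> topspace E" "(e, e') \<in> R \<Longrightarrow> e' \<in> topspace E"
  using assms unfolding covering_relation_def by (auto elim!: equivE)

lemma covering_relation_Int:
  assumes R: "covering_relation R" and S: "covering_relation S"
  shows "covering_relation (R \<inter> S)"
  unfolding covering_relation_def
proof (intro conjI ballI)
  show "equiv (topspace E) (R \<inter> S)"
    using covering_relationD(1)[OF R] covering_relationD(1)[OF S]
    by (auto simp: equiv_def refl_on_def sym_Int trans_Int)
  show "openin F ((R \<inter> S) `` {f})" if "f \<in> fibre_set E p x0" for f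
  proof -
    have "(R \<inter> S) `` {f} = R `` {f} \<inter> S `` {f}" by blast
    then show ?thesis using covering_relationD(5)[OF R that] covering_relationD(5)[OF S that] by auto
  qed
qed (use covering_relationD(2-4)[OF R] covering_relationD(3,4)[OF S] in \<open>auto split: prod.splits\<close>)

text \<open>The coarsest covering relation: it makes the index set nonempty and remembers the point
  of \<open>X\<close> below a compatible family of classes.\<close>

lemma covering_relation_fibres: "covering_relation {(e, e'). e \<in> topspace E \<and> e' \<in> topspace E \<and> p e = p e'}"
  (is "covering_relation ?R")
  unfolding covering_relation_def
proof (intro conjI ballI)
  show "equiv (topspace E) ?R"
    by (auto simp: equiv_def refl_on_def sym_def trans_def)
  show "openin F (?R `` {f})" if "f \<in> fibre_set E p x0" for f
  proof -
    have "?R `` {f} = topspace F" using that by auto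
    then show ?thesis by (metis openin_topspace)
  qed
qed (auto simp: lift_end deck_transformationD)

text \<open>No path from \<open>p e\<close> to \<open>x0\<close> is preferred, so points are
  compared in the fibre after transport along every such path. This quantification yields invariance
  under transport.\<close>

definition block_relation :: "(real \<Rightarrow> 'x) set set \<Rightarrow> ('e \<times> 'e) set" where
  "block_relation N = {(e, e'). e \<in> topspace E \<and> e' \<in> topspace E \<and> p e = p e' \<and>
     (\<forall>\<alpha>. pathin X \<alpha> \<and> \<alpha> 0 = p e \<and> \<alpha> 1 = x0 \<longrightarrow> e' \<cdot> \<alpha> \<in> orbit_closure N (e \<cdot> \<alpha>))}"

text \<open>For points over \<open>x0\<close> the test paths are loops. The constant loop gives the
  inclusion into the orbit closure; conversely, any loop translates the orbit closure of
  \<open>f\<close> onto that of the translated point, by normality of \<open>N\<close>.\<close>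

lemma block_relation_fibre:
  assumes N: "normal_finite_index N G" and f: "f \<in> fibre_set E p x0"
  shows "block_relation N `` {f} = orbit_closure N f"
proof (intro subset_antisym subsetI)
  fix y assume "y \<in> block_relation N `` {f}"
  then have y: "y \<in> topspace E" "p f = p y"
    and *: "pathin X \<alpha> \<Longrightarrow> \<alpha> 0 = p f \<Longrightarrow> \<alpha> 1 = x0 \<Longrightarrow> y \<cdot> \<alpha> \<in> orbit_closure N (f \<cdot> \<alpha>)" for \<alpha>
    by (auto simp: block_relation_def)
  have "y \<cdot> (\<lambda>_. p y) \<in> orbit_closure N (f \<cdot> (\<lambda>_. p f))"
    using *[of "\<lambda>_. p f"] f y(2) x0 by simp
  moreover have "f \<in> topspace E" using f by simp
  ultimately show "y \<in> orbit_closure N f" using y(1) by (simp only: lift_end_const)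
next
  fix y assume y: "y \<in> orbit_closure N f"
  then have yF: "y \<in> fibre_set E p x0"
    using closedin_subset[OF closed_orbit_closure] by auto
  have "y \<cdot> \<alpha> \<in> orbit_closure N (f \<cdot> \<alpha>)" if \<alpha>: "pathin X \<alpha>" "\<alpha> 0 = p f" "\<alpha> 1 = x0" for \<alpha>
  proof -
    have loop: "\<alpha> \<in> loops X x0" using \<alpha> f by (simp add: loops_def)
    then have A: "loop_class X \<alpha> \<in> carrier G" by (simp add: carrier_fundamental_group)
    have fF: "f \<in> topspace F" using f by simp
    have "y \<star> loop_class X \<alpha> \<in> orbit_closure N (f \<star> loop_class X \<alpha>)"
      unfolding orbit_closure_act[OF N fF A] using y by blast
    then show ?thesis using class_endpoint_eq[of _ \<alpha>] f yF loop by simp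
  qed
  then show "y \<in> block_relation N `` {f}" using f yF by (auto simp: block_relation_def)
qed

lemma covering_relation_block:
  assumes N: "normal_finite_index N G"
  shows "covering_relation (block_relation N)"
  unfolding covering_relation_def
proof (intro conjI ballI)
  have in_F: "e \<cdot> \<alpha> \<in> topspace F" if "e \<in> topspace E" "pathin X \<alpha>" "\<alpha> 0 = p e" "\<alpha> 1 = x0" for e \<alpha>
    using that lift_end by simp
  show "equiv (topspace E) (block_relation N)"
  proof (rule equivI)
    show "block_relation N \<subseteq> topspace E \<times> topspace E" by (auto simp: block_relation_def)
    show "refl_on (topspace E) (block_relation N)"
      using orbit_closure_refl[OF N] in_F by (auto simp: refl_on_def block_relation_def)
    show "sym (block_relation N)"
      unfolding sym_def
    proof (intro allI impI)
      fix e e' assume R: "(e, e') \<in> block_relation N"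
      have "e \<cdot> \<alpha> \<in> orbit_closure N (e' \<cdot> \<alpha>)" if "pathin X \<alpha>" "\<alpha> 0 = p e'" "\<alpha> 1 = x0" for \<alpha>
      proof -
        have *: "e \<cdot> \<alpha> \<in> topspace F" "e' \<cdot> \<alpha> \<in> orbit_closure N (e \<cdot> \<alpha>)"
          using R that in_F by (auto simp: block_relation_def)
        show ?thesis using orbit_closure_eq[OF N *] orbit_closure_refl[OF N *(1)] by simp
      qed
      then show "(e', e) \<in> block_relation N" using R by (auto simp: block_relation_def)
    qed
    show "trans (block_relation N)"
      unfolding trans_def
    proof (intro allI impI)
      fix e e' e'' assume R: "(e, e') \<in> block_relation N" "(e', e'') \<in> block_relation N"
      have "e'' \<cdot> \<alpha> \<in> orbit_closure N (e \<cdot> \<alpha>)" if "pathin X \<alpha>" "\<alpha> 0 = p e" "\<alpha> 1 = x0" for \<alpha>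
      proof -
        have *: "e \<cdot> \<alpha> \<in> topspace F" "e' \<cdot> \<alpha> \<in> orbit_closure N (e \<cdot> \<alpha>)" "e'' \<cdot> \<alpha> \<in> orbit_closure N (e' \<cdot> \<alpha>)"
          using R that in_F by (auto simp: block_relation_def)
        show ?thesis using orbit_closure_eq[OF N *(1,2)] *(3) by simp
      qed
      then show "(e, e'') \<in> block_relation N" using R by (auto simp: block_relation_def)
    qed
  qed
  show "case z of (e, e') \<Rightarrow> p e = p e'" if "z \<in> block_relation N" for z
    using that by (auto simp: block_relation_def)
  show "case z of (e, e') \<Rightarrow> \<forall>\<alpha>. pathin X \<alpha> \<and> \<alpha> 0 = p e \<longrightarrow> (e \<cdot> \<alpha>, e' \<cdot> \<alpha>) \<in> block_relation N"
    if "z \<in> block_relation N" for z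
  proof (clarify)
    fix e e' \<alpha> assume z: "z = (e, e')" and \<alpha>: "pathin X \<alpha>" "\<alpha> 0 = p e"
    have R: "e \<in> topspace E" "e' \<in> topspace E" "p e = p e'"
      and *: "\<And>\<beta>. pathin X \<beta> \<Longrightarrow> \<beta> 0 = p e \<Longrightarrow> \<beta> 1 = x0 \<Longrightarrow> e' \<cdot> \<beta> \<in> orbit_closure N (e \<cdot> \<beta>)"
      using that z by (auto simp: block_relation_def)
    \<comment> \<open>Prefixing \<alpha> turns a test path for the transported points into one for
      \<open>e\<close> and \<open>e'\<close>.\<close>
    have "e' \<cdot> \<alpha> \<cdot> \<beta> \<in> orbit_closure N (e \<cdot> \<alpha> \<cdot> \<beta>)"
      if "pathin X \<beta>" "\<beta> 0 = \<alpha> 1" "\<beta> 1 = x0" for \<beta>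
      using *[of "path_concat \<alpha> \<beta>"] that \<alpha> R by (simp add: pathin_concat lift_end_concat)
    then show "(e \<cdot> \<alpha>, e' \<cdot> \<alpha>) \<in> block_relation N"
      using R \<alpha> lift_end by (simp add: block_relation_def)
  qed
  show "case z of (e, e') \<Rightarrow> (\<phi> e, \<phi> e') \<in> block_relation N"
    if \<phi>: "\<phi> \<in> deck_transformations E p" and "z \<in> block_relation N" for \<phi> z
  proof (clarify)
    fix e e' assume z: "z = (e, e')"
    have R: "e \<in> topspace E" "e' \<in> topspace E" "p e = p e'"
      and *: "\<And>\<beta>. pathin X \<beta> \<Longrightarrow> \<beta> 0 = p e \<Longrightarrow> \<beta> 1 = x0 \<Longrightarrow> e' \<cdot> \<beta> \<in> orbit_closure N (e \<cdot> \<beta>)"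
      using that z by (auto simp: block_relation_def)
    have "\<phi> e' \<cdot> \<beta> \<in> orbit_closure N (\<phi> e \<cdot> \<beta>)"
      if \<beta>: "pathin X \<beta>" "\<beta> 0 = p e" "\<beta> 1 = x0" for \<beta>
    proof -
      have "\<phi> (e' \<cdot> \<beta>) \<in> orbit_closure N (\<phi> (e \<cdot> \<beta>))"
      proof (rule orbit_closure_equivariant[OF deck_fibre[OF \<phi>] _ _ *[OF \<beta>]])
        show "N \<subseteq> carrier G" by (rule N_sub[OF N])
        show "e \<cdot> \<beta> \<in> topspace F" using in_F R \<beta> by simp
      qed (simp add: deck_monodromy[OF \<phi>])
      then show ?thesis using deck_lift_end[OF \<phi>] R \<beta> by simp
    qed
    then show "(\<phi> e, \<phi> e') \<in> block_relation N"
      using R deck_transformationD[OF \<phi>] by (simp add: block_relation_def)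
  qed
  show "openin F (block_relation N `` {f})" if "f \<in> fibre_set E p x0" for f
    using block_relation_fibre[OF N that] open_orbit_closure[OF N] that by simp
qed

text \<open>Continuity of the endpoint map at the identity yields \<open>N\<close> with a small
  orbit of \<open>e0\<close>. For any other point \<open>f\<close> the neighbourhood is pulled back
  along a deck transformation taking \<open>e0\<close> to \<open>f\<close>, and deck invariance of
  the relation carries the result back.\<close>

lemma small_covering_relation:
  assumes W: "openin F W" "f \<in> W"
  obtains R where "covering_relation R" "R `` {f} \<subseteq> W"
proof -
  have f: "f \<in> fibre_set E p x0" using W openin_subset[OF W(1)] by auto
  obtain \<phi> where \<phi>: "\<phi> \<in> deck_transformations E p" "\<phi> e0 = f"
    using transitive[of e0 f] e0 f by auto
  obtain \<psi> where \<psi>: "\<psi> \<in> deck_transformations E p" "\<And>e. e \<in> topspace E \<Longrightarrow> \<psi> (\<phi> e) = e"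
      "\<And>e. e \<in> topspace E \<Longrightarrow> \<phi> (\<psi> e) = e"
    by (rule deck_transformation_inverse[OF \<phi>(1)]) (rule that)
  define W' where "W' = {y \<in> topspace F. \<phi> y \<in> W}"
  have W'_open: "openin F W'"
    unfolding W'_def by (rule openin_continuous_map_preimage[OF deck_fibre[OF \<phi>(1)] W(1)])
  have e0W': "e0 \<in> W'" using e0 \<phi>(2) W(2) by (simp add: W'_def)
  have F_reg: "regular_space F" using compact_Hausdorff_imp_regular_space compact_fibre Hausdorff_fibre by blast
  \<comment> \<open>Continuity controls only the orbit, while the block is its closure; hence a
    neighbourhood whose closure stays inside \<open>W'\<close>.\<close>
  obtain V where V: "openin F V" "e0 \<in> V" "F closure_of V \<subseteq> W'"
    by (rule regular_space_shrink[OF F_reg W'_open e0W']) (rule that)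
  have U: "openin (profinite_topology G) {A \<in> topspace (profinite_topology G). e0 \<star> A \<in> V}"
    using profinite V(1) unfolding pi1_profinite_def by (rule openin_continuous_map_preimage)
  have one: "\<one>\<^bsub>G\<^esub> \<in> {A \<in> topspace (profinite_topology G). e0 \<star> A \<in> V}"
    using V(2) monodromy_one[OF e0] by (simp add: topspace_profinite_topology is_group)
  from U[unfolded openin_profinite_topology, THEN conjunct2, rule_format, OF one]
  obtain N where N: "normal_finite_index N G"
      and sub: "l_coset G \<one>\<^bsub>G\<^esub> N \<subseteq> {A \<in> topspace (profinite_topology G). e0 \<star> A \<in> V}"
    by (elim exE conjE) (rule that)
  have "e0 \<star> A \<in> V" if "A \<in> N" for A
  proof -
    have "A \<in> l_coset G \<one>\<^bsub>G\<^esub> N"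
      unfolding l_coset_def using that N_sub[OF N] by (auto intro!: bexI[of _ A])
    then show ?thesis using sub by blast
  qed
  then have "class_endpoint E p e0 ` N \<subseteq> V" by blast
  then have D: "orbit_closure N e0 \<subseteq> W'"
    unfolding orbit_closure_def using V(3) closure_of_mono by blast
  note R = covering_relation_block[OF N]
  have "y \<in> W" if "(f, y) \<in> block_relation N" for y
  proof -
    have y: "y \<in> topspace E" using covering_relationD(7)[OF R that] .
    have "(\<psi> f, \<psi> y) \<in> block_relation N" using covering_relationD(4)[OF R \<psi>(1) that] .
    moreover have "\<psi> f = e0" using \<psi>(2)[of e0] \<phi>(2) e0 by simp
    ultimately have "\<psi> y \<in> orbit_closure N e0" using block_relation_fibre[OF N e0] by blast
    then have "\<phi> (\<psi> y) \<in> W" using D by (auto simp: W'_def)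
    then show ?thesis using \<psi>(3)[OF y] by simp
  qed
  then show ?thesis using that[OF R] by blast
qed

end

section \<open>Quotient spaces\<close>

text \<open>Points are the classes themselves, so the quotients by all relations live on one type,
  as an inverse system requires.\<close>

definition quotient_space :: "'e topology \<Rightarrow> ('e \<times> 'e) set \<Rightarrow> 'e set topology" where
  "quotient_space E R =
     topology (\<lambda>U. U \<subseteq> topspace E // R \<and> openin E {e \<in> topspace E. R `` {e} \<in> U})"

lemma openin_quotient_space:
  "openin (quotient_space E R) U \<longleftrightarrow> U \<subseteq> topspace E // R \<and> openin E {e \<in> topspace E. R `` {e} \<in> U}"
proof -
  have "istopology (\<lambda>U. U \<subseteq> topspace E // R \<and> openin E {e \<in> topspace E. R `` {e} \<in> U})"
    unfolding istopology_def
  proof (intro conjI allI impI)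
    fix S T
    assume "S \<subseteq> topspace E // R \<and> openin E {e \<in> topspace E. R `` {e} \<in> S}"
      "T \<subseteq> topspace E // R \<and> openin E {e \<in> topspace E. R `` {e} \<in> T}"
    moreover have "{e \<in> topspace E. R `` {e} \<in> S \<inter> T} =
        {e \<in> topspace E. R `` {e} \<in> S} \<inter> {e \<in> topspace E. R `` {e} \<in> T}" by blast
    ultimately show "openin E {e \<in> topspace E. R `` {e} \<in> S \<inter> T}" by auto
  next
    fix \<K> assume "\<forall>K\<in>\<K>. K \<subseteq> topspace E // R \<and> openin E {e \<in> topspace E. R `` {e} \<in> K}"
    moreover have "{e \<in> topspace E. R `` {e} \<in> \<Union>\<K>} = (\<Union>K\<in>\<K>. {e \<in> topspace E. R `` {e} \<in> K})" by blast
    ultimately show "openin E {e \<in> topspace E. R `` {e} \<in> \<Union>\<K>}" by auto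
  qed blast+
  then show ?thesis unfolding quotient_space_def by (simp add: topology_inverse')
qed

lemma topspace_quotient_space [simp]: "topspace (quotient_space E R) = topspace E // R"
proof
  have "{e \<in> topspace E. R `` {e} \<in> topspace E // R} = topspace E" by (auto intro: quotientI)
  then have "openin (quotient_space E R) (topspace E // R)" by (simp add: openin_quotient_space)
  then show "topspace E // R \<subseteq> topspace (quotient_space E R)" by (rule openin_subset)
  show "topspace (quotient_space E R) \<subseteq> topspace E // R"
    using openin_topspace[of "quotient_space E R"] unfolding openin_quotient_space by blast
qed

lemma quotient_map_quotient_space: "quotient_map E (quotient_space E R) (\<lambda>e. R `` {e})"
  unfolding quotient_map_def topspace_quotient_space openin_quotient_space
  by (auto simp: quotient_def)

lemma continuous_class: "continuous_map E (quotient_space E R) (\<lambda>e. R `` {e})"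
  using quotient_imp_continuous_map quotient_map_quotient_space .

lemma continuous_map_from_quotient_space:
  assumes "continuous_map E Y g" "\<And>e. e \<in> topspace E \<Longrightarrow> f (R `` {e}) = g e"
  shows "continuous_map (quotient_space E R) Y f"
proof (rule continuous_compose_quotient_map[OF quotient_map_quotient_space])
  show "continuous_map E Y (f \<circ> (\<lambda>e. R `` {e}))"
    by (rule continuous_map_eq[OF assms(1)]) (simp add: assms(2))
qed

text \<open>\<open>S\<close> is saturated, so membership of a class in its image can be tested on
  any representative.\<close>

lemma class_in_image_iff:
  assumes "equiv (topspace E) R" "S \<subseteq> topspace E" "\<And>e e'. e \<in> S \<Longrightarrow> (e, e') \<in> R \<Longrightarrow> e' \<in> S"
    and "e \<in> topspace E"
  shows "R `` {e} \<in> (\<lambda>e. R `` {e}) ` S \<longleftrightarrow> e \<in> S"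
proof
  assume "R `` {e} \<in> (\<lambda>e. R `` {e}) ` S"
  then obtain e' where e': "e' \<in> S" "R `` {e} = R `` {e'}" by blast
  then have "(e', e) \<in> R" using equiv_class_self[OF assms(1,4)] by blast
  then show "e \<in> S" using assms(3) e'(1) by blast
qed blast

lemma openin_class_image:
  assumes "equiv (topspace E) R" "openin E S" "\<And>e e'. e \<in> S \<Longrightarrow> (e, e') \<in> R \<Longrightarrow> e' \<in> S"
  shows "openin (quotient_space E R) ((\<lambda>e. R `` {e}) ` S)"
proof -
  have S: "S \<subseteq> topspace E" using openin_subset[OF assms(2)] .
  have "R `` {e} \<in> (\<lambda>e. R `` {e}) ` S \<longleftrightarrow> e \<in> S" if "e \<in> topspace E" for e
    by (rule class_in_image_iff[OF assms(1) S _ that]) (rule assms(3))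
  then have "{e \<in> topspace E. R `` {e} \<in> (\<lambda>e. R `` {e}) ` S} = S" using S by auto
  then show ?thesis
    unfolding openin_quotient_space using assms(2) S by (auto intro: quotientI)
qed


context profinite_projection
begin

section \<open>The finite regular coverings\<close>

text \<open>All points of a class have the same image, so the choice is immaterial.\<close>

definition class_proj :: "'e set \<Rightarrow> 'x" where
  "class_proj c = p (SOME e. e \<in> c)"

lemma class_proj:
  assumes R: "covering_relation R" and e: "e \<in> topspace E"
  shows "class_proj (R `` {e}) = p e"
proof -
  have "e \<in> R `` {e}" using equiv_class_self[OF covering_relationD(1)[OF R] e] .
  then have "(SOME e'. e' \<in> R `` {e}) \<in> R `` {e}" by (rule someI)
  then have "(e, SOME e'. e' \<in> R `` {e}) \<in> R" by simp
  then show ?thesis unfolding class_proj_def using covering_relationD(2)[OF R] by metis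
qed

lemma class_eq_iff:
  assumes "covering_relation R" "e \<in> topspace E" "e' \<in> topspace E"
  shows "R `` {e} = R `` {e'} \<longleftrightarrow> (e, e') \<in> R"
  using eq_equiv_class_iff[OF covering_relationD(1)[OF assms(1)] assms(2,3)] .

lemma covering_relation_sym: "covering_relation R \<Longrightarrow> (e, e') \<in> R \<Longrightarrow> (e', e) \<in> R"
  and covering_relation_trans: "covering_relation R \<Longrightarrow> (e, e') \<in> R \<Longrightarrow> (e', e'') \<in> R \<Longrightarrow> (e, e'') \<in> R"
  and covering_relation_refl: "covering_relation R \<Longrightarrow> e \<in> topspace E \<Longrightarrow> (e, e) \<in> R"
  using covering_relationD(1) unfolding equiv_def sym_def trans_def refl_on_def by blast+

lemma transport_cancel:
  assumes R: "covering_relation R" and e: "e \<in> topspace E" "e' \<in> topspace E" "p e = p e'"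
    and \<alpha>: "pathin X \<alpha>" "\<alpha> 0 = p e" and *: "(e \<cdot> \<alpha>, e' \<cdot> \<alpha>) \<in> R"
  shows "(e, e') \<in> R"
proof -
  have "(e \<cdot> \<alpha> \<cdot> (\<lambda>t. \<alpha> (1 - t)), e' \<cdot> \<alpha> \<cdot> (\<lambda>t. \<alpha> (1 - t))) \<in> R"
    using covering_relationD(3)[OF R *] pathin_reverse[OF \<alpha>(1)] lift_end[OF e(1) \<alpha>] by simp
  then show ?thesis using lift_end_reverse[OF e(1) \<alpha>] lift_end_reverse[OF e(2) \<alpha>(1)] \<alpha>(2) e(3) by simp
qed

text \<open>The classes partition the compact fibre into nonempty open sets, and a partition has no
  proper subcover.\<close>

lemma finite_classes:
  assumes R: "covering_relation R"
  shows "finite ((\<lambda>f. R `` {f}) ` fibre_set E p x0)"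
proof -
  let ?\<U> = "(\<lambda>f. R `` {f}) ` fibre_set E p x0"
  have op: "\<forall>U\<in>?\<U>. openin F U" using covering_relationD(5)[OF R] by blast
  have self: "f \<in> R `` {f}" if "f \<in> fibre_set E p x0" for f
    using covering_relation_refl[OF R, of f] that by simp
  then have "topspace F \<subseteq> \<Union>?\<U>" by auto
  then have "\<exists>\<F>. finite \<F> \<and> \<F> \<subseteq> ?\<U> \<and> topspace F \<subseteq> \<Union>\<F>"
    using compact_fibre op unfolding compact_space_alt by meson
  then obtain \<F> where \<F>: "finite \<F>" "\<F> \<subseteq> ?\<U>" "topspace F \<subseteq> \<Union>\<F>"
    by (elim exE conjE) (rule that)
  have "R `` {f} \<in> \<F>" if f: "f \<in> fibre_set E p x0" for f
  proof -
    have "f \<in> \<Union>\<F>" using f \<F>(3) by auto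
    then obtain U where U: "U \<in> \<F>" "f \<in> U" by (elim UnionE)
    then obtain g where g: "g \<in> fibre_set E p x0" "U = R `` {g}" using \<F>(2) by blast
    then have "R `` {g} = R `` {f}" using U(2) class_eq_iff[OF R, of g f] f by simp
    then show ?thesis using U(1) g(2) by simp
  qed
  then show ?thesis using \<F>(1) finite_subset[of ?\<U> \<F>] by blast
qed

text \<open>Transport over a trivializing set \<open>V\<close> preserves \<open>R\<close> in both
  directions, so over \<open>V\<close> the quotient looks like \<open>V\<close> times the discrete
  set of classes in the fibre over \<open>x0\<close>: sheets correspond to such classes.\<close>

lemma covering_quotient:
  assumes R: "covering_relation R"
  shows "covering_projection (quotient_space E R) X class_proj"
  unfolding covering_projection_def
proof (intro conjI ballI)
  let ?Q = "quotient_space E R" and ?\<pi> = "\<lambda>e. R `` {e}"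
  note equiv = covering_relationD(1)[OF R]
  show cont: "continuous_map ?Q X class_proj"
    using continuous_map_from_quotient_space[OF continuous_p] class_proj[OF R] by blast
  show "class_proj ` topspace ?Q = topspace X"
  proof (intro subset_antisym subsetI)
    show "x \<in> topspace X" if "x \<in> class_proj ` topspace ?Q" for x
      using that continuous_map_image_subset_topspace[OF cont] by blast
    fix x assume x: "x \<in> topspace X"
    obtain \<alpha> where \<alpha>: "pathin X \<alpha>" "\<alpha> 0 = x" "\<alpha> 1 = x0" using path_to[OF x] .
    let ?e = "e0 \<cdot> (\<lambda>t. \<alpha> (1 - t))"
    have "?e \<in> topspace E" "p ?e = x"
      using lift_end[of e0 "\<lambda>t. \<alpha> (1 - t)"] e0 \<alpha> pathin_reverse[OF \<alpha>(1)] by simp_all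
    then have "?\<pi> ?e \<in> topspace ?Q" "class_proj (?\<pi> ?e) = x"
      using class_proj[OF R] by (simp_all add: quotientI)
    then show "x \<in> class_proj ` topspace ?Q" by blast
  qed
  fix x assume x: "x \<in> topspace X"
  obtain V \<alpha> where V: "openin X V" "x \<in> V"
    and \<alpha>: "\<And>v. v \<in> V \<Longrightarrow> pathin X (\<alpha> v) \<and> \<alpha> v 0 = v \<and> \<alpha> v 1 = x0"
    and triv: "homeomorphic_maps (subtopology E {e \<in> topspace E. p e \<in> V})
       (prod_topology (subtopology X V) F) (\<lambda>e. (p e, e \<cdot> \<alpha> (p e))) (\<lambda>(v, f). f \<cdot> (\<lambda>t. \<alpha> v (1 - t)))"
    by (rule local_trivialization[OF path_connected locally_contractible x0 x]) (rule that)
  define P where "P = {e \<in> topspace E. p e \<in> V}"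
  \<comment> \<open>\<tau> is the fibre coordinate of the trivialization, \<open>s f\<close> the
    section of constant coordinate \<open>f\<close>, and \<open>S f\<close> the saturated open tube
    of points whose coordinate is related to \<open>f\<close>; its image will be a sheet.\<close>
  define \<tau> where "\<tau> = (\<lambda>e. e \<cdot> \<alpha> (p e))"
  define s where "s = (\<lambda>f v. f \<cdot> (\<lambda>t. \<alpha> v (1 - t)))"
  define S where "S = (\<lambda>f. {e \<in> P. \<tau> e \<in> R `` {f}})"
  have VX: "V \<subseteq> topspace X" using openin_subset[OF V(1)] .
  have PE: "P \<subseteq> topspace E" by (auto simp: P_def)
  have P: "openin E P" unfolding P_def using openin_continuous_map_preimage[OF continuous_p V(1)] .
  have triv': "continuous_map (subtopology E P) F \<tau>"
    "continuous_map (prod_topology (subtopology X V) F) (subtopology E P) (\<lambda>z. s (snd z) (fst z))"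
    using triv unfolding homeomorphic_maps_def continuous_map_pairwise P_def[symmetric]
    by (simp_all add: o_def \<tau>_def s_def case_prod_unfold)
  have \<tau>_in: "\<tau> e \<in> fibre_set E p x0" if "e \<in> P" for e
    using that \<alpha>[of "p e"] lift_end[of e "\<alpha> (p e)"] by (simp add: P_def \<tau>_def)
  have s: "s f v \<in> P" "p (s f v) = v" "\<tau> (s f v) = f" if "f \<in> fibre_set E p x0" "v \<in> V" for f v
    using that \<alpha>[of v] lift_end[of f "\<lambda>t. \<alpha> v (1 - t)"] pathin_reverse[of X "\<alpha> v"] lift_end_reverse'[of f "\<alpha> v"]
    by (simp_all add: P_def \<tau>_def s_def)
  have s\<tau>: "s (\<tau> e) (p e) = e" if "e \<in> P" for e
    using that \<alpha>[of "p e"] lift_end_reverse[of e "\<alpha> (p e)"] by (simp add: P_def \<tau>_def s_def)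
  have \<tau>_R: "(\<tau> e, \<tau> e') \<in> R" if "e \<in> P" "(e, e') \<in> R" for e e'
    using covering_relationD(3)[OF R that(2), of "\<alpha> (p e)"] covering_relationD(2)[OF R that(2)] that(1) \<alpha>[of "p e"]
    by (simp add: P_def \<tau>_def)
  have SE: "S f \<subseteq> topspace E" for f using PE by (auto simp: S_def)
  have S_open: "openin E (S f)" if f: "f \<in> fibre_set E p x0" for f
  proof -
    have "topspace (subtopology E P) = P" using PE by auto
    with openin_continuous_map_preimage[OF triv'(1) covering_relationD(5)[OF R f]]
    have "openin (subtopology E P) (S f)" unfolding S_def by (simp only:)
    then show ?thesis using P openin_open_subtopology by blast
  qed
  have S_sat: "e' \<in> S f" if e: "e \<in> S f" and ee': "(e, e') \<in> R" for e e' f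
  proof -
    have eP: "e \<in> P" and ef: "(f, \<tau> e) \<in> R" using e by (auto simp: S_def)
    have "e' \<in> P" using eP covering_relationD(2,7)[OF R ee'] by (auto simp: P_def)
    then show ?thesis using covering_relation_trans[OF R ef \<tau>_R[OF eP ee']] by (simp add: S_def)
  qed
  have S_img: "R `` {e} \<in> ?\<pi> ` S f \<longleftrightarrow> e \<in> S f" if "e \<in> topspace E" for e f
    by (rule class_in_image_iff[OF equiv SE _ that]) (rule S_sat)
  \<comment> \<open>Related points \<open>f\<close> give the same tube, so sheets are indexed with
    repetition; \<open>pairwise\<close> concerns distinct sets only.\<close>
  let ?\<V> = "(\<lambda>f. ?\<pi> ` S f) ` fibre_set E p x0"
  have "\<Union>?\<V> = {c \<in> topspace ?Q. class_proj c \<in> V}"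
  proof (intro subset_antisym subsetI)
    fix c assume "c \<in> \<Union>?\<V>"
    then obtain f e where "e \<in> S f" "c = ?\<pi> e" by blast
    then show "c \<in> {c \<in> topspace ?Q. class_proj c \<in> V}"
      using class_proj[OF R, of e] by (simp add: S_def P_def quotientI)
  next
    fix c assume c: "c \<in> {c \<in> topspace ?Q. class_proj c \<in> V}"
    then have "c \<in> topspace E // R" by simp
    then obtain e where e: "e \<in> topspace E" "c = ?\<pi> e" by (rule quotientE) (rule that)
    then have eP: "e \<in> P" using c class_proj[OF R e(1)] by (simp add: P_def)
    have "e \<in> S (\<tau> e)" using eP covering_relation_refl[OF R, of "\<tau> e"] \<tau>_in[OF eP] by (simp add: S_def)
    then show "c \<in> \<Union>?\<V>" using e(2) \<tau>_in[OF eP] by blast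
  qed
  moreover have "pairwise disjnt ?\<V>"
    unfolding pairwise_image
  proof (rule pairwiseI, rule impI)
    fix f g assume f: "f \<in> fibre_set E p x0" and g: "g \<in> fibre_set E p x0" and ne: "?\<pi> ` S f \<noteq> ?\<pi> ` S g"
    show "disjnt (?\<pi> ` S f) (?\<pi> ` S g)"
    proof (rule ccontr)
      assume "\<not> disjnt (?\<pi> ` S f) (?\<pi> ` S g)"
      then obtain e where e: "e \<in> S f" "?\<pi> e \<in> ?\<pi> ` S g" unfolding disjnt_iff by blast
      then have "e \<in> S g" using S_img SE by blast
      then have "(f, \<tau> e) \<in> R" "(g, \<tau> e) \<in> R" using e(1) by (auto simp: S_def)
      then have "(f, g) \<in> R" using covering_relation_sym[OF R] covering_relation_trans[OF R] by blast
      then have "R `` {f} = R `` {g}" using class_eq_iff[OF R] f g by simp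
      then have "S f = S g" unfolding S_def by (simp only:)
      then show False using ne by simp
    qed
  qed
  moreover have "openin ?Q (?\<pi> ` S f) \<and> homeomorphic_map (subtopology ?Q (?\<pi> ` S f)) (subtopology X V) class_proj"
    if f: "f \<in> fibre_set E p x0" for f
  proof
    show op: "openin ?Q (?\<pi> ` S f)" by (rule openin_class_image[OF equiv S_open[OF f]]) (rule S_sat)
    have "homeomorphic_maps (subtopology ?Q (?\<pi> ` S f)) (subtopology X V) class_proj (\<lambda>v. ?\<pi> (s f v))"
      unfolding homeomorphic_maps_def
    proof (intro conjI ballI)
      show "continuous_map (subtopology ?Q (?\<pi> ` S f)) (subtopology X V) class_proj"
        unfolding continuous_map_in_subtopology
      proof
        show "continuous_map (subtopology ?Q (?\<pi> ` S f)) X class_proj"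
          using cont by (rule continuous_map_from_subtopology)
        show "class_proj \<in> topspace (subtopology ?Q (?\<pi> ` S f)) \<rightarrow> V"
          using class_proj[OF R] by (auto simp: S_def P_def)
      qed
      have "continuous_map (subtopology X V) (prod_topology (subtopology X V) F) (\<lambda>v. (v, f))"
        using f by (intro continuous_map_pairedI) auto
      from continuous_map_compose[OF this triv'(2)]
      have "continuous_map (subtopology X V) E (\<lambda>v. s f v)"
        by (simp add: continuous_map_in_subtopology o_def)
      from continuous_map_compose[OF this continuous_class]
      have "continuous_map (subtopology X V) ?Q (\<lambda>v. ?\<pi> (s f v))" by (simp add: o_def)
      moreover have "s f v \<in> S f" if "v \<in> V" for v
        using s[OF f that] covering_relation_refl[OF R, of f] f by (simp add: S_def)
      ultimately show "continuous_map (subtopology X V) (subtopology ?Q (?\<pi> ` S f)) (\<lambda>v. ?\<pi> (s f v))"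
        by (auto simp: continuous_map_in_subtopology)
    next
      fix c assume "c \<in> topspace (subtopology ?Q (?\<pi> ` S f))"
      then have "c \<in> ?\<pi> ` S f" by simp
      then obtain e where e: "e \<in> S f" "c = ?\<pi> e" by blast
      have eP: "e \<in> P" and ef: "(f, \<tau> e) \<in> R" using e(1) by (auto simp: S_def)
      have eE: "e \<in> topspace E" and pe: "p e \<in> V" using eP by (auto simp: P_def)
      have pf: "p f = x0" using f by simp
      \<comment> \<open>\<open>e\<close> is recovered as \<open>s (\<tau> e) (p e)\<close>, and
        transport along the reverse of \<open>\<alpha> (p e)\<close> preserves the relation between
        \<open>f\<close> and \<open>\<tau> e\<close>.\<close>
      have "(s f (p e), s (\<tau> e) (p e)) \<in> R"
        unfolding s_def using covering_relationD(3)[OF R ef] \<alpha>[OF pe] pathin_reverse[of X "\<alpha> (p e)"] pf by simp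
      then have "?\<pi> (s f (p e)) = ?\<pi> e"
        using s\<tau>[OF eP] class_eq_iff[OF R, of "s f (p e)" e] covering_relationD(6)[OF R] eE by simp
      then show "?\<pi> (s f (class_proj c)) = c" using e(2) class_proj[OF R eE] by simp
    next
      fix v assume "v \<in> topspace (subtopology X V)"
      then have v: "v \<in> V" by simp
      then show "class_proj (?\<pi> (s f v)) = v"
        using s[OF f v] class_proj[OF R, of "s f v"] PE by auto
    qed
    then show "homeomorphic_map (subtopology ?Q (?\<pi> ` S f)) (subtopology X V) class_proj"
      unfolding homeomorphic_map_maps by blast
  qed
  ultimately show "\<exists>U. openin X U \<and> x \<in> U \<and> (\<exists>\<V>. \<Union>\<V> = {e \<in> topspace ?Q. class_proj e \<in> U} \<and>
      pairwise disjnt \<V> \<and> (\<forall>V\<in>\<V>. openin ?Q V \<and> homeomorphic_map (subtopology ?Q V) (subtopology X U) class_proj))"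
    using V by (intro exI[of _ V] conjI exI[of _ ?\<V>]) simp_all
qed

text \<open>Transport along a path from \<open>x\<close> to \<open>x0\<close> is injective on
  classes, being undone by the reverse path; so finiteness over \<open>x0\<close> gives finiteness
  over \<open>x\<close>.\<close>

lemma finite_fibres_quotient:
  assumes R: "covering_relation R" and x: "x \<in> topspace X"
  shows "finite (fibre_set (quotient_space E R) class_proj x)"
proof -
  obtain \<alpha> where \<alpha>: "pathin X \<alpha>" "\<alpha> 0 = x" "\<alpha> 1 = x0" using path_to[OF x] .
  have in_F: "e \<cdot> \<alpha> \<in> fibre_set E p x0" if "e \<in> fibre_set E p x" for e
    using that lift_end[of e \<alpha>] \<alpha> by simp
  then have "(\<lambda>e. R `` {e \<cdot> \<alpha>}) ` fibre_set E p x \<subseteq> (\<lambda>f. R `` {f}) ` fibre_set E p x0" by blast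
  then have "finite ((\<lambda>e. R `` {e \<cdot> \<alpha>}) ` fibre_set E p x)"
    using finite_classes[OF R] by (rule finite_subset)
  then have "finite ((\<lambda>e. R `` {e}) ` fibre_set E p x)"
  proof (rule finite_image_factor)
    fix e e' assume e: "e \<in> fibre_set E p x" "e' \<in> fibre_set E p x" and eq: "R `` {e \<cdot> \<alpha>} = R `` {e' \<cdot> \<alpha>}"
    then have "(e \<cdot> \<alpha>, e' \<cdot> \<alpha>) \<in> R" using class_eq_iff[OF R, of "e \<cdot> \<alpha>" "e' \<cdot> \<alpha>"] in_F by simp
    then have "(e, e') \<in> R" using transport_cancel[OF R _ _ _ \<alpha>(1)] e \<alpha>(2) by simp
    then show "R `` {e} = R `` {e'}" using class_eq_iff[OF R] e by simp
  qed
  moreover have "fibre_set (quotient_space E R) class_proj x \<subseteq> (\<lambda>e. R `` {e}) ` fibre_set E p x"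
  proof
    fix c assume c: "c \<in> fibre_set (quotient_space E R) class_proj x"
    then have "c \<in> topspace E // R" by simp
    then obtain e where "e \<in> topspace E" "c = R `` {e}" by (rule quotientE) (rule that)
    then show "c \<in> (\<lambda>e. R `` {e}) ` fibre_set E p x" using c class_proj[OF R, of e] by auto
  qed
  ultimately show ?thesis by (rule finite_subset[rotated])
qed

text \<open>Invariance under the inverse deck transformation gives surjectivity onto the class. Thus
  \<phi> descends to the quotient as \<open>image \<phi>\<close>, which is how the quotient inherits
  regularity.\<close>

lemma deck_image_class:
  assumes R: "covering_relation R" and \<phi>: "\<phi> \<in> deck_transformations E p" and e: "e \<in> topspace E"
  shows "\<phi> ` (R `` {e}) = R `` {\<phi> e}"
proof -
  obtain \<psi> where \<psi>: "\<psi> \<in> deck_transformations E p" "\<And>e. e \<in> topspace E \<Longrightarrow> \<psi> (\<phi> e) = e"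
      "\<And>e. e \<in> topspace E \<Longrightarrow> \<phi> (\<psi> e) = e"
    by (rule deck_transformation_inverse[OF \<phi>]) (rule that)
  have "y \<in> \<phi> ` (R `` {e})" if "(\<phi> e, y) \<in> R" for y
  proof -
    have "(e, \<psi> y) \<in> R" using covering_relationD(4)[OF R \<psi>(1) that] \<psi>(2)[OF e] by simp
    moreover have "y = \<phi> (\<psi> y)" using \<psi>(3) covering_relationD(7)[OF R that] by simp
    ultimately show ?thesis by blast
  qed
  then show ?thesis using covering_relationD(4)[OF R \<phi>] by blast
qed

lemma regular_quotient:
  assumes R: "covering_relation R"
  shows "regular_projection (quotient_space E R) class_proj"
  unfolding regular_projection_def
proof (intro ballI impI)
  let ?Q = "quotient_space E R"
  fix c c' assume "c \<in> topspace ?Q" "c' \<in> topspace ?Q" and cc': "class_proj c = class_proj c'"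
  then obtain e e' where e: "e \<in> topspace E" "c = R `` {e}" and e': "e' \<in> topspace E" "c' = R `` {e'}"
    by (auto elim!: quotientE)
  then have "p e = p e'" using cc' class_proj[OF R] by simp
  then obtain \<phi> where \<phi>: "\<phi> \<in> deck_transformations E p" "\<phi> e = e'"
    using transitive[OF e(1) e'(1)] by blast
  obtain \<psi> where \<psi>: "\<psi> \<in> deck_transformations E p" "\<And>e. e \<in> topspace E \<Longrightarrow> \<psi> (\<phi> e) = e"
      "\<And>e. e \<in> topspace E \<Longrightarrow> \<phi> (\<psi> e) = e"
    by (rule deck_transformation_inverse[OF \<phi>(1)]) (rule that)
  have cont: "continuous_map ?Q ?Q (image \<phi>)" if "\<phi> \<in> deck_transformations E p" for \<phi>
  proof (rule continuous_map_from_quotient_space)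
    show "continuous_map E ?Q (\<lambda>e. R `` {\<phi> e})"
      using continuous_map_compose[OF deck_transformationD(1)[OF that] continuous_class] by (simp add: o_def)
  qed (rule deck_image_class[OF R that])
  have class_sub: "C \<subseteq> topspace E" if "C \<in> topspace ?Q" for C
    using in_quotient_imp_subset[OF covering_relationD(1)[OF R]] that by simp
  have "homeomorphic_maps ?Q ?Q (image \<phi>) (image \<psi>)"
    unfolding homeomorphic_maps_def
  proof (intro conjI ballI cont \<phi>(1) \<psi>(1))
    fix C assume "C \<in> topspace ?Q"
    then have "\<psi> (\<phi> x) = x" "\<phi> (\<psi> x) = x" if "x \<in> C" for x
      using class_sub \<psi>(2,3) that by blast+
    then show "\<psi> ` \<phi> ` C = C" "\<phi> ` \<psi> ` C = C"
      by (simp_all add: image_image cong: image_cong_simp)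
  qed
  moreover have "class_proj (\<phi> ` C) = class_proj C" if "C \<in> topspace ?Q" for C
  proof -
    have "C \<in> topspace E // R" using that by simp
    then obtain a where a: "a \<in> topspace E" "C = R `` {a}" by (rule quotientE) (rule that)
    then show ?thesis
      using deck_image_class[OF R \<phi>(1) a(1)] class_proj[OF R] deck_transformationD(2,3)[OF \<phi>(1)] by simp
  qed
  ultimately have "image \<phi> \<in> deck_transformations ?Q class_proj"
    unfolding deck_transformations_def homeomorphic_map_maps by blast
  moreover have "\<phi> ` c = c'" using deck_image_class[OF R \<phi>(1) e(1)] e(2) e'(2) \<phi>(2) by simp
  ultimately show "\<exists>\<phi>\<in>deck_transformations ?Q class_proj. \<phi> c = c'" by blast
qed

text \<open>Every class meets the leaf of \<open>e0\<close>. Move \<open>e\<close> to the fibre over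
  \<open>x0\<close>: its class there is open and contains a point of the dense orbit of
  \<open>e0\<close>; transporting this point back along the reverse path stays in the leaf and
  arrives in the class of \<open>e\<close>.\<close>

lemma path_connected_quotient:
  assumes R: "covering_relation R"
  shows "path_connected_space (quotient_space E R)"
proof -
  let ?Q = "quotient_space E R"
  have "path_component_of ?Q (R `` {e0}) c" if "c \<in> topspace ?Q" for c
  proof -
    have "c \<in> topspace E // R" using that by simp
    then obtain e where e: "e \<in> topspace E" "c = R `` {e}" by (rule quotientE) (rule that)
    obtain \<alpha> where \<alpha>: "pathin X \<alpha>" "\<alpha> 0 = p e" "\<alpha> 1 = x0" using path_to[OF p_in[OF e(1)]] .
    have eF: "e \<cdot> \<alpha> \<in> fibre_set E p x0" using lift_end[OF e(1) \<alpha>(1,2)] \<alpha>(3) by simp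
    have "e \<cdot> \<alpha> \<in> F closure_of (class_endpoint E p e0 ` carrier G)"
      using dense_monodromy_orbit[OF e0] eF by simp
    moreover have "e \<cdot> \<alpha> \<in> R `` {e \<cdot> \<alpha>}" using covering_relation_refl[OF R] eF by simp
    ultimately obtain y where y: "y \<in> class_endpoint E p e0 ` carrier G" "(e \<cdot> \<alpha>, y) \<in> R"
      using covering_relationD(5)[OF R eF] unfolding in_closure_of by blast
    then obtain \<beta> where \<beta>: "\<beta> \<in> loops X x0" "y = e0 \<star> loop_class X \<beta>"
      by (auto simp: carrier_fundamental_group)
    then have y_eq: "y = e0 \<cdot> \<beta>" using class_endpoint_eq[of e0 \<beta>] e0 by simp
    have yF: "y \<in> topspace E" "p y = x0" "path_component_of E e0 y"
      using lift_end[of e0 \<beta>] \<beta>(1) e0 y_eq by (auto simp: loops_def)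
    let ?\<alpha> = "\<lambda>t. \<alpha> (1 - t)"
    have "(e \<cdot> \<alpha> \<cdot> ?\<alpha>, y \<cdot> ?\<alpha>) \<in> R"
      using covering_relationD(3)[OF R y(2) pathin_reverse[OF \<alpha>(1)]] eF \<alpha>(3) by simp
    then have z: "(e, y \<cdot> ?\<alpha>) \<in> R" using lift_end_reverse[OF e(1) \<alpha>(1,2)] by simp
    have "path_component_of E y (y \<cdot> ?\<alpha>)"
      using lift_end(3)[OF yF(1) pathin_reverse[OF \<alpha>(1)]] yF(2) \<alpha>(3) by simp
    then have "path_component_of E e0 (y \<cdot> ?\<alpha>)" using yF(3) path_component_of_trans by metis
    then obtain \<gamma> where \<gamma>: "pathin E \<gamma>" "\<gamma> 0 = e0" "\<gamma> 1 = y \<cdot> ?\<alpha>" unfolding path_component_of_def by blast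
    have "R `` {y \<cdot> ?\<alpha>} = c" using class_eq_iff[OF R e(1) covering_relationD(7)[OF R z]] z e(2) by simp
    then show ?thesis
      using pathin_compose[OF \<gamma>(1) continuous_class[of E R]] \<gamma>(2,3)
      unfolding path_component_of_def by (intro exI[of _ "(\<lambda>e. R `` {e}) \<circ> \<gamma>"]) simp
  qed
  then show ?thesis
    unfolding path_connected_space_iff_path_component
    using path_component_of_sym path_component_of_trans by metis
qed

lemma finite_regular_quotient:
  assumes "covering_relation R"
  shows "finite_regular_covering (quotient_space E R) X class_proj"
  using assms covering_quotient finite_fibres_quotient regular_quotient
  by (simp add: finite_regular_covering_def)


section \<open>The limit of the finite regular coverings\<close>

lemma Image_class:
  assumes "covering_relation R" "covering_relation S" "S \<subseteq> R" "e \<in> topspace E"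
  shows "R `` (S `` {e}) = R `` {e}"
  using covering_relation_refl[OF assms(2,4)] covering_relation_trans[OF assms(1)] assms(3) by blast

lemma inverse_system_quotients:
  "inverse_system (Collect covering_relation) (\<lambda>R S. S \<subseteq> R) (quotient_space E) (\<lambda>R S c. R `` c)"
  unfolding inverse_system_def directed_set_def
proof (intro conjI ballI allI impI)
  show "Collect covering_relation \<noteq> {}" using covering_relation_fibres by blast
  show "\<exists>S\<in>Collect covering_relation. S \<subseteq> R \<and> S \<subseteq> R'"
    if "R \<in> Collect covering_relation" "R' \<in> Collect covering_relation" for R R'
    using that covering_relation_Int by (intro bexI[of _ "R \<inter> R'"]) auto
  show "continuous_map (quotient_space E S) (quotient_space E R) (\<lambda>c. R `` c)"
    if "R \<in> Collect covering_relation" "S \<in> Collect covering_relation" "S \<subseteq> R" for R S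
    using that Image_class by (intro continuous_map_from_quotient_space[OF continuous_class]) auto
  show "R `` c = c" if "R \<in> Collect covering_relation" "c \<in> topspace (quotient_space E R)" for R c
    using that Image_class[of R R] by (auto elim!: quotientE)
  show "R `` (S `` c) = R `` c"
    if "R \<in> Collect covering_relation" "S \<in> Collect covering_relation" "S' \<in> Collect covering_relation"
      "S \<subseteq> R \<and> S' \<subseteq> S" "c \<in> topspace (quotient_space E S')" for R S S' c
  proof -
    have "c \<in> topspace E // S'" using that by simp
    then obtain e where "e \<in> topspace E" "c = S' `` {e}" by (rule quotientE) (rule that)
    moreover have "S' \<subseteq> R" using that by blast
    ultimately have "S `` c = S `` {e}" "R `` c = R `` {e}" "R `` (S `` {e}) = R `` {e}"
      using that Image_class[of S S' e] Image_class[of R S' e] Image_class[of R S e] by simp_all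
    then show ?thesis by simp
  qed
qed auto

abbreviation L where
  "L \<equiv> inverse_limit (Collect covering_relation) (\<lambda>R S. S \<subseteq> R) (quotient_space E) (\<lambda>R S c. R `` c)"

definition class_family :: "'e \<Rightarrow> ('e \<times> 'e) set \<Rightarrow> 'e set" where
  "class_family e = (\<lambda>R\<in>Collect covering_relation. R `` {e})"

lemma continuous_class_family: "continuous_map E L class_family"
  unfolding continuous_map_into_inverse_limit_iff topspace_inverse_limit
proof (intro conjI ballI image_subsetI)
  show "class_family e \<in> {z \<in> \<Pi>\<^sub>E R\<in>Collect covering_relation. topspace (quotient_space E R).
      \<forall>R\<in>Collect covering_relation. \<forall>S\<in>Collect covering_relation. S \<subseteq> R \<longrightarrow> R `` z S = z R}"
    if "e \<in> topspace E" for e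
    using that Image_class by (auto simp: class_family_def quotientI)
  show "continuous_map E (quotient_space E R) (\<lambda>e. class_family e R)" if "R \<in> Collect covering_relation" for R
    using that continuous_class[of E R] by (simp add: class_family_def)
qed

text \<open>The fibre relation puts points with equal families over one point of \<open>X\<close>.
  Transport to the fibre over \<open>x0\<close> keeps them distinct, and there the Hausdorff
  property and a small covering relation separate them.\<close>

lemma inj_class_family: "inj_on class_family (topspace E)"
proof (rule inj_onI, rule ccontr)
  fix e e' assume e: "e \<in> topspace E" "e' \<in> topspace E" and eq: "class_family e = class_family e'" and ne: "e \<noteq> e'"
  have R: "(e, e') \<in> R" if "covering_relation R" for R
    using fun_cong[OF eq, of R] that class_eq_iff[OF that e] by (simp add: class_family_def)
  have pe: "p e = p e'" using covering_relationD(2)[OF covering_relation_fibres R[OF covering_relation_fibres]] .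
  obtain \<alpha> where \<alpha>: "pathin X \<alpha>" "\<alpha> 0 = p e" "\<alpha> 1 = x0" using path_to[OF p_in[OF e(1)]] .
  have F: "e \<cdot> \<alpha> \<in> topspace F" "e' \<cdot> \<alpha> \<in> topspace F" using lift_end[OF _ \<alpha>(1)] e pe \<alpha>(2,3) by simp_all
  have \<alpha>e': "\<alpha> 0 = p e'" using \<alpha>(2) pe by simp
  have "e \<cdot> \<alpha> \<noteq> e' \<cdot> \<alpha>"
    using lift_end_reverse[OF e(1) \<alpha>(1,2)] lift_end_reverse[OF e(2) \<alpha>(1) \<alpha>e'] ne by auto
  moreover have "closedin F {e' \<cdot> \<alpha>}" using closedin_Hausdorff_sing_eq[OF Hausdorff_fibre, of "e' \<cdot> \<alpha>"] F(2) by (simp only:)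
  ultimately have W: "openin F (topspace F - {e' \<cdot> \<alpha>})" "e \<cdot> \<alpha> \<in> topspace F - {e' \<cdot> \<alpha>}"
    using F(1) by (auto simp: closedin_def)
  obtain R where R': "covering_relation R" "R `` {e \<cdot> \<alpha>} \<subseteq> topspace F - {e' \<cdot> \<alpha>}"
    by (rule small_covering_relation[OF W]) (rule that)
  have "(e \<cdot> \<alpha>, e' \<cdot> \<alpha>) \<in> R" using covering_relationD(3)[OF R'(1) R[OF R'(1)] \<alpha>(1,2)] .
  then show False using R'(2) by blast
qed

lemma closed_class:
  assumes R: "covering_relation R" and f: "f \<in> fibre_set E p x0"
  shows "closedin F (R `` {f})"
proof -
  let ?\<U> = "(\<lambda>g. R `` {g}) ` {g \<in> fibre_set E p x0. (f, g) \<notin> R}"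
  have in_F: "h \<in> fibre_set E p x0" if "g \<in> fibre_set E p x0" "(g, h) \<in> R" for g h
    using that covering_relationD(2,7)[OF R that(2)] by simp
  have "openin F (\<Union>?\<U>)" using covering_relationD(5)[OF R] by (intro openin_Union) blast
  moreover have "h \<in> topspace F - R `` {f} \<longleftrightarrow> h \<in> \<Union>?\<U>" for h
  proof
    assume "h \<in> topspace F - R `` {f}"
    then have "h \<in> fibre_set E p x0" "(f, h) \<notin> R" "(h, h) \<in> R" using covering_relation_refl[OF R, of h] by auto
    then show "h \<in> \<Union>?\<U>" by blast
  next
    assume "h \<in> \<Union>?\<U>"
    then obtain g where g: "g \<in> fibre_set E p x0" "(f, g) \<notin> R" "(g, h) \<in> R" by blast
    then have "(f, h) \<notin> R" using covering_relation_sym[OF R] covering_relation_trans[OF R] by blast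
    then show "h \<in> topspace F - R `` {f}" using in_F[OF g(1,3)] by simp
  qed
  then have "topspace F - R `` {f} = \<Union>?\<U>" by blast
  ultimately have "openin F (topspace F - R `` {f})" by (simp only:)
  moreover have "R `` {f} \<subseteq> topspace F" using in_F[OF f] by auto
  ultimately show ?thesis unfolding closedin_def by blast
qed

lemma lower_bound:
  assumes "finite K" "\<And>R. R \<in> K \<Longrightarrow> covering_relation R"
  obtains S where "covering_relation S" "\<And>R. R \<in> K \<Longrightarrow> S \<subseteq> R"
proof -
  have "\<exists>S. covering_relation S \<and> (\<forall>R\<in>K. S \<subseteq> R)"
    using assms
  proof (induction K rule: finite_induct)
    case empty then show ?case using covering_relation_fibres by blast
  next
    case (insert R K)
    then obtain S where "covering_relation S" "\<forall>R\<in>K. S \<subseteq> R" by blast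
    then show ?case using insert.prems covering_relation_Int[of R S] by (intro exI[of _ "R \<inter> S"]) auto
  qed
  then show ?thesis using that by blast
qed

text \<open>A point of the limit is a compatible family of classes; moved into the compact fibre over
  \<open>x0\<close>, these are closed sets with the finite intersection property.\<close>

lemma surj_class_family: "class_family ` topspace E = topspace L"
proof
  show "class_family ` topspace E \<subseteq> topspace L"
    using continuous_map_image_subset_topspace[OF continuous_class_family] .
  show "topspace L \<subseteq> class_family ` topspace E"
  proof
    fix z assume "z \<in> topspace L"
    then have z_in: "\<And>R. covering_relation R \<Longrightarrow> z R \<in> topspace E // R"
      and z_ext: "z \<in> extensional (Collect covering_relation)"
      and z_comp: "\<And>R S. covering_relation R \<Longrightarrow> covering_relation S \<Longrightarrow> S \<subseteq> R \<Longrightarrow> R `` z S = z R"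
      by (auto simp: topspace_inverse_limit PiE_iff)
    define R0 where "R0 = {(e, e'). e \<in> topspace E \<and> e' \<in> topspace E \<and> p e = p e'}"
    have R0: "covering_relation R0" unfolding R0_def by (rule covering_relation_fibres)
    obtain e1 where e1: "e1 \<in> topspace E" "z R0 = R0 `` {e1}" using z_in[OF R0] by (rule quotientE) (rule that)
    \<comment> \<open>Refining \<open>R\<close> by the fibre relation \<open>R0\<close> and using
      compatibility with both, all classes of the family get representatives over the same point
      \<open>p e1\<close>.\<close>
    have z_class: "\<exists>e. e \<in> topspace E \<and> p e = p e1 \<and> z R = R `` {e}" if R: "covering_relation R" for R
    proof -
      let ?S = "R \<inter> R0"
      have S: "covering_relation ?S" using covering_relation_Int[OF R R0] .
      obtain e where e: "e \<in> topspace E" "z ?S = ?S `` {e}" using z_in[OF S] by (rule quotientE) (rule that)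
      have "R0 `` {e} = R0 `` {e1}" using z_comp[OF R0 S] Image_class[OF R0 S _ e(1)] e(2) e1(2) by simp
      then have "p e = p e1" using class_eq_iff[OF R0 e(1) e1(1)] covering_relationD(2)[OF R0] by blast
      moreover have "z R = R `` {e}" using z_comp[OF R S] Image_class[OF R S _ e(1)] e(2) by simp
      ultimately show ?thesis using e(1) by blast
    qed
    obtain \<alpha> where \<alpha>: "pathin X \<alpha>" "\<alpha> 0 = p e1" "\<alpha> 1 = x0" using path_to[OF p_in[OF e1(1)]] .
    let ?\<alpha> = "\<lambda>t. \<alpha> (1 - t)"
    \<comment> \<open>\<open>C R\<close> is the class \<open>z R\<close> carried to the fibre over
      \<open>x0\<close> along \<alpha>, described through the reverse path.\<close>
    define C where "C = (\<lambda>R. {f \<in> fibre_set E p x0. f \<cdot> ?\<alpha> \<in> z R})"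
    have C_class: "\<exists>f\<in>fibre_set E p x0. C R = R `` {f}" if R: "covering_relation R" for R
    proof -
      obtain e where e: "e \<in> topspace E" "p e = p e1" "z R = R `` {e}" using z_class[OF R] by blast
      have \<alpha>e: "\<alpha> 0 = p e" using \<alpha>(2) e(2) by simp
      have f: "e \<cdot> \<alpha> \<in> fibre_set E p x0" using lift_end[OF e(1) \<alpha>(1) \<alpha>e] \<alpha>(3) by simp
      have "(e \<cdot> \<alpha>, g) \<in> R \<longleftrightarrow> (e, g \<cdot> ?\<alpha>) \<in> R" if g: "g \<in> fibre_set E p x0" for g
      proof
        assume "(e \<cdot> \<alpha>, g) \<in> R"
        then have "(e \<cdot> \<alpha> \<cdot> ?\<alpha>, g \<cdot> ?\<alpha>) \<in> R"
          using covering_relationD(3)[OF R _ pathin_reverse[OF \<alpha>(1)]] f \<alpha>(3) by simp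
        then show "(e, g \<cdot> ?\<alpha>) \<in> R" using lift_end_reverse[OF e(1) \<alpha>(1) \<alpha>e] by simp
      next
        assume "(e, g \<cdot> ?\<alpha>) \<in> R"
        then have "(e \<cdot> \<alpha>, g \<cdot> ?\<alpha> \<cdot> \<alpha>) \<in> R"
          using covering_relationD(3)[OF R _ \<alpha>(1)] \<alpha>e by simp
        then show "(e \<cdot> \<alpha>, g) \<in> R" using lift_end_reverse'[of g \<alpha>] g \<alpha>(1,3) by simp
      qed
      moreover have "g \<in> fibre_set E p x0" if "(e \<cdot> \<alpha>, g) \<in> R" for g
        using covering_relationD(2,7)[OF R that] f by simp
      ultimately have "C R = R `` {e \<cdot> \<alpha>}" unfolding C_def e(3) by blast
      then show ?thesis using f by blast
    qed
    have "\<Inter>(C ` Collect covering_relation) \<noteq> {}"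
    proof -
      have closed: "\<forall>D\<in>C ` Collect covering_relation. closedin F D"
        using C_class closed_class by fastforce
      have "\<Inter>\<F> \<noteq> {}" if \<F>: "finite \<F>" "\<F> \<subseteq> C ` Collect covering_relation" for \<F>
      proof -
        obtain K where K: "K \<subseteq> Collect covering_relation" "finite K" "\<F> = C ` K"
          using finite_subset_image[OF \<F>] by blast
        \<comment> \<open>For a common refinement \<open>S\<close>, compatibility gives
          \<open>z S \<subseteq> z R\<close>, so a point of \<open>C S\<close> lies in all the
          finitely many sets.\<close>
        obtain S where S: "covering_relation S" "\<And>R. R \<in> K \<Longrightarrow> S \<subseteq> R"
          using lower_bound[OF K(2)] K(1) by blast
        obtain f where f: "f \<in> fibre_set E p x0" "C S = S `` {f}" using C_class[OF S(1)] by blast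
        then have fS: "f \<in> C S" using covering_relation_refl[OF S(1), of f] by simp
        have "f \<in> C R" if "R \<in> K" for R
        proof -
          have R: "covering_relation R" using that K(1) by blast
          have "z S \<subseteq> topspace E" using in_quotient_imp_subset[OF covering_relationD(1)[OF S(1)] z_in[OF S(1)]] .
          then have "z S \<subseteq> R `` z S" using covering_relation_refl[OF R] by blast
          then have "z S \<subseteq> z R" using z_comp[OF R S(1) S(2)[OF that]] by simp
          then show ?thesis using fS by (auto simp: C_def)
        qed
        then show ?thesis using K(3) by blast
      qed
      then have fip: "\<forall>\<F>. finite \<F> \<and> \<F> \<subseteq> C ` Collect covering_relation \<longrightarrow> \<Inter>\<F> \<noteq> {}"
        by (intro allI impI) (elim conjE)
      show ?thesis
        by (rule compact_fibre[unfolded compact_space_fip, THEN spec, THEN mp]) (intro conjI closed fip)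
    qed
    then obtain f where f: "\<And>R. covering_relation R \<Longrightarrow> f \<in> C R" by blast
    define e where "e = f \<cdot> ?\<alpha>"
    have "f \<in> fibre_set E p x0" using f[OF R0] by (simp add: C_def)
    then have e: "e \<in> topspace E"
      unfolding e_def using lift_end(1)[of f ?\<alpha>] pathin_reverse[OF \<alpha>(1)] \<alpha>(3) by simp
    have "z R = R `` {e}" if R: "covering_relation R" for R
    proof -
      obtain e' where e': "e' \<in> topspace E" "z R = R `` {e'}" using z_in[OF R] by (rule quotientE) (rule that)
      have "e \<in> z R" using f[OF R] by (simp add: C_def e_def)
      then show ?thesis using e' e class_eq_iff[OF R e'(1) e] by simp
    qed
    then have "z = class_family e"
      using z_ext by (auto simp: class_family_def extensional_def fun_eq_iff)
    then show "z \<in> class_family ` topspace E" using e by blast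
  qed
qed

text \<open>A product box around \<open>e\<close> inside \<open>W\<close> is shrunk in the fibre
  direction to a class of a small covering relation \<open>R\<close>. The resulting open set is
  saturated for \<open>R\<close>, so the single coordinate \<open>R\<close> of the limit detects
  it.\<close>

lemma open_map_class_family: "open_map E L class_family"
  unfolding open_map_def
proof (intro allI impI)
  fix W assume W: "openin E W"
  have "\<exists>S. openin L S \<and> class_family e \<in> S \<and> S \<subseteq> class_family ` W" if eW: "e \<in> W" for e
  proof -
    have e: "e \<in> topspace E" using eW openin_subset[OF W] by blast
    obtain V \<alpha> where V: "openin X V" "p e \<in> V"
      and \<alpha>: "\<And>v. v \<in> V \<Longrightarrow> pathin X (\<alpha> v) \<and> \<alpha> v 0 = v \<and> \<alpha> v 1 = x0"
      and triv: "homeomorphic_maps (subtopology E {e \<in> topspace E. p e \<in> V})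
         (prod_topology (subtopology X V) F) (\<lambda>e. (p e, e \<cdot> \<alpha> (p e))) (\<lambda>(v, f). f \<cdot> (\<lambda>t. \<alpha> v (1 - t)))"
      by (rule local_trivialization[OF path_connected locally_contractible x0 p_in[OF e]]) (rule that)
    define P where "P = {e \<in> topspace E. p e \<in> V}"
    define \<tau> where "\<tau> = (\<lambda>e. e \<cdot> \<alpha> (p e))"
    let ?\<theta> = "\<lambda>e. (p e, \<tau> e)" and ?VF = "prod_topology (subtopology X V) F"
    have P: "openin E P" unfolding P_def using openin_continuous_map_preimage[OF continuous_p V(1)] .
    have topP: "topspace (subtopology E P) = P" by (auto simp: P_def)
    have \<theta>: "homeomorphic_map (subtopology E P) ?VF ?\<theta>"
      using triv homeomorphic_maps_map unfolding P_def \<tau>_def by blast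
    have eP: "e \<in> P" using e V(2) by (simp add: P_def)
    have "openin (subtopology E P) (W \<inter> P)" using W by (rule openin_subtopology_Int)
    then have open_image: "openin ?VF (?\<theta> ` (W \<inter> P))"
      using homeomorphic_imp_open_map[OF \<theta>] unfolding open_map_def by blast
    have "?\<theta> e \<in> ?\<theta> ` (W \<inter> P)" using eW eP by blast
    from open_image[unfolded openin_prod_topology_alt, rule_format, OF this] obtain V' W' where V': "openin (subtopology X V) V'" "openin F W'" "p e \<in> V'" "\<tau> e \<in> W'"
        "V' \<times> W' \<subseteq> ?\<theta> ` (W \<inter> P)"
      by (elim exE conjE) (rule that)
    obtain R where R: "covering_relation R" "R `` {\<tau> e} \<subseteq> W'"
      by (rule small_covering_relation[OF V'(2,4)]) (rule that)
    have \<tau>e: "\<tau> e \<in> fibre_set E p x0" using V'(2,4) openin_subset[OF V'(2)] by auto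
    define S where "S = {a \<in> P. p a \<in> V' \<and> \<tau> a \<in> R `` {\<tau> e}}"
    have "openin ?VF (V' \<times> R `` {\<tau> e})"
      using V'(1) covering_relationD(5)[OF R(1) \<tau>e] by (simp add: openin_prod_Times_iff)
    from openin_continuous_map_preimage[OF homeomorphic_imp_continuous_map[OF \<theta>] this]
    have "openin (subtopology E P) S" unfolding topP S_def by simp
    then have S_open: "openin E S" using P openin_open_subtopology by blast
    have SE: "S \<subseteq> topspace E" by (auto simp: S_def P_def)
    have SW: "S \<subseteq> W"
    proof
      fix a assume a: "a \<in> S"
      then have aP: "a \<in> P" and "?\<theta> a \<in> V' \<times> W'" using R(2) by (auto simp: S_def)
      then obtain a' where a': "a' \<in> W \<inter> P" "?\<theta> a = ?\<theta> a'" using V'(5) by blast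
      then have "a = a'"
        using homeomorphic_imp_injective_map[OF \<theta>] aP unfolding topP by (meson IntD2 inj_onD)
      then show "a \<in> W" using a'(1) by blast
    qed
    have S_sat: "b \<in> S" if a: "a \<in> S" and ab: "(a, b) \<in> R" for a b
    proof -
      have aV: "p a \<in> V" "p a = p b" "b \<in> topspace E"
        using a covering_relationD(2,7)[OF R(1) ab] by (auto simp: S_def P_def)
      have "(\<tau> a, \<tau> b) \<in> R"
        using covering_relationD(3)[OF R(1) ab, of "\<alpha> (p a)"] \<alpha>[OF aV(1)] aV(2) by (simp add: \<tau>_def)
      then have "(\<tau> e, \<tau> b) \<in> R" using a covering_relation_trans[OF R(1)] by (auto simp: S_def)
      then show ?thesis using a aV by (auto simp: S_def P_def)
    qed
    have eS: "e \<in> S"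
      using eP V'(3) covering_relation_refl[OF R(1), of "\<tau> e"] \<tau>e by (simp add: S_def)
    let ?T = "{z \<in> topspace L. z R \<in> (\<lambda>e. R `` {e}) ` S}"
    have "continuous_map L (quotient_space E R) (\<lambda>z. z R)"
      unfolding inverse_limit_def using R(1)
      by (intro continuous_map_from_subtopology continuous_map_product_projection) simp
    moreover have "openin (quotient_space E R) ((\<lambda>e. R `` {e}) ` S)"
      by (rule openin_class_image[OF covering_relationD(1)[OF R(1)] S_open]) (rule S_sat)
    ultimately have "openin L ?T" by (rule openin_continuous_map_preimage)
    moreover have "class_family e \<in> ?T"
      using surj_class_family e eS R(1) by (auto simp: class_family_def)
    moreover have "?T \<subseteq> class_family ` W"
    proof
      fix z assume z: "z \<in> ?T"
      then have "z \<in> topspace L" by simp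
      then obtain a where a: "a \<in> topspace E" "z = class_family a" using surj_class_family by blast
      have "R `` {a} \<in> (\<lambda>e. R `` {e}) ` S" using z a(2) R(1) by (simp add: class_family_def)
      moreover have "R `` {a} \<in> (\<lambda>e. R `` {e}) ` S \<longleftrightarrow> a \<in> S"
        by (rule class_in_image_iff[OF covering_relationD(1)[OF R(1)] SE _ a(1)]) (rule S_sat)
      ultimately have "a \<in> S" by simp
      then show "z \<in> class_family ` W" using SW a(2) by blast
    qed
    ultimately show ?thesis by (intro exI[of _ ?T] conjI)
  qed
  then show "openin L (class_family ` W)"
    by (subst openin_subopen) blast
qed

theorem limit_of_quotients: "is_inverse_limit_of_finite_regular_coverings E X p"
  unfolding inverse_limit_of_finite_regular_coverings_def
proof (intro exI conjI ballI impI)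
  show "inverse_system (Collect covering_relation) (\<lambda>R S. S \<subseteq> R) (quotient_space E) (\<lambda>R S c. R `` c)"
    by (rule inverse_system_quotients)
  show "path_connected_space (quotient_space E R)" if "R \<in> Collect covering_relation" for R
    using that path_connected_quotient by simp
  show "finite_regular_covering (quotient_space E R) X class_proj" if "R \<in> Collect covering_relation" for R
    using that finite_regular_quotient by simp
  show "class_proj (R `` c) = class_proj c"
    if "R \<in> Collect covering_relation" "S \<in> Collect covering_relation" "S \<subseteq> R"
      "c \<in> topspace (quotient_space E S)" for R S c
    using that Image_class class_proj by (auto elim!: quotientE)
  show "homeomorphic_map E L class_family"
    using continuous_class_family open_map_class_family surj_class_family inj_class_family
    by (rule bijective_open_imp_homeomorphic_map)
  show "class_proj (class_family e R) = p e" if "e \<in> topspace E" "R \<in> Collect covering_relation" for e R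
    using that class_proj by (simp add: class_family_def)
qed

end

theorem mainTheorem1:
  fixes X :: "'x topology" and E :: "'e topology" and p :: "'e \<Rightarrow> 'x" and x0 :: 'x and e0 :: 'e
  assumes "path_connected_space X"
    and "locally_contractible_space X"
    and "x0 \<in> topspace X"
    and "residually_finite (fundamental_group X x0)"
    and "hurewicz_fibration E X p"
    and "\<And>x. x \<in> topspace X \<Longrightarrow> compact_space (fibre E p x)"
    and "\<And>x. x \<in> topspace X \<Longrightarrow> metrizable_space (fibre E p x)"
    and "\<And>x. x \<in> topspace X \<Longrightarrow> totally_path_disconnected_space (fibre E p x)"
    and "e0 \<in> topspace (fibre E p x0)"
  shows "(is_inverse_limit_of_finite_regular_coverings E X p \<longleftrightarrow>
            regular_projection E p \<and> pi1_profinite E X p x0 e0 \<and> has_dense_leaf E) \<and>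
         (inverse_limit_of_finite_regular_coverings TYPE('i) TYPE('t) E X p \<longrightarrow>
            is_inverse_limit_of_finite_regular_coverings E X p)"
proof -
  have lifting: "lifting_projection E X p"
    using assms(5,8) by (rule lifting_projection.intro)
  have e0: "e0 \<in> fibre_set E p x0" using assms(9) by simp
  note imp = lifting_projection.limit_of_coverings_imp[OF lifting _ e0]
  have conv: "is_inverse_limit_of_finite_regular_coverings E X p"
    if "regular_projection E p \<and> pi1_profinite E X p x0 e0 \<and> has_dense_leaf E"
  proof -
    have "profinite_projection E X p x0 e0"
      using lifting assms(1,2) assms(6,7)[OF assms(3)] e0 that
      by (simp add: profinite_projection_def profinite_projection_axioms_def metrizable_imp_Hausdorff_space)
    then show ?thesis by (rule profinite_projection.limit_of_quotients)
  qed
  \<comment> \<open>\<open>imp\<close> is instantiated at the canonical types and at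
    \<open>'i\<close>, \<open>'t\<close>. A limit over any types thus satisfies the three
    conditions, and \<open>conv\<close> leads from these to a canonical system.\<close>
  have "is_inverse_limit_of_finite_regular_coverings E X p \<Longrightarrow>
      regular_projection E p \<and> pi1_profinite E X p x0 e0 \<and> has_dense_leaf E"
    and "inverse_limit_of_finite_regular_coverings TYPE('i) TYPE('t) E X p \<Longrightarrow>
      regular_projection E p \<and> pi1_profinite E X p x0 e0 \<and> has_dense_leaf E"
    by (rule imp, assumption)+
  then show ?thesis using conv by blast
qed

end
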